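(* Let $(W,S)$ be a Coxeter group with $S$ finite. The assignment $\gamma_I\mapsto\beta_I(\beta_I^2)^{-1/2}$, for $I\subset S$ spherical, defines a morphism of groups $\phi:C_W\to\hat B_W$ from the cactus group to the completed braid group. Moreover $p_W\circ\phi=\pi_W$, where $p_W:\hat B_W\to W$ and $\pi_W:C_W\to W$ are the canonical surjections.
   Context: For $I\subset S$, $W_I=\langle I\rangle$; $I$ is spherical if $W_I$ is finite, and then $w_I$ denotes the longest element of $W_I$. **Cactus group.** $C_W$ is the group generated by $\gamma_I$ ($I\subset S$ spherical) with relations $\gamma_I^2=1$; $\gamma_I\gamma_J=\gamma_{I\cup J}$ if $W_{I\cup J}=W_I\times W_J$; $\gamma_I\gamma_J=\gamma_J\gamma_{w_J(I)}$ if $I\subset J$, where $w_J(I)=w_JIw_J$. The morphism $\pi_W:C_W\to W$ is given by $\gamma_I\mapsto w_I$. **Braid group.** $B_W$ is the braid group of $W$, generated by $(\beta_s)_{s\in S}$ with the braid relations $\beta_s\beta_t\beta_s\cdots=\beta_t\beta_s\beta_t\cdots$ ($m_{st}$ terms on each side, where $(m_{st})$ is the Coxeter matrix). For a reduced decomposition $w=s_1\cdots s_n$, $\beta_w=\beta_{s_1}\cdots\beta_{s_n}$ (independent of the decomposition). For $I$ spherical, $\beta_I=\beta_{w_I}$. The morphism $p_W:B_W\to W$ is $\beta_s\mapsto s$, and $P_W=\ker p_W$ is the pure braid group; $\beta_I^2\in P_W$. **Completions.** Let $\mathcal{I}$ be the augmentation ideal of $\mathbf{Q}[P_W]$, $\widehat{\mathbf{Q}[P_W]}$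 the completion of $\mathbf{Q}[P_W]$ at $\mathcal{I}$ (a complete cocommutative Hopf algebra) and $\hat P_W=\mathrm{Spec}(\widehat{\mathbf{Q}[P_W]}^* )$ the prounipotent completion of $P_W$, where $^*$ denotes the topological dual. Let $\mathcal{I}'$ be the kernel of $\mathbf{Q}[B_W]\to\mathbf{Q}[W]$ induced by $p_W$, $\widehat{\mathbf{Q}[B_W]}$ the completion of $\mathbf{Q}[B_W]$ at $\mathcal{I}'$ and $\hat B_W=\mathrm{Spec}(\widehat{\mathbf{Q}[B_W]}^* )$. This is a proalgebraic group, and $p_W$ extends to a surjective morphism $p_W:\hat B_W\to W$ with kernel $\hat P_W$. Elements of $\hat B_W$ (rational points) are viewed as invertible elements of $\widehat{\mathbf{Q}[B_W]}$. For $g\in P_W$ and $\alpha\in\mathbf{Q}$, $g^\alpha\in\hat P_W$ is the element corresponding to $\sum_{n\ge0}\binom{\alpha}{n}(g-1)^n\in\widehat{\mathbf{Q}[P_W]}$. *)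

theory Defs
  imports "HOL-Algebra.Algebra" "HOL-Library.Poly_Mapping"
begin

section \<open>Groups given by generators and relations\<close>

text \<open>
  A word over a set \<open>A\<close> of generators is a list of pairs \<open>(x, b)\<close>, where \<open>(x, True)\<close>
  stands for \<open>x\<close> and \<open>(x, False)\<close> for the formal inverse of \<open>x\<close>. A relation \<open>u = v\<close> is
  the pair \<open>(u, v)\<close> of words.
\<close>

type_synonym 'x gword = "('x \<times> bool) list"

abbreviation gwords :: "'x set \<Rightarrow> 'x gword set" where
  "gwords A \<equiv> lists (A \<times> UNIV)"

definition pos_word :: "'x list \<Rightarrow> 'x gword" where
  "pos_word xs = map (\<lambda>x. (x, True)) xs"

inductive_set word_cong :: "'x set \<Rightarrow> ('x gword \<times> 'x gword) set \<Rightarrow> ('x gword \<times> 'x gword) set"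
  for A R where
    refl: "u \<in> gwords A \<Longrightarrow> (u, u) \<in> word_cong A R"
  | sym: "(u, v) \<in> word_cong A R \<Longrightarrow> (v, u) \<in> word_cong A R"
  | trans: "\<lbrakk> (u, v) \<in> word_cong A R; (v, w) \<in> word_cong A R \<rbrakk> \<Longrightarrow> (u, w) \<in> word_cong A R"
  | cancel: "\<lbrakk> u \<in> gwords A; v \<in> gwords A; x \<in> A \<rbrakk>
      \<Longrightarrow> (u @ [(x, b), (x, \<not> b)] @ v, u @ v) \<in> word_cong A R"
  | rel: "\<lbrakk> u \<in> gwords A; v \<in> gwords A; (l, r) \<in> R; l \<in> gwords A; r \<in> gwords A \<rbrakk>
      \<Longrightarrow> (u @ l @ v, u @ r @ v) \<in> word_cong A R"

definition word_class :: "'x set \<Rightarrow> ('x gword \<times> 'x gword) set \<Rightarrow> 'x gword \<Rightarrow> 'x gword set" where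
  "word_class A R u = word_cong A R `` {u}"

definition presented_group ::
    "'x set \<Rightarrow> ('x gword \<times> 'x gword) set \<Rightarrow> 'x gword set monoid" where
  "presented_group A R =
    \<lparr> carrier = gwords A // word_cong A R,
      monoid.mult = (\<lambda>c d. \<Union>u\<in>c. \<Union>v\<in>d. word_class A R (u @ v)),
      one = word_class A R [] \<rparr>"

text \<open>The value of a word when each generator \<open>x\<close> is sent to \<open>f x\<close> in \<open>G\<close>.\<close>

primrec word_eval :: "('g, 'm) monoid_scheme \<Rightarrow> ('x \<Rightarrow> 'g) \<Rightarrow> 'x gword \<Rightarrow> 'g" where
  "word_eval G f [] = \<one>\<^bsub>G\<^esub>"
| "word_eval G f (p # u) =
    (if snd p then f (fst p) else inv\<^bsub>G\<^esub> (f (fst p))) \<otimes>\<^bsub>G\<^esub> word_eval G f u"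

text \<open>
  The map induced on a presented group by \<open>x \<mapsto> f x\<close>; it is meaningful when \<open>f\<close> is
  compatible with the relations, all words of a class having then the same value.
\<close>

definition presented_lift ::
    "('g, 'm) monoid_scheme \<Rightarrow> ('x \<Rightarrow> 'g) \<Rightarrow> 'x gword set \<Rightarrow> 'g" where
  "presented_lift G f c = the_elem (word_eval G f ` c)"


section \<open>Coxeter groups\<close>

text \<open>
  The entry \<open>m(s, t)\<close> of the Coxeter matrix is the order of \<open>s t\<close>, with \<open>0\<close> in place of
  \<open>\<infinity>\<close> (the convention of \<^const>\<open>group.ord\<close>).
\<close>

definition coxeter_relations ::
    "('a, 'm) monoid_scheme \<Rightarrow> 'a set \<Rightarrow> ('a gword \<times> 'a gword) set" where
  "coxeter_relations W S =
    {(concat (replicate (group.ord W (s \<otimes>\<^bsub>W\<^esub> t)) (pos_word [s, t])), []) | s t.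
       s \<in> S \<and> t \<in> S \<and> group.ord W (s \<otimes>\<^bsub>W\<^esub> t) > 0}"

locale coxeter_group = group W for W (structure) +
  fixes S
  assumes gens_closed: "S \<subseteq> carrier W"
    and gens_order: "s \<in> S \<Longrightarrow> group.ord W s = 2"
    and presentation:
      "presented_lift W (\<lambda>s. s) \<in> iso (presented_group S (coxeter_relations W S)) W"

definition word_prod :: "('a, 'm) monoid_scheme \<Rightarrow> 'a list \<Rightarrow> 'a" where
  "word_prod W ss = foldr (\<lambda>s w. s \<otimes>\<^bsub>W\<^esub> w) ss \<one>\<^bsub>W\<^esub>"

definition cox_length :: "('a, 'm) monoid_scheme \<Rightarrow> 'a set \<Rightarrow> 'a \<Rightarrow> nat" where
  "cox_length W S w = (LEAST n. \<exists>ss \<in> lists S. length ss = n \<and> word_prod W ss = w)"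

definition reduced_decomp :: "('a, 'm) monoid_scheme \<Rightarrow> 'a set \<Rightarrow> 'a \<Rightarrow> 'a list \<Rightarrow> bool" where
  "reduced_decomp W S w ss \<longleftrightarrow>
     ss \<in> lists S \<and> word_prod W ss = w \<and> length ss = cox_length W S w"

definition spherical :: "('a, 'm) monoid_scheme \<Rightarrow> 'a set \<Rightarrow> 'a set \<Rightarrow> bool" where
  "spherical W S I \<longleftrightarrow> I \<subseteq> S \<and> finite (generate W I)"

definition longest_elem :: "('a, 'm) monoid_scheme \<Rightarrow> 'a set \<Rightarrow> 'a set \<Rightarrow> 'a" where
  "longest_elem W S I = (THE w. is_arg_max (cox_length W S) (\<lambda>w. w \<in> generate W I) w)"


section \<open>The cactus group\<close>

text \<open>
  \<open>W\<^bsub>K\<^esub> = W\<^bsub>I\<^esub> \<times> W\<^bsub>J\<^esub>\<close> as an internal direct product: the multiplication of \<open>W\<close>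
  induces an isomorphism \<open>W\<^bsub>I\<^esub> \<times> W\<^bsub>J\<^esub> \<rightarrow> W\<^bsub>K\<^esub>\<close>.
\<close>

definition parabolic_direct_prod ::
    "('a, 'm) monoid_scheme \<Rightarrow> 'a set \<Rightarrow> 'a set \<Rightarrow> 'a set \<Rightarrow> bool" where
  "parabolic_direct_prod W K I J \<longleftrightarrow>
     (\<lambda>(x, y). x \<otimes>\<^bsub>W\<^esub> y)
       \<in> iso (subgroup_generated W I \<times>\<times> subgroup_generated W J) (subgroup_generated W K)"

definition cactus_relations ::
    "('a, 'm) monoid_scheme \<Rightarrow> 'a set \<Rightarrow> ('a set gword \<times> 'a set gword) set" where
  "cactus_relations W S =
     {(pos_word [I, I], []) | I. spherical W S I}
   \<union> {(pos_word [I, J], pos_word [I \<union> J]) | I J.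
        spherical W S I \<and> spherical W S J \<and> spherical W S (I \<union> J) \<and>
        parabolic_direct_prod W (I \<union> J) I J}
   \<union> {(pos_word [I, J], pos_word [J, (\<lambda>s. w \<otimes>\<^bsub>W\<^esub> s \<otimes>\<^bsub>W\<^esub> w) ` I]) | I J w.
        spherical W S I \<and> spherical W S J \<and> I \<subseteq> J \<and> w = longest_elem W S J}"

definition cactus_group :: "('a, 'm) monoid_scheme \<Rightarrow> 'a set \<Rightarrow> 'a set gword set monoid" where
  "cactus_group W S = presented_group {I. spherical W S I} (cactus_relations W S)"

definition cactus_gen :: "('a, 'm) monoid_scheme \<Rightarrow> 'a set \<Rightarrow> 'a set \<Rightarrow> 'a set gword set" where
  "cactus_gen W S I = word_class {I. spherical W S I} (cactus_relations W S) (pos_word [I])"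

definition cactus_proj ::
    "('a, 'm) monoid_scheme \<Rightarrow> 'a set \<Rightarrow> 'a set gword set \<Rightarrow> 'a" where
  "cactus_proj W S = presented_lift W (longest_elem W S)"


section \<open>The braid group\<close>

fun alternating :: "nat \<Rightarrow> 'a \<Rightarrow> 'a \<Rightarrow> 'a list" where
  "alternating 0 s t = []"
| "alternating (Suc n) s t = s # alternating n t s"

definition braid_relations ::
    "('a, 'm) monoid_scheme \<Rightarrow> 'a set \<Rightarrow> ('a gword \<times> 'a gword) set" where
  "braid_relations W S =
    {(pos_word (alternating m s t), pos_word (alternating m t s)) | s t m.
       s \<in> S \<and> t \<in> S \<and> s \<noteq> t \<and> m = group.ord W (s \<otimes>\<^bsub>W\<^esub> t) \<and> m > 0}"

definition braid_group :: "('a, 'm) monoid_scheme \<Rightarrow> 'a set \<Rightarrow> 'a gword set monoid" where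
  "braid_group W S = presented_group S (braid_relations W S)"

definition braid_proj :: "('a, 'm) monoid_scheme \<Rightarrow> 'a gword set \<Rightarrow> 'a" where
  "braid_proj W = presented_lift W (\<lambda>s. s)"

definition pure_braid_group :: "('a, 'm) monoid_scheme \<Rightarrow> 'a set \<Rightarrow> 'a gword set monoid" where
  "pure_braid_group W S =
     (braid_group W S)\<lparr>carrier := kernel (braid_group W S) W (braid_proj W)\<rparr>"

text \<open>
  \<open>\<beta>\<^bsub>w\<^esub>\<close>: by Matsumoto's theorem the choice of the reduced decomposition is irrelevant.
\<close>

definition braid_lift :: "('a, 'm) monoid_scheme \<Rightarrow> 'a set \<Rightarrow> 'a \<Rightarrow> 'a gword set" where
  "braid_lift W S w =
     word_class S (braid_relations W S) (pos_word (SOME ss. reduced_decomp W S w ss))"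

definition braid_longest :: "('a, 'm) monoid_scheme \<Rightarrow> 'a set \<Rightarrow> 'a set \<Rightarrow> 'a gword set" where
  "braid_longest W S I = braid_lift W S (longest_elem W S I)"


section \<open>Rational group algebras\<close>

definition rat_ring :: "rat ring" where
  "rat_ring = \<lparr> carrier = UNIV, monoid.mult = (*), one = 1, ring.zero = 0, ring.add = (+) \<rparr>"

text \<open>
  The product of the type \<^typ>\<open>'g \<Rightarrow>\<^sub>0 rat\<close> comes from an additive monoid structure on the
  type \<^typ>\<open>'g\<close>, so the convolution along the multiplication of \<open>G\<close> is defined here.
\<close>

definition group_algebra :: "('g, 'm) monoid_scheme \<Rightarrow> ('g \<Rightarrow>\<^sub>0 rat) ring" where
  "group_algebra G =
    \<lparr> carrier = {a. Poly_Mapping.keys a \<subseteq> carrier G},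
      monoid.mult = (\<lambda>a b. \<Sum>g\<in>Poly_Mapping.keys a. \<Sum>h\<in>Poly_Mapping.keys b.
        Poly_Mapping.single (g \<otimes>\<^bsub>G\<^esub> h) (Poly_Mapping.lookup a g * Poly_Mapping.lookup b h)),
      one = Poly_Mapping.single \<one>\<^bsub>G\<^esub> 1,
      ring.zero = 0,
      ring.add = (+) \<rparr>"

definition group_algebra_map :: "('g \<Rightarrow> 'h) \<Rightarrow> ('g \<Rightarrow>\<^sub>0 rat) \<Rightarrow> ('h \<Rightarrow>\<^sub>0 rat)" where
  "group_algebra_map f a =
     (\<Sum>g\<in>Poly_Mapping.keys a. Poly_Mapping.single (f g) (Poly_Mapping.lookup a g))"

definition augmentation :: "('g \<Rightarrow>\<^sub>0 rat) \<Rightarrow> rat" where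
  "augmentation a = (\<Sum>g\<in>Poly_Mapping.keys a. Poly_Mapping.lookup a g)"

definition augmentation_ideal :: "('g, 'm) monoid_scheme \<Rightarrow> ('g \<Rightarrow>\<^sub>0 rat) set" where
  "augmentation_ideal G = a_kernel (group_algebra G) rat_ring augmentation"


section \<open>Completion of a ring at an ideal\<close>

text \<open>
  The completion is the inverse limit of the quotients \<open>R / J\<^sup>n\<close>. Since the elements of
  \<open>R / J\<^sup>n\<close> are cosets, the transition map \<open>R / J\<^sup>n\<^sup>+\<^sup>1 \<rightarrow> R / J\<^sup>n\<close> sends a coset to the one
  containing it.
\<close>

definition adic_quot :: "('r, 'm) ring_scheme \<Rightarrow> 'r set \<Rightarrow> nat \<Rightarrow> 'r set ring" where
  "adic_quot R J n = R Quot (J [^]\<^bsub>ideals_set R\<^esub> n)"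

definition adic_completion :: "('r, 'm) ring_scheme \<Rightarrow> 'r set \<Rightarrow> (nat \<Rightarrow> 'r set) ring" where
  "adic_completion R J =
    \<lparr> carrier = {x. \<forall>n. x n \<in> carrier (adic_quot R J n) \<and> x (Suc n) \<subseteq> x n},
      monoid.mult = (\<lambda>x y n. x n \<otimes>\<^bsub>adic_quot R J n\<^esub> y n),
      one = (\<lambda>n. \<one>\<^bsub>adic_quot R J n\<^esub>),
      ring.zero = (\<lambda>n. \<zero>\<^bsub>adic_quot R J n\<^esub>),
      ring.add = (\<lambda>x y n. x n \<oplus>\<^bsub>adic_quot R J n\<^esub> y n) \<rparr>"

definition to_completion :: "('r, 'm) ring_scheme \<Rightarrow> 'r set \<Rightarrow> 'r \<Rightarrow> nat \<Rightarrow> 'r set" where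
  "to_completion R J a = (\<lambda>n. (J [^]\<^bsub>ideals_set R\<^esub> n) +>\<^bsub>R\<^esub> a)"

text \<open>
  The map on completions induced by a ring homomorphism \<open>h\<close> into \<open>R'\<close> sending the first
  ideal into \<open>J'\<close>.
\<close>

definition completion_map ::
    "('r, 'm) ring_scheme \<Rightarrow> 'r set \<Rightarrow> ('q \<Rightarrow> 'r) \<Rightarrow> (nat \<Rightarrow> 'q set) \<Rightarrow> nat \<Rightarrow> 'r set" where
  "completion_map R' J' h x = (\<lambda>n. (J' [^]\<^bsub>ideals_set R'\<^esub> n) <+>\<^bsub>R'\<^esub> h ` x n)"

text \<open>Sum of a series for the inverse limit topology, the quotients being discrete.\<close>

definition adic_suminf ::
    "('r, 'm) ring_scheme \<Rightarrow> 'r set \<Rightarrow> (nat \<Rightarrow> nat \<Rightarrow> 'r set) \<Rightarrow> nat \<Rightarrow> 'r set" where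
  "adic_suminf R J u =
    (THE x. x \<in> carrier (adic_completion R J) \<and>
       (\<forall>n. \<forall>\<^sub>F M in sequentially. finsum (adic_completion R J) u {..<M} n = x n))"


section \<open>Completed group algebras and their rational points\<close>

abbreviation completed_algebra ::
    "('g, 'm) monoid_scheme \<Rightarrow> ('g \<Rightarrow>\<^sub>0 rat) set \<Rightarrow> (nat \<Rightarrow> ('g \<Rightarrow>\<^sub>0 rat) set) ring" where
  "completed_algebra G J \<equiv> adic_completion (group_algebra G) J"

text \<open>The image of \<open>c g\<close>, for a rational number \<open>c\<close> and a group element \<open>g\<close>.\<close>

definition completed_elem ::
    "('g, 'm) monoid_scheme \<Rightarrow> ('g \<Rightarrow>\<^sub>0 rat) set \<Rightarrow> rat \<Rightarrow> 'g \<Rightarrow> nat \<Rightarrow> ('g \<Rightarrow>\<^sub>0 rat) set" where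
  "completed_elem G J c g = to_completion (group_algebra G) J (Poly_Mapping.single g c)"

text \<open>
  Continuous linear functionals on the completed group algebra. A linear map to the
  discrete space of rational numbers is continuous if and only if it vanishes on the kernel
  of the projection to \<open>\<rat>[G] / J\<^sup>n\<close> for some \<open>n\<close>.
\<close>

definition dual_space ::
    "('g, 'm) monoid_scheme \<Rightarrow> ('g \<Rightarrow>\<^sub>0 rat) set \<Rightarrow> ((nat \<Rightarrow> ('g \<Rightarrow>\<^sub>0 rat) set) \<Rightarrow> rat) set" where
  "dual_space G J = (let H = completed_algebra G J in
    {l \<in> extensional (carrier H).
       (\<forall>x\<in>carrier H. \<forall>y\<in>carrier H. l (x \<oplus>\<^bsub>H\<^esub> y) = l x + l y) \<and>
       (\<forall>c. \<forall>x\<in>carrier H. l (completed_elem G J c \<one>\<^bsub>G\<^esub> \<otimes>\<^bsub>H\<^esub> x) = c * l x) \<and>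
       (\<exists>n. \<forall>x\<in>carrier H. x n = \<zero>\<^bsub>H\<^esub> n \<longrightarrow> l x = 0)})"

text \<open>
  The topological dual as an algebra. Its product is the transpose \<open>(l \<otimes> m) \<circ> \<Delta>\<close> of the
  coproduct and its unit is the counit. As \<open>\<Delta>(g) = g \<otimes> g\<close> and \<open>\<epsilon>(g) = 1\<close> for \<open>g\<close> in \<open>G\<close>
  and as the span of \<open>G\<close> is dense, they are the elements of the dual whose restrictions
  to \<open>G\<close> are \<open>g \<mapsto> l(g) m(g)\<close> and \<open>g \<mapsto> 1\<close>.
\<close>

definition dual_elem ::
    "('g, 'm) monoid_scheme \<Rightarrow> ('g \<Rightarrow>\<^sub>0 rat) set \<Rightarrow> ('g \<Rightarrow> rat)
      \<Rightarrow> (nat \<Rightarrow> ('g \<Rightarrow>\<^sub>0 rat) set) \<Rightarrow> rat" where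
  "dual_elem G J f =
    (THE l. l \<in> dual_space G J \<and> (\<forall>g\<in>carrier G. l (completed_elem G J 1 g) = f g))"

definition dual_algebra ::
    "('g, 'm) monoid_scheme \<Rightarrow> ('g \<Rightarrow>\<^sub>0 rat) set
      \<Rightarrow> ((nat \<Rightarrow> ('g \<Rightarrow>\<^sub>0 rat) set) \<Rightarrow> rat) ring" where
  "dual_algebra G J =
    \<lparr> carrier = dual_space G J,
      monoid.mult = (\<lambda>l m. dual_elem G J
        (\<lambda>g. l (completed_elem G J 1 g) * m (completed_elem G J 1 g))),
      one = dual_elem G J (\<lambda>g. 1),
      ring.zero = (\<lambda>x\<in>carrier (completed_algebra G J). 0),
      ring.add = (\<lambda>l m. \<lambda>x\<in>carrier (completed_algebra G J). l x + m x) \<rparr>"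

text \<open>
  A rational point of the spectrum of an algebra \<open>A\<close> over the rational numbers is an algebra
  homomorphism from \<open>A\<close> to the rational numbers (such homomorphisms are the same as unital
  ring homomorphisms). For \<open>A\<close> the topological dual, the points are viewed as invertible
  elements \<open>x\<close> of the completed group algebra: the point given by \<open>x\<close> is evaluation at
  \<open>x\<close>. The group law is the product of the completed group algebra.
\<close>

definition completion_points ::
    "('g, 'm) monoid_scheme \<Rightarrow> ('g \<Rightarrow>\<^sub>0 rat) set \<Rightarrow> (nat \<Rightarrow> ('g \<Rightarrow>\<^sub>0 rat) set) monoid" where
  "completion_points G J =
    (units_of (completed_algebra G J))
      \<lparr>carrier := {x \<in> Units (completed_algebra G J).
                     (\<lambda>l. l x) \<in> ring_hom (dual_algebra G J) rat_ring}\<rparr>"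

text \<open>\<open>g\<^sup>\<alpha> = (\<Sum>n\<ge>0. (\<alpha> choose n) (g - 1)\<^sup>n)\<close>, in the completion at the augmentation ideal.\<close>

definition group_rat_power ::
    "('g, 'm) monoid_scheme \<Rightarrow> 'g \<Rightarrow> rat \<Rightarrow> nat \<Rightarrow> ('g \<Rightarrow>\<^sub>0 rat) set" where
  "group_rat_power G g \<alpha> =
    (let J = augmentation_ideal G; H = completed_algebra G J in
     adic_suminf (group_algebra G) J
       (\<lambda>n. completed_elem G J (\<alpha> gchoose n) \<one>\<^bsub>G\<^esub>
              \<otimes>\<^bsub>H\<^esub> (completed_elem G J 1 g \<ominus>\<^bsub>H\<^esub> \<one>\<^bsub>H\<^esub>) [^]\<^bsub>H\<^esub> n))"


section \<open>The completed braid group\<close>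

definition braid_ideal :: "('a, 'm) monoid_scheme \<Rightarrow> 'a set \<Rightarrow> ('a gword set \<Rightarrow>\<^sub>0 rat) set" where
  "braid_ideal W S =
     a_kernel (group_algebra (braid_group W S)) (group_algebra W)
       (group_algebra_map (braid_proj W))"

definition braid_algebra_hat ::
    "('a, 'm) monoid_scheme \<Rightarrow> 'a set \<Rightarrow> (nat \<Rightarrow> ('a gword set \<Rightarrow>\<^sub>0 rat) set) ring" where
  "braid_algebra_hat W S = completed_algebra (braid_group W S) (braid_ideal W S)"

definition braid_group_hat ::
    "('a, 'm) monoid_scheme \<Rightarrow> 'a set \<Rightarrow> (nat \<Rightarrow> ('a gword set \<Rightarrow>\<^sub>0 rat) set) monoid" where
  "braid_group_hat W S = completion_points (braid_group W S) (braid_ideal W S)"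

definition braid_to_hat ::
    "('a, 'm) monoid_scheme \<Rightarrow> 'a set \<Rightarrow> 'a gword set \<Rightarrow> nat \<Rightarrow> ('a gword set \<Rightarrow>\<^sub>0 rat) set" where
  "braid_to_hat W S b = completed_elem (braid_group W S) (braid_ideal W S) 1 b"

text \<open>
  The canonical map from the completed group algebra of the pure braid group; on group
  algebras it is the inclusion.
\<close>

definition pure_to_braid_hat ::
    "('a, 'm) monoid_scheme \<Rightarrow> 'a set \<Rightarrow> (nat \<Rightarrow> ('a gword set \<Rightarrow>\<^sub>0 rat) set)
      \<Rightarrow> nat \<Rightarrow> ('a gword set \<Rightarrow>\<^sub>0 rat) set" where
  "pure_to_braid_hat W S =
     completion_map (group_algebra (braid_group W S)) (braid_ideal W S) (\<lambda>a. a)"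

text \<open>
  The extension of the projection of the braid group onto \<open>W\<close>. It is induced by the map from
  the quotient by the first power of the ideal, whose elements are the \<open>x 1\<close>, to the
  group algebra of \<open>W\<close>; it sends a rational point to an element of \<open>W\<close>.
\<close>

definition braid_hat_proj ::
    "('a, 'm) monoid_scheme \<Rightarrow> (nat \<Rightarrow> ('a gword set \<Rightarrow>\<^sub>0 rat) set) \<Rightarrow> 'a" where
  "braid_hat_proj W x =
     (THE w. w \<in> carrier W \<and>
        group_algebra_map (braid_proj W) ` x 1 = {Poly_Mapping.single w 1})"

text \<open>\<open>\<beta>\<^bsub>I\<^esub> (\<beta>\<^bsub>I\<^esub>\<^sup>2)\<^bsup>-1/2\<^esup>\<close>\<close>

definition cactus_image ::
    "('a, 'm) monoid_scheme \<Rightarrow> 'a set \<Rightarrow> 'a set \<Rightarrow> nat \<Rightarrow> ('a gword set \<Rightarrow>\<^sub>0 rat) set" where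
  "cactus_image W S I =
     (let b = braid_longest W S I in
      braid_to_hat W S b \<otimes>\<^bsub>braid_algebra_hat W S\<^esub>
      pure_to_braid_hat W S
        (group_rat_power (pure_braid_group W S) (b \<otimes>\<^bsub>braid_group W S\<^esub> b) (- 1 / 2)))"

end

theory Submission
  imports Defs "HOL-Computational_Algebra.Formal_Power_Series" "HOL-Computational_Algebra.Polynomial"
begin

text \<open>
  For \<open>b\<close> in the braid group with \<open>b\<^sup>2\<close> pure put \<open>x\<^sub>b = b (b\<^sup>2)\<^sup>-\<^sup>1\<^sup>/\<^sup>2\<close>. Since \<open>(b\<^sup>2)\<^sup>-\<^sup>1\<^sup>/\<^sup>2\<close> is a power
  series in \<open>b\<^sup>2\<close>, it commutes with whatever commutes with \<open>b\<^sup>2\<close>, so \<open>x\<^sub>b\<^sup>2 = 1\<close>, and \<open>a b = b a'\<close>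
  together with \<open>b a = a' b\<close> gives \<open>x\<^sub>a x\<^sub>b = x\<^sub>b x\<^bsub>a'\<^esub>\<close>. If \<open>a b = b a\<close>, then
  \<open>x\<^sub>a x\<^sub>b = x\<^bsub>ab\<^esub>\<close> because unipotent square roots are unique. The required relations between the
  \<open>\<beta>\<^sub>I\<close> follow from Matsumoto's theorem and additivity of lengths: \<open>w\<^sub>K = w\<^sub>I w\<^sub>J\<close> if
  \<open>W\<^sub>K = W\<^sub>I \<times> W\<^sub>J\<close>, and \<open>w\<^sub>J = w\<^sub>I u = u w\<^bsub>I'\<^esub>\<close> with \<open>u = w\<^sub>I w\<^sub>J\<close>, \<open>I' = w\<^sub>J I w\<^sub>J\<close> if \<open>I \<subseteq> J\<close>.
  Modulo a power of the ideal, every functional of \<open>g\<^sup>\<alpha>\<close> is polynomial in \<open>\<alpha>\<close>; hence \<open>g\<^sup>\<alpha>\<close> is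
  group-like because \<open>g\<^sup>n\<close> is for all natural numbers \<open>n\<close>.
\<close>

section \<open>Presented groups\<close>

text \<open>The completion of Q[B] is taken at the kernel of Q[B] \<rightarrow> Q[W], so \<beta>_I
  is in general not unipotent; only its square is, which is why the normalising factor comes from
  the pure subgroup. The obstacle is membership in the group of points, stated through the
  topological dual with a product given by \<open>THE\<close>. No completed tensor product is
  formed: a continuous functional is a function f on the group whose linear extension vanishes on
  some J^n (\<open>kills n f\<close>), the product of the dual is the pointwise product, and a point
  is a unit whose representatives modulo J^N are multiplicative on pairs of functionals of orders n,
  k with n + k \<le> N (\<open>grouplike\<close>). Equations in the completion thus become
  congruences modulo J^n in the group algebra, where (b^2)^(-1/2) is a truncated binomial polynomial
  in b^2 - 1. On the Coxeter side only a presentation is given, so the exchange condition is derived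
  from a set-valued cocycle on words that respects the relations. The projection to W is read off at
  level 1, where (\<beta>_I^2)^(-1/2) becomes 1.\<close>

declare in_listsD [rule del] in_listsI [rule del]

lemma word_cong_gwords: "(u, v) \<in> word_cong A R \<Longrightarrow> u \<in> gwords A \<and> v \<in> gwords A"
  by (induction rule: word_cong.induct) auto

lemma equiv_word_cong: "equiv (gwords A) (word_cong A R)"
proof (rule equivI)
  show "word_cong A R \<subseteq> gwords A \<times> gwords A"
    using word_cong_gwords by fast
  show "refl_on (gwords A) (word_cong A R)"
    using word_cong_gwords word_cong.refl by (fastforce simp: refl_on_def)
  show "sym (word_cong A R)"
    by (meson symI word_cong.sym)
  show "trans (word_cong A R)"
    by (meson transI word_cong.trans)
qed

lemma word_cong_context:
  assumes "(u, v) \<in> word_cong A R" "p \<in> gwords A" "q \<in> gwords A"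
  shows "(p @ u @ q, p @ v @ q) \<in> word_cong A R"
  using assms
proof (induction rule: word_cong.induct)
  case (refl u)
  then show ?case by (simp add: word_cong.refl)
next
  case (sym u v)
  then show ?case by (meson word_cong.sym)
next
  case (trans u v w)
  then show ?case by (meson word_cong.trans)
next
  case (cancel u v x b)
  then show ?case
    using word_cong.cancel[of "p @ u" A "v @ q" x b R] by simp
next
  case (rel u v l r)
  then show ?case
    using word_cong.rel[of "p @ u" A "v @ q" l r R] by simp
qed

lemma word_cong_append:
  assumes "(u, u') \<in> word_cong A R" "(v, v') \<in> word_cong A R"
  shows "(u @ v, u' @ v') \<in> word_cong A R"
proof -
  have "(u @ v, u' @ v) \<in> word_cong A R"
    using word_cong_context[OF assms(1), of "[]" v] word_cong_gwords[OF assms(2)] by simp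
  moreover have "(u' @ v, u' @ v') \<in> word_cong A R"
    using word_cong_context[OF assms(2), of u' "[]"] word_cong_gwords[OF assms(1)] by simp
  ultimately show ?thesis by (rule word_cong.trans)
qed

lemma word_class_eq_iff:
  "u \<in> gwords A \<Longrightarrow> v \<in> gwords A \<Longrightarrow>
     word_class A R u = word_class A R v \<longleftrightarrow> (u, v) \<in> word_cong A R"
  unfolding word_class_def by (rule eq_equiv_class_iff[OF equiv_word_cong])

lemma word_class_eqI: "(u, v) \<in> word_cong A R \<Longrightarrow> word_class A R u = word_class A R v"
  by (metis word_class_eq_iff word_cong_gwords)

lemma presented_carrier:
  "carrier (presented_group A R) = word_class A R ` gwords A"
  by (auto simp: presented_group_def quotient_def word_class_def)

lemma presented_mult:
  assumes "u \<in> gwords A" "v \<in> gwords A"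
  shows "word_class A R u \<otimes>\<^bsub>presented_group A R\<^esub> word_class A R v = word_class A R (u @ v)"
proof -
  have "word_class A R (u' @ v') = word_class A R (u @ v)"
    if "u' \<in> word_class A R u" "v' \<in> word_class A R v" for u' v'
    using that
    by (intro word_class_eqI[OF word_cong_append, symmetric]) (simp_all add: word_class_def)
  then have "(\<Union>u'\<in>word_class A R u. \<Union>v'\<in>word_class A R v. word_class A R (u' @ v'))
      = (\<Union>u'\<in>word_class A R u. \<Union>v'\<in>word_class A R v. word_class A R (u @ v))"
    by (intro SUP_cong HOL.refl)
  moreover have "u \<in> word_class A R u" "v \<in> word_class A R v"
    using assms by (auto simp: word_class_def word_cong.refl)
  ultimately show ?thesis
    by (auto simp: presented_group_def)
qed

lemma presented_one: "\<one>\<^bsub>presented_group A R\<^esub> = word_class A R []"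
  by (simp add: presented_group_def)

lemma gwords_inverse: "u \<in> gwords A \<Longrightarrow> map (\<lambda>(x, b). (x, \<not> b)) (rev u) \<in> gwords A"
  by (induction u) (auto split: prod.splits)

lemma word_cong_inverse:
  assumes "u \<in> gwords A"
  shows "(map (\<lambda>(x, b). (x, \<not> b)) (rev u) @ u, []) \<in> word_cong A R"
  using assms
proof (induction u)
  case Nil
  then show ?case by (simp add: word_cong.refl)
next
  case (Cons p u)
  obtain x b where p: "p = (x, b)" by force
  have inv: "map (\<lambda>(x, b). (x, \<not> b)) (rev u) \<in> gwords A"
    by (rule gwords_inverse) (rule Cons.hyps)
  have "(map (\<lambda>(x, b). (x, \<not> b)) (rev u) @ [(x, \<not> b), (x, \<not> \<not> b)] @ u,
      map (\<lambda>(x, b). (x, \<not> b)) (rev u) @ u) \<in> word_cong A R"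
    by (rule word_cong.cancel[OF inv]) (use Cons.hyps p in auto)
  then show ?case
    using Cons word_cong.trans by (fastforce simp: p)
qed

lemma group_presented_group: "group (presented_group A R)"
proof (rule groupI)
  fix c d e
  assume "c \<in> carrier (presented_group A R)" "d \<in> carrier (presented_group A R)"
    "e \<in> carrier (presented_group A R)"
  then show "c \<otimes>\<^bsub>presented_group A R\<^esub> d \<otimes>\<^bsub>presented_group A R\<^esub> e =
      c \<otimes>\<^bsub>presented_group A R\<^esub> (d \<otimes>\<^bsub>presented_group A R\<^esub> e)"
    by (auto simp: presented_carrier presented_mult)
next
  fix c assume "c \<in> carrier (presented_group A R)"
  then obtain u where u: "u \<in> gwords A" "c = word_class A R u"
    by (auto simp: presented_carrier)
  let ?v = "map (\<lambda>(x, b). (x, \<not> b)) (rev u)"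
  have "?v \<in> gwords A" by (rule gwords_inverse[OF u(1)])
  moreover have "word_class A R ?v \<otimes>\<^bsub>presented_group A R\<^esub> c = \<one>\<^bsub>presented_group A R\<^esub>"
    using u \<open>?v \<in> gwords A\<close> word_class_eqI[OF word_cong_inverse[OF u(1)]]
    by (simp only: presented_mult presented_one)
  ultimately show "\<exists>d\<in>carrier (presented_group A R).
      d \<otimes>\<^bsub>presented_group A R\<^esub> c = \<one>\<^bsub>presented_group A R\<^esub>"
    unfolding presented_carrier by blast
qed (auto simp: presented_carrier presented_mult presented_one)

lemma (in group) word_eval_closed:
  "f \<in> A \<rightarrow> carrier G \<Longrightarrow> u \<in> gwords A \<Longrightarrow> word_eval G f u \<in> carrier G"
  by (induction u) (auto simp: Pi_iff)

lemma (in group) word_eval_append: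
  "f \<in> A \<rightarrow> carrier G \<Longrightarrow> u \<in> gwords A \<Longrightarrow> v \<in> gwords A \<Longrightarrow>
     word_eval G f (u @ v) = word_eval G f u \<otimes> word_eval G f v"
proof (induction u)
  case (Cons p u)
  then show ?case
    using word_eval_closed[OF Cons.prems(1)] by (auto simp: Pi_iff m_assoc)
qed (simp add: word_eval_closed)

lemma (in group) word_eval_cong:
  assumes f: "f \<in> A \<rightarrow> carrier G"
    and R: "\<And>l r. (l, r) \<in> R \<Longrightarrow> l \<in> gwords A \<Longrightarrow> r \<in> gwords A
      \<Longrightarrow> word_eval G f l = word_eval G f r"
    and uv: "(u, v) \<in> word_cong A R"
  shows "word_eval G f u = word_eval G f v"
  using uv
proof (induction rule: word_cong.induct)
  case (cancel u v x b)
  have x: "[(x, b), (x, \<not> b)] \<in> gwords A" "f x \<in> carrier G" using cancel f by auto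
  then have "word_eval G f [(x, b), (x, \<not> b)] = \<one>" by (cases b) auto
  then show ?case
    using cancel x word_eval_closed[OF f]
    by (simp add: word_eval_append[OF f] del: word_eval.simps(2) append_Cons)
next
  case (rel u v l r)
  then show ?case by (simp add: word_eval_append[OF f] R)
qed auto

text \<open>Compatibility with the relations makes the image of a class a singleton, so
  \<open>the_elem\<close> is meaningful and any word of the class computes the value.\<close>

lemma (in group) presented_lift_class:
  assumes f: "f \<in> A \<rightarrow> carrier G"
    and R: "\<And>l r. (l, r) \<in> R \<Longrightarrow> l \<in> gwords A \<Longrightarrow> r \<in> gwords A
      \<Longrightarrow> word_eval G f l = word_eval G f r"
    and u: "u \<in> gwords A"
  shows "presented_lift G f (word_class A R u) = word_eval G f u"
proof -
  have "u \<in> word_class A R u" using u by (simp add: word_class_def word_cong.refl)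
  moreover have "word_eval G f v = word_eval G f u" if "v \<in> word_class A R u" for v
    using word_eval_cong[OF f R, where u = u and v = v] that by (auto simp: word_class_def)
  ultimately have "word_eval G f ` word_class A R u = {word_eval G f u}"
    by blast
  then show ?thesis by (simp add: presented_lift_def)
qed

lemma (in group) presented_lift_hom:
  assumes f: "f \<in> A \<rightarrow> carrier G"
    and R: "\<And>l r. (l, r) \<in> R \<Longrightarrow> l \<in> gwords A \<Longrightarrow> r \<in> gwords A
      \<Longrightarrow> word_eval G f l = word_eval G f r"
  shows "presented_lift G f \<in> hom (presented_group A R) G"
  by (rule homI)
    (auto simp: presented_carrier presented_mult presented_lift_class[OF f R]
      word_eval_closed[OF f] word_eval_append[OF f])

text \<open>The uniqueness half of the universal property. Formal inverses are covered because
  \<open>[(x, False)]\<close> and \<open>[(x, True)]\<close> cancel, so their classes are inverse to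
  each other.\<close>

lemma (in group) presented_hom_eval:
  assumes h: "h \<in> hom (presented_group A R) G" and u: "u \<in> gwords A"
  shows "h (word_class A R u) = word_eval G (\<lambda>x. h (word_class A R [(x, True)])) u"
  using u
proof (induction u)
  case Nil
  show ?case
    using hom_one[OF h group_presented_group group_axioms] by (simp add: presented_one)
next
  case (Cons p u)
  obtain x b where p: "p = (x, b)" by force
  interpret P: group "presented_group A R" by (rule group_presented_group)
  interpret H: group_hom "presented_group A R" G h
    using h by unfold_locales
  have x: "[(x, True)] \<in> gwords A" "[(x, False)] \<in> gwords A" "u \<in> gwords A"
    using Cons.hyps by (auto simp: p)
  have "word_class A R [(x, False)] \<otimes>\<^bsub>presented_group A R\<^esub> word_class A R [(x, True)]
      = \<one>\<^bsub>presented_group A R\<^esub>"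
    using x word_class_eqI[OF word_cong_inverse[of "[(x, True)]" A R]]
    by (simp add: presented_mult presented_one)
  then have "inv\<^bsub>presented_group A R\<^esub> word_class A R [(x, True)] = word_class A R [(x, False)]"
    using x by (intro P.inv_equality) (auto simp: presented_carrier)
  then have "word_class A R [(x, False)] = inv\<^bsub>presented_group A R\<^esub> word_class A R [(x, True)]"
    by simp
  then have "h (word_class A R [(x, False)]) = inv (h (word_class A R [(x, True)]))"
    using x by (simp add: presented_carrier H.hom_inv)
  moreover have "h (word_class A R (p # u)) = h (word_class A R [p]) \<otimes> h (word_class A R u)"
    using x by (cases b) (auto simp: presented_mult presented_carrier p simp flip: H.hom_mult)
  ultimately show ?case
    using Cons x by (cases b) (auto simp: p)
qed

section \<open>Coxeter groups\<close>

lemma word_prod_simps [simp]: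
  "word_prod G [] = \<one>\<^bsub>G\<^esub>" "word_prod G (s # ss) = s \<otimes>\<^bsub>G\<^esub> word_prod G ss"
  by (simp_all add: word_prod_def)

lemma pos_word_simps [simp]:
  "pos_word [] = []" "pos_word (x # xs) = (x, True) # pos_word xs"
  "pos_word (xs @ ys) = pos_word xs @ pos_word ys"
  by (simp_all add: pos_word_def)

lemma pos_word_gwords [simp]: "pos_word xs \<in> gwords A \<longleftrightarrow> xs \<in> lists A"
  by (induction xs) auto

lemma word_eval_pos_word: "word_eval G f (pos_word xs) = word_prod G (map f xs)"
  by (induction xs) auto

lemma (in group) word_prod_closed [simp]: "xs \<in> lists (carrier G) \<Longrightarrow> word_prod G xs \<in> carrier G"
  by (induction xs) auto

lemma (in group) word_prod_append:
  "xs \<in> lists (carrier G) \<Longrightarrow> ys \<in> lists (carrier G) \<Longrightarrow>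
     word_prod G (xs @ ys) = word_prod G xs \<otimes> word_prod G ys"
  by (induction xs) (auto simp: m_assoc)

text \<open>
  The set of reflections that occur an odd number of times in the sequence
  \<open>s\<^sub>1, s\<^sub>1 s\<^sub>2 s\<^sub>1, s\<^sub>1 s\<^sub>2 s\<^sub>3 s\<^sub>2 s\<^sub>1, \<dots>\<close> of a word. It depends only on the value of the word, and
  its elements of length one are the left descents of this value.
\<close>

primrec inversions :: "('a, 'm) monoid_scheme \<Rightarrow> 'a list \<Rightarrow> 'a set" where
  "inversions W [] = {}"
| "inversions W (s # ss) =
    sym_diff {s} ((\<lambda>r. s \<otimes>\<^bsub>W\<^esub> r \<otimes>\<^bsub>W\<^esub> s) ` inversions W ss)"

context coxeter_group
begin

abbreviation "len \<equiv> cox_length W S"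

lemma gen_carrier [simp]: "s \<in> S \<Longrightarrow> s \<in> carrier W"
  using gens_closed by auto

lemma lists_carrier [simp]: "ss \<in> lists S \<Longrightarrow> ss \<in> lists (carrier W)"
  using gens_closed lists_mono by blast

lemma gen_sq [simp]: "s \<in> S \<Longrightarrow> s \<otimes> s = \<one>"
  using gens_order[of s] pow_ord_eq_1[of s] by (simp add: numeral_2_eq_2)

lemma gen_inv [simp]: "s \<in> S \<Longrightarrow> inv s = s"
  by (simp add: inv_equality)

lemma gen_cancel [simp]: "s \<in> S \<Longrightarrow> x \<in> carrier W \<Longrightarrow> s \<otimes> (s \<otimes> x) = x"
  by (simp flip: m_assoc)

lemma gen_cancel_right [simp]: "s \<in> S \<Longrightarrow> x \<in> carrier W \<Longrightarrow> x \<otimes> s \<otimes> s = x"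
  by (simp add: m_assoc)

lemma word_eval_eq: "u \<in> gwords S \<Longrightarrow> word_eval W (\<lambda>s. s) u = word_prod W (map fst u)"
  by (induction u) auto

lemma coxeter_relation_holds:
  assumes "(l, r) \<in> coxeter_relations W S"
  shows "word_eval W (\<lambda>s. s) l = word_eval W (\<lambda>s. s) r"
proof -
  obtain s t where st: "s \<in> S" "t \<in> S" "r = []"
    and l: "l = concat (replicate (ord (s \<otimes> t)) (pos_word [s, t]))"
    using assms unfolding coxeter_relations_def by auto
  have "word_eval W (\<lambda>s. s) (concat (replicate k (pos_word [s, t]))) = (s \<otimes> t) [^] k" for k
  proof (induction k)
    case (Suc k)
    have "(s \<otimes> t) [^] Suc k = s \<otimes> (t \<otimes> (s \<otimes> t) [^] k)"
      using st by (subst nat_pow_Suc2) (auto simp: m_assoc)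
    then show ?case using Suc by simp
  qed simp
  then show ?thesis using st by (simp add: l)
qed

lemma word_class_prod:
  assumes "u \<in> gwords S"
  shows "presented_lift W (\<lambda>s. s) (word_class S (coxeter_relations W S) u)
    = word_eval W (\<lambda>s. s) u"
  using assms coxeter_relation_holds by (intro presented_lift_class) auto

lemma ex_word:
  assumes "w \<in> carrier W"
  shows "\<exists>ss\<in>lists S. word_prod W ss = w"
proof -
  have "w \<in> presented_lift W (\<lambda>s. s) ` word_class S (coxeter_relations W S) ` gwords S"
    using presentation assms by (auto simp: iso_def bij_betw_def presented_carrier)
  then obtain u where u: "u \<in> gwords S" "w = word_eval W (\<lambda>s. s) u"
    by (elim imageE) (simp add: word_class_prod)
  moreover have "map fst u \<in> lists S" using u(1) by (induction u) auto
  ultimately show ?thesis by (auto simp: word_eval_eq)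
qed

text \<open>Injectivity of the Coxeter presentation enters here: any invariant of words that
  respects the relations becomes an invariant of group elements.\<close>

lemma word_cong_of_prod_eq:
  assumes "xs \<in> lists S" "ys \<in> lists S" "word_prod W xs = word_prod W ys"
  shows "(pos_word xs, pos_word ys) \<in> word_cong S (coxeter_relations W S)"
proof -
  have "inj_on (presented_lift W (\<lambda>s. s)) (carrier (presented_group S (coxeter_relations W S)))"
    using presentation by (simp add: iso_def bij_betw_def)
  then have "word_class S (coxeter_relations W S) (pos_word xs)
      = word_class S (coxeter_relations W S) (pos_word ys)"
    by (rule inj_onD) (use assms in \<open>auto simp: word_class_prod presented_carrier word_eval_pos_word\<close>)
  then show ?thesis using assms by (simp add: word_class_eq_iff)
qed

subsection \<open>The exchange condition\<close>

lemma inversions_closed: "ss \<in> lists S \<Longrightarrow> inversions W ss \<subseteq> carrier W"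
  by (induction ss) auto

lemma inj_on_conj:
  assumes "g \<in> carrier W" "h \<in> carrier W"
  shows "inj_on (\<lambda>r. g \<otimes> r \<otimes> h) (carrier W)"
  using assms by (intro inj_onI) simp

lemma image_sym_diff:
  assumes "inj_on f C" "A \<subseteq> C" "B \<subseteq> C"
  shows "f ` sym_diff A B = sym_diff (f ` A) (f ` B)"
  using assms by (subst image_Un, subst (1 2) inj_on_image_set_diff[OF assms(1)]) auto

text \<open>The cocycle rule N(uv) = N(u) + u N(v) u^-1, with symmetric difference as addition;
  conjugation is injective, hence commutes with symmetric differences.\<close>

lemma inversions_append:
  assumes "xs \<in> lists S" "ys \<in> lists S"
  shows "inversions W (xs @ ys) = sym_diff (inversions W xs)
    ((\<lambda>r. word_prod W xs \<otimes> r \<otimes> inv (word_prod W xs)) ` inversions W ys)"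
  using assms(1)
proof (induction xs)
  case Nil
  then show ?case using inversions_closed[OF assms(2)] by (auto simp: image_iff subset_iff)
next
  case (Cons s xs)
  let ?p = "word_prod W xs"
  have cl: "inversions W xs \<subseteq> carrier W" "inversions W ys \<subseteq> carrier W"
    using Cons assms inversions_closed by blast+
  have "(\<lambda>r. s \<otimes> r \<otimes> s) ` (\<lambda>r. ?p \<otimes> r \<otimes> inv ?p) ` inversions W ys
      = (\<lambda>r. (s \<otimes> ?p) \<otimes> r \<otimes> inv (s \<otimes> ?p)) ` inversions W ys"
    unfolding image_image
    by (rule image_cong[OF HOL.refl])
      (use Cons cl in \<open>auto simp: m_assoc inv_mult_group subset_iff\<close>)
  moreover have "(\<lambda>r. s \<otimes> r \<otimes> s) ` inversions W (xs @ ys) = sym_diff ((\<lambda>r. s \<otimes> r \<otimes> s) ` inversions W xs)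
       ((\<lambda>r. s \<otimes> r \<otimes> s) ` (\<lambda>r. ?p \<otimes> r \<otimes> inv ?p) ` inversions W ys)"
    unfolding Cons.IH
    by (rule image_sym_diff[OF inj_on_conj[of s s]]) (use Cons cl in auto)
  ultimately show ?case by auto
qed

lemma alternating_lists: "s \<in> S \<Longrightarrow> t \<in> S \<Longrightarrow> alternating k s t \<in> lists S"
  by (induction k arbitrary: s t) auto

lemma concat_replicate_pair: "concat (replicate k [s, t]) = alternating (2 * k) s t"
  by (induction k) auto

lemma conj_pow:
  assumes "s \<in> S" "t \<in> S"
  shows "s \<otimes> ((t \<otimes> s) [^] (k::nat) \<otimes> t) = (s \<otimes> t) [^] Suc k"
proof (induction k)
  case (Suc k)
  have "s \<otimes> ((t \<otimes> s) [^] Suc k \<otimes> t) = s \<otimes> ((t \<otimes> s) [^] k \<otimes> t) \<otimes> (s \<otimes> t)"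
    using assms by (simp add: m_assoc)
  then show ?case by (simp only: Suc.IH nat_pow_Suc)
qed (use assms in simp)

text \<open>The last letter of the alternating word of length k + 1 contributes the reflection
  (st)^k s. The induction works at the front of the word: conjugating (ts)^k t by s gives (st)^(k+1)
  s, by \<open>conj_pow\<close>.\<close>

lemma inversions_alternating_Suc:
  assumes "s \<in> S" "t \<in> S"
  shows "inversions W (alternating (Suc k) s t)
    = sym_diff (inversions W (alternating k s t)) {(s \<otimes> t) [^] k \<otimes> s}"
  using assms
proof (induction k arbitrary: s t)
  case (Suc k)
  have "inversions W (alternating (Suc (Suc k)) s t) = sym_diff {s}
      ((\<lambda>r. s \<otimes> r \<otimes> s) ` inversions W (alternating (Suc k) t s))"
    by simp
  also have "(\<lambda>r. s \<otimes> r \<otimes> s) ` inversions W (alternating (Suc k) t s)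
     = (\<lambda>r. s \<otimes> r \<otimes> s) ` sym_diff (inversions W (alternating k t s)) {(t \<otimes> s) [^] k \<otimes> t}"
    using Suc.IH[of t s] Suc.prems by simp
  also have "\<dots> = sym_diff ((\<lambda>r. s \<otimes> r \<otimes> s) ` inversions W (alternating k t s))
      {s \<otimes> ((t \<otimes> s) [^] k \<otimes> t) \<otimes> s}"
    by (subst image_sym_diff[OF inj_on_conj[of s s]])
      (use Suc.prems inversions_closed alternating_lists in auto)
  also have "s \<otimes> ((t \<otimes> s) [^] k \<otimes> t) = (s \<otimes> t) [^] Suc k"
    using Suc.prems conj_pow by blast
  finally show ?case by auto
qed auto

text \<open>The reflections (st)^j s are periodic in j with period m, so the letters after the m-th
  contribute the same reflections as a word starting afresh.\<close>

lemma inversions_alternating_add: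
  assumes "s \<in> S" "t \<in> S" "(s \<otimes> t) [^] m = \<one>"
  shows "inversions W (alternating (m + k) s t)
    = sym_diff (inversions W (alternating m s t)) (inversions W (alternating k s t))"
proof (induction k)
  case (Suc k)
  have "(s \<otimes> t) [^] (m + k) = (s \<otimes> t) [^] k"
    using assms by (simp flip: nat_pow_mult)
  then have "inversions W (alternating (m + Suc k) s t)
    = sym_diff (inversions W (alternating (m + k) s t)) {(s \<otimes> t) [^] k \<otimes> s}"
    using inversions_alternating_Suc[OF assms(1,2), of "m + k"] by simp
  then show ?case
    using inversions_alternating_Suc[OF assms(1,2), of k] unfolding Suc.IH by auto
qed auto

text \<open>The relator (st)^m has 2m letters; by periodicity its two halves contribute the same
  set, which cancels.\<close>

lemma inversions_coxeter_relation:
  assumes "s \<in> S" "t \<in> S"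
  shows "inversions W (concat (replicate (ord (s \<otimes> t)) [s, t])) = {}"
  using inversions_alternating_add[OF assms, of "ord (s \<otimes> t)" "ord (s \<otimes> t)"] assms
  by (simp add: concat_replicate_pair mult_2)

text \<open>The pairs \<open>[x, x]\<close> and the Coxeter relators have value 1 and empty
  inversion set, so by the cocycle rule inserting them changes nothing.\<close>

lemma inversions_word_cong:
  assumes "(u, v) \<in> word_cong S (coxeter_relations W S)"
  shows "inversions W (map fst u) = inversions W (map fst v)"
  using assms
proof (induction rule: word_cong.induct)
  case (cancel u v x b)
  have m: "map fst u \<in> lists S" "map fst v \<in> lists S" "[x, x] \<in> lists S"
    using cancel by (auto simp: in_lists_conv_set)
  have "inversions W [x, x] = {}" using cancel by simp
  moreover have "(\<lambda>r. \<one> \<otimes> r \<otimes> \<one>) ` inversions W (map fst v) = inversions W (map fst v)"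
    using inversions_closed[OF m(2)] by (auto simp: image_iff subset_iff)
  ultimately have "inversions W ([x, x] @ map fst v) = inversions W (map fst v)"
    using inversions_append[OF m(3,2)] cancel by simp
  then show ?case
    using m inversions_append[OF m(1)] cancel by simp
next
  case (rel u v l r)
  then obtain s t where st: "s \<in> S" "t \<in> S" "r = []"
    and l: "l = concat (replicate (ord (s \<otimes> t)) (pos_word [s, t]))"
    unfolding coxeter_relations_def by auto
  have l': "map fst l = concat (replicate (ord (s \<otimes> t)) [s, t])"
    unfolding l by (simp add: map_concat)
  have m: "map fst u \<in> lists S" "map fst v \<in> lists S" "map fst l \<in> lists S"
    using rel by (auto simp: in_lists_conv_set)
  have "word_prod W (map fst l) = \<one>"
    using coxeter_relation_holds[OF rel(3)] rel(4) st by (simp add: word_eval_eq)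
  moreover have "(\<lambda>r. \<one> \<otimes> r \<otimes> \<one>) ` inversions W (map fst v) = inversions W (map fst v)"
    using inversions_closed[OF m(2)] by (auto simp: image_iff subset_iff)
  ultimately have "inversions W (map fst l @ map fst v) = inversions W (map fst v)"
    using inversions_append[OF m(3,2)] inversions_coxeter_relation[OF st(1,2)] by (simp add: l')
  then show ?case
    using m inversions_append[OF m(1)] st by simp
qed auto

lemma inversions_eq:
  assumes "xs \<in> lists S" "ys \<in> lists S" "word_prod W xs = word_prod W ys"
  shows "inversions W xs = inversions W ys"
  using inversions_word_cong[OF word_cong_of_prod_eq[OF assms]] by (simp add: pos_word_def comp_def)

text \<open>Each inversion has the form r = s_1 ... s_(i-1) s_i s_(i-1) ... s_1, and left
  multiplication by it deletes the i-th letter.\<close>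

lemma inversions_exchange:
  assumes "ss \<in> lists S" "r \<in> inversions W ss"
  shows "\<exists>xs s ys. ss = xs @ s # ys \<and> r \<otimes> word_prod W ss = word_prod W (xs @ ys)"
  using assms
proof (induction ss arbitrary: r)
  case (Cons s ss)
  show ?case
  proof (cases "r = s")
    case True
    then have "s # ss = [] @ s # ss \<and> r \<otimes> word_prod W (s # ss) = word_prod W ([] @ ss)"
      using Cons by simp
    then show ?thesis by blast
  next
    case False
    then obtain r' where r': "r' \<in> inversions W ss" "r = s \<otimes> r' \<otimes> s"
      using Cons.prems by auto
    then obtain xs t ys where *: "ss = xs @ t # ys"
      "r' \<otimes> word_prod W ss = word_prod W (xs @ ys)"
      using Cons by blast
    have "r' \<in> carrier W" using r' inversions_closed Cons by auto
    then have "r \<otimes> word_prod W (s # ss) = s \<otimes> (r' \<otimes> word_prod W ss)"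
      using Cons r' by (simp add: m_assoc)
    then have "s # ss = (s # xs) @ t # ys \<and> r \<otimes> word_prod W (s # ss) = word_prod W ((s # xs) @ ys)"
      using * by simp
    then show ?thesis by blast
  qed
qed auto

section \<open>Length function and reduced words\<close>

lemma reduced_exists:
  assumes "w \<in> carrier W"
  shows "\<exists>ss. reduced_decomp W S w ss"
proof -
  obtain ss where "ss \<in> lists S" "word_prod W ss = w" using ex_word[OF assms] by blast
  then have "\<exists>n. \<exists>ss \<in> lists S. length ss = n \<and> word_prod W ss = w" by blast
  from LeastI_ex[OF this] show ?thesis unfolding reduced_decomp_def cox_length_def by auto
qed

lemma len_le: "ss \<in> lists S \<Longrightarrow> len (word_prod W ss) \<le> length ss"
  unfolding cox_length_def by (rule Least_le) auto

definition red :: "'a list \<Rightarrow> bool" where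
  "red ss \<longleftrightarrow> ss \<in> lists S \<and> len (word_prod W ss) = length ss"

lemma reduced_decomp_iff_red: "reduced_decomp W S w ss \<longleftrightarrow> red ss \<and> word_prod W ss = w"
  by (auto simp: reduced_decomp_def red_def)

lemma red_lists: "red ss \<Longrightarrow> ss \<in> lists S" by (simp add: red_def)

lemma red_obtain:
  assumes "w \<in> carrier W" obtains ss where "red ss" "word_prod W ss = w"
  using reduced_exists[OF assms] reduced_decomp_iff_red by blast

text \<open>Deleting a letter of a reduced word shows that an inversion s shortens w. If s is not an
  inversion of w, it is one of s w, because conjugation by s fixes s, and the same argument for s w
  gives the reverse inequality. In particular multiplication by a generator always changes the
  length.\<close>

lemma left_descent_cases:
  assumes s: "s \<in> S" and ss: "ss \<in> lists S"
  shows "(s \<in> inversions W ss \<and> len (s \<otimes> word_prod W ss) < len (word_prod W ss))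
    \<or> (s \<notin> inversions W ss \<and> len (word_prod W ss) < len (s \<otimes> word_prod W ss))"
proof -
  have shorter: "len (s \<otimes> word_prod W xs) < len (word_prod W xs)"
    if xs: "xs \<in> lists S" and sx: "s \<in> inversions W xs" for xs
  proof -
    obtain ys where ys: "red ys" "word_prod W ys = word_prod W xs"
      using red_obtain[of "word_prod W xs"] xs by auto
    then have "s \<in> inversions W ys" using inversions_eq[of ys xs] xs sx red_lists by blast
    then obtain as t bs where *: "ys = as @ t # bs" "s \<otimes> word_prod W ys = word_prod W (as @ bs)"
      using inversions_exchange red_lists[OF ys(1)] by blast
    then have "len (s \<otimes> word_prod W xs) \<le> length (as @ bs)"
      using len_le[of "as @ bs"] red_lists[OF ys(1)] ys by simp
    then show ?thesis using * ys by (simp add: red_def)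
  qed
  show ?thesis
  proof (cases "s \<in> inversions W ss")
    case False
    have "r = s" if "r \<in> carrier W" "s = s \<otimes> r \<otimes> s" for r
    proof -
      have "s \<otimes> s \<otimes> s = s \<otimes> (s \<otimes> r \<otimes> s) \<otimes> s" using that by simp
      then show ?thesis using s that(1) by (simp add: m_assoc)
    qed
    then have "s \<in> inversions W (s # ss)"
      using False inversions_closed[OF ss] by auto
    then show ?thesis using shorter[of "s # ss"] False s ss by simp
  qed (use shorter ss in blast)
qed

lemma exchange:
  assumes "s \<in> S" "ss \<in> lists S" "len (s \<otimes> word_prod W ss) \<le> len (word_prod W ss)"
  shows "\<exists>xs t ys. ss = xs @ t # ys \<and> s \<otimes> word_prod W ss = word_prod W (xs @ ys)"
  using left_descent_cases[OF assms(1,2)] assms inversions_exchange by fastforce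

lemma red_Cons_D: "red (s # ss) \<Longrightarrow> red ss"
proof -
  assume r: "red (s # ss)"
  then have l: "s \<in> S" "ss \<in> lists S" using red_lists by auto
  obtain ys where ys: "red ys" "word_prod W ys = word_prod W ss"
    using red_obtain[of "word_prod W ss"] l by auto
  then have "len (s \<otimes> word_prod W ss) \<le> Suc (length ys)"
    using len_le[of "s # ys"] l red_lists[OF ys(1)] by simp
  then have "length ss \<le> len (word_prod W ss)" using r ys by (simp add: red_def)
  then show "red ss" using len_le[OF l(2)] l by (simp add: red_def)
qed

lemma red_Cons_iff:
  assumes "s \<in> S" "red ss"
  shows "red (s # ss) \<longleftrightarrow> len (word_prod W ss) < len (s \<otimes> word_prod W ss)"
proof -
  have "len (s \<otimes> word_prod W ss) \<le> Suc (len (word_prod W ss))"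
    using assms len_le[of "s # ss"] red_lists[OF assms(2)] by (simp add: red_def)
  then show ?thesis using assms red_lists by (auto simp: red_def)
qed

lemma len_mult_le:
  assumes "x \<in> carrier W" "y \<in> carrier W"
  shows "len (x \<otimes> y) \<le> len x + len y"
proof -
  obtain xs ys where *: "red xs" "word_prod W xs = x" "red ys" "word_prod W ys = y"
    using red_obtain assms by metis
  then show ?thesis
    using len_le[of "xs @ ys"] red_lists by (simp add: word_prod_append red_def)
qed

lemma word_prod_rev: "ss \<in> lists S \<Longrightarrow> word_prod W (rev ss) = inv (word_prod W ss)"
proof (induction ss)
  case (Cons s ss)
  then have "rev ss \<in> lists S" by (simp add: in_lists_conv_set)
  with Cons show ?case by (simp add: word_prod_append inv_mult_group)
qed simp

lemma len_inv: "x \<in> carrier W \<Longrightarrow> len (inv x) = len x"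
proof -
  have le: "len (inv x) \<le> len x" if x: "x \<in> carrier W" for x
  proof -
    obtain xs where *: "red xs" "word_prod W xs = x" using red_obtain x by metis
    moreover have "rev xs \<in> lists S" using red_lists[OF *(1)] by (simp add: in_lists_conv_set)
    ultimately show ?thesis
      using len_le[of "rev xs"] word_prod_rev[of xs] red_lists[of xs] by (simp add: red_def)
  qed
  assume x: "x \<in> carrier W"
  then show ?thesis using le[of x] le[of "inv x"] by simp
qed

lemma append_eq_split_Cons:
  assumes "xs @ ys = as @ t # bs"
  obtains cs where "xs = as @ t # cs" "bs = cs @ ys" | cs where "ys = cs @ t # bs" "as = xs @ cs"
proof -
  from assms consider us where "xs = as @ us" "us @ ys = t # bs"
    | us where "as = xs @ us" "ys = us @ t # bs"
    by (auto simp: append_eq_append_conv2)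
  then show thesis using that by cases (metis append_Nil append_Nil2 append_eq_Cons_conv, metis)
qed

text \<open>Induction on the prefix. Let \<open>xs @ ys\<close> be a reduced word of w. The exchange
  for the descent s deletes one of its letters; this letter cannot lie in \<open>xs\<close>, since
  \<open>s # xs\<close> is reduced, so it lies in \<open>ys\<close>, and \<open>s # xs\<close>
  becomes a prefix.\<close>

lemma ex_reduced_prefix:
  assumes "w \<in> carrier W" and desc: "\<And>s. s \<in> J \<Longrightarrow> len (s \<otimes> w) < len w"
    and "J \<subseteq> S" "xs \<in> lists J" "red xs"
  shows "\<exists>ys. red (xs @ ys) \<and> word_prod W (xs @ ys) = w"
  using assms(4,5)
proof (induction xs)
  case Nil
  then show ?case using red_obtain[OF assms(1)] by auto
next
  case (Cons s xs)
  then obtain ys where ys: "red (xs @ ys)" "word_prod W (xs @ ys) = w"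
    using red_Cons_D by auto
  have s: "s \<in> S" "s \<in> J" and l: "xs \<in> lists S" "ys \<in> lists S"
    using Cons assms(3) red_lists[OF ys(1)] by auto
  obtain as t bs where *: "xs @ ys = as @ t # bs" "s \<otimes> w = word_prod W (as @ bs)"
    using exchange[OF s(1), of "xs @ ys"] desc[OF s(2)] ys l by fastforce
  then have abt: "as \<in> lists S" "bs \<in> lists S" "t \<in> S"
    using l by (metis append_in_lists_conv Cons_in_lists_iff)+
  consider cs where "xs = as @ t # cs" "bs = cs @ ys"
    | cs where "ys = cs @ t # bs" "as = xs @ cs"
  using *(1) by (rule append_eq_split_Cons)
  then show ?case
  proof cases
    case 1
    have cs: "cs \<in> lists S" using l 1 by simp
    have "s \<otimes> word_prod W xs \<otimes> word_prod W ys = word_prod W (as @ cs) \<otimes> word_prod W ys"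
      using *(2) ys(2) s l abt cs 1 by (simp add: word_prod_append m_assoc flip: ys(2))
    then have "s \<otimes> word_prod W xs = word_prod W (as @ cs)"
      using s l abt cs by simp
    then have "len (word_prod W (s # xs)) \<le> length (as @ cs)"
      using len_le[of "as @ cs"] abt cs by simp
    then show ?thesis using Cons.prems 1 by (simp add: red_def)
  next
    case 2
    have cs: "cs \<in> lists S" using l 2 by simp
    have "w = s \<otimes> (s \<otimes> w)" using assms(1) s by simp
    also have "\<dots> = word_prod W ((s # xs) @ cs @ bs)" using * 2 by simp
    finally have w: "w = word_prod W ((s # xs) @ cs @ bs)" .
    moreover have "length ((s # xs) @ cs @ bs) = len w"
      using ys 2 by (simp add: red_def)
    moreover have "(s # xs) @ cs @ bs \<in> lists S" using s l cs abt by simp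
    ultimately show ?thesis unfolding red_def by (intro exI[of _ "cs @ bs"]) simp
  qed
qed

lemma red_append_len:
  assumes "red (xs @ ys)"
  shows "len (word_prod W (xs @ ys)) = len (word_prod W xs) + len (word_prod W ys)"
    and "red xs"
proof -
  have l: "xs \<in> lists S" "ys \<in> lists S" using red_lists[OF assms] by auto
  have "len (word_prod W (xs @ ys)) \<le> len (word_prod W xs) + len (word_prod W ys)"
    using l by (simp add: word_prod_append len_mult_le)
  moreover have "len (word_prod W xs) \<le> length xs" "len (word_prod W ys) \<le> length ys"
    using l len_le by auto
  moreover have "len (word_prod W (xs @ ys)) = length xs + length ys"
    using assms by (simp add: red_def)
  ultimately show "len (word_prod W (xs @ ys)) = len (word_prod W xs) + len (word_prod W ys)"
    "red xs" using l by (auto simp: red_def)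
qed

subsection \<open>Matsumoto's theorem\<close>

lemma finite_inversions: "finite (inversions W ss)"
  by (induction ss) auto

text \<open>Together with \<open>inversions_eq\<close> this bounds lengths from below: every word of
  an element has at least as many letters as the element has inversions.\<close>

lemma card_inversions_le: "card (inversions W ss) \<le> length ss"
proof (induction ss)
  case (Cons s ss)
  have "card (inversions W (s # ss)) \<le> card (insert s ((\<lambda>r. s \<otimes> r \<otimes> s) ` inversions W ss))"
    by (intro card_mono) (auto simp: finite_inversions)
  also have "\<dots> \<le> Suc (card (inversions W ss))"
    using card_image_le[OF finite_inversions, of "\<lambda>r. s \<otimes> r \<otimes> s" ss]
    by (simp add: card_insert_if finite_inversions)
  finally show ?case using Cons by simp
qed simp

text \<open>The value 0 of \<open>ord\<close> stands for infinite order, in which case k is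
  unrestricted.\<close>

lemma inj_on_pow:
  assumes "x \<in> carrier W" "ord x = 0 \<or> k \<le> ord x"
  shows "inj_on (\<lambda>j. x [^] (j::nat)) {..<k}"
proof (rule linorder_inj_onI)
  fix i j :: nat
  assume ij: "i < j" "i \<in> {..<k}" "j \<in> {..<k}"
  show "x [^] i \<noteq> x [^] j"
  proof
    assume eq: "x [^] i = x [^] j"
    have "x [^] i \<otimes> x [^] (j - i) = x [^] i \<otimes> \<one>"
      using ij assms(1) by (simp add: nat_pow_mult[OF assms(1)] eq[symmetric] del: add_diff_assoc)
    then have "ord x dvd j - i" using assms(1) by (simp add: pow_eq_id)
    then show False using assms(2) ij by (auto dest: dvd_imp_le)
  qed
qed auto

lemma inversions_alternating:
  assumes "s \<in> S" "t \<in> S" "inj_on (\<lambda>j. (s \<otimes> t) [^] (j::nat)) {..<k}"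
  shows "inversions W (alternating k s t) = (\<lambda>j. (s \<otimes> t) [^] j \<otimes> s) ` {..<k}"
  using assms(3)
proof (induction k)
  case (Suc k)
  have "(s \<otimes> t) [^] k \<otimes> s \<notin> (\<lambda>j. (s \<otimes> t) [^] j \<otimes> s) ` {..<k}"
  proof
    assume "(s \<otimes> t) [^] k \<otimes> s \<in> (\<lambda>j. (s \<otimes> t) [^] j \<otimes> s) ` {..<k}"
    then obtain j where "j < k" "(s \<otimes> t) [^] k = (s \<otimes> t) [^] j"
      using assms(1,2) by auto
    then show False using inj_onD[OF Suc.prems, of k j] by simp
  qed
  moreover have "inj_on (\<lambda>j. (s \<otimes> t) [^] j) {..<k}"
    using Suc.prems by (rule inj_on_subset) auto
  ultimately show ?case
    using inversions_alternating_Suc[OF assms(1,2), of k] Suc.IH by (auto simp: lessThan_Suc)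
qed simp

lemma length_alternating [simp]: "length (alternating k s t) = k"
  by (induction k arbitrary: s t) auto

text \<open>The k reflections (st)^j s are pairwise distinct, so none of them cancels and every word
  with the same value has at least k letters.\<close>

lemma red_alternating:
  assumes "s \<in> S" "t \<in> S" "inj_on (\<lambda>j. (s \<otimes> t) [^] (j::nat)) {..<k}"
  shows "red (alternating k s t)"
proof -
  have l: "alternating k s t \<in> lists S" using assms by (simp add: alternating_lists)
  obtain ys where ys: "red ys" "word_prod W ys = word_prod W (alternating k s t)"
    using red_obtain[of "word_prod W (alternating k s t)"] l by auto
  have "inj_on (\<lambda>j. (s \<otimes> t) [^] j \<otimes> s) {..<k}"
  proof (rule inj_onI)
    fix i j assume ij: "i \<in> {..<k}" "j \<in> {..<k}" "(s \<otimes> t) [^] i \<otimes> s = (s \<otimes> t) [^] j \<otimes> s"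
    have "(s \<otimes> t) [^] i = (s \<otimes> t) [^] j" by (rule r_cancel[OF ij(3)]) (use assms in auto)
    then show "i = j" by (rule inj_onD[OF assms(3) _ ij(1,2)])
  qed
  then have "k = card (inversions W (alternating k s t))"
    by (simp add: inversions_alternating[OF assms] card_image)
  also have "\<dots> = card (inversions W ys)"
    by (simp only: inversions_eq[OF red_lists[OF ys(1)] l ys(2)])
  also have "\<dots> \<le> len (word_prod W (alternating k s t))"
    using card_inversions_le[of ys] ys by (simp add: red_def)
  finally show ?thesis using len_le[OF l(1)] l by (simp add: red_def)
qed



text \<open>Stated for all k to permit induction; when k is the order of st the right side is 1,
  which is the braid relation.\<close>

lemma braid_relation_prod:
  assumes "s \<in> S" "t \<in> S"
  shows "word_prod W (alternating k s t) \<otimes> inv (word_prod W (alternating k t s)) = (s \<otimes> t) [^] k"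
  using assms
proof (induction k arbitrary: s t)
  case (Suc k)
  have l: "alternating k s t \<in> lists S" "alternating k t s \<in> lists S"
    using Suc.prems alternating_lists by auto
  have "word_prod W (alternating (Suc k) s t) \<otimes> inv (word_prod W (alternating (Suc k) t s))
    = s \<otimes> (word_prod W (alternating k t s) \<otimes> inv (word_prod W (alternating k s t)) \<otimes> t)"
    using Suc.prems l by (simp add: inv_mult_group m_assoc)
  then show ?case using conj_pow Suc by simp
qed simp

lemma braid_relation_holds:
  assumes "s \<in> S" "t \<in> S"
  shows "word_prod W (alternating (ord (s \<otimes> t)) s t) = word_prod W (alternating (ord (s \<otimes> t)) t s)"
proof -
  let ?p = "word_prod W (alternating (ord (s \<otimes> t)) s t)" and ?q = "word_prod W (alternating (ord (s \<otimes> t)) t s)"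
  have c: "?p \<in> carrier W" "?q \<in> carrier W" using assms alternating_lists by auto
  have "?p \<otimes> inv ?q = \<one>" using braid_relation_prod[OF assms] assms by simp
  then have "?p \<otimes> inv ?q \<otimes> ?q = ?q" using c by simp
  then show ?thesis using c by (simp add: m_assoc)
qed

text \<open>
  If the two words start with \<open>s \<noteq> t\<close>, both \<open>s\<close> and \<open>t\<close> are left descents of the common value,
  which therefore has reduced words starting with either side of the braid relation of \<open>s\<close> and
  \<open>t\<close>; these words interpolate between the given ones.
\<close>

theorem matsumoto:
  assumes f: "\<And>s t. s \<in> S \<Longrightarrow> t \<in> S \<Longrightarrow> s \<noteq> t \<Longrightarrow> ord (s \<otimes> t) > 0 \<Longrightarrow>
      word_prod G (map f (alternating (ord (s \<otimes> t)) s t))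
      = word_prod G (map f (alternating (ord (s \<otimes> t)) t s))"
    and G: "group G" "f \<in> S \<rightarrow> carrier G"
    and red: "red xs" "red ys" "word_prod W xs = word_prod W ys"
  shows "word_prod G (map f xs) = word_prod G (map f ys)"
  using red
proof (induction "length xs" arbitrary: xs ys)
  case 0
  then show ?case by (metis length_0_conv red_def)
next
  case (Suc n)
  interpret G: group G by (rule G)
  have len: "length ys = Suc n" using Suc by (metis red_def)
  obtain s xs' where xs: "xs = s # xs'" using Suc by (metis Suc_length_conv)
  obtain t ys' where ys: "ys = t # ys'" using len by (metis Suc_length_conv)
  \<comment> \<open>Words with the same first letter are compared through their tails, to which the
    induction hypothesis applies.\<close>
  have same: "word_prod G (map f (r # us)) = word_prod G (map f (r # vs))"
    if "red (r # us)" "red (r # vs)" "length us = n"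
      "word_prod W (r # us) = word_prod W (r # vs)" for r us vs
  proof -
    have "r \<in> S" "us \<in> lists S" "vs \<in> lists S" using that red_lists by fastforce+
    then have "word_prod W us = word_prod W vs" using that by simp
    then show ?thesis using Suc.hyps(1)[of us vs] that red_Cons_D by auto
  qed
  show ?case
  proof (cases "s = t")
    case True
    then show ?thesis using same[of s xs' ys'] Suc xs ys by simp
  next
    case False
    let ?w = "word_prod W xs" and ?m = "ord (s \<otimes> t)"
    have st: "s \<in> S" "t \<in> S" and l: "xs' \<in> lists S" "ys' \<in> lists S"
      using red_lists Suc.prems xs ys by fastforce+
    have w: "?w \<in> carrier W" using Suc.prems red_lists by simp
    have descent: "len (r \<otimes> word_prod W (r # us)) < len (word_prod W (r # us))"
      if "red (r # us)" for r us
      using red_Cons_D[OF that] that by (simp add: red_def)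
    have "len (s \<otimes> ?w) < len ?w" "len (t \<otimes> ?w) < len ?w"
      using descent[of s xs'] descent[of t ys'] Suc.prems unfolding xs ys by simp_all
    then have desc: "len (r \<otimes> ?w) < len ?w" if "r \<in> {s, t}" for r
      using that by auto
    have prefix: "\<exists>vs. red (alternating k a b @ vs) \<and> word_prod W (alternating k a b @ vs) = ?w"
      if "inj_on (\<lambda>j. (a \<otimes> b) [^] (j::nat)) {..<k}" "{a, b} = {s, t}" for k a b
    proof (rule ex_reduced_prefix[where J = "{s, t}"])
      have "set (alternating k a b) \<subseteq> {a, b}" by (induction k arbitrary: a b) fastforce+
      then show "alternating k a b \<in> lists {s, t}" using that by (auto simp: in_lists_conv_set)
      show "red (alternating k a b)" using that st by (intro red_alternating) auto
    qed (use w desc st in auto)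
    have inj: "inj_on (\<lambda>j. (a \<otimes> b) [^] (j::nat)) {..<k}" if "ord (a \<otimes> b) = 0 \<or> k \<le> ord (a \<otimes> b)"
      "a \<in> S" "b \<in> S" for a b k
      using that by (intro inj_on_pow) auto
    have "?m > 0"
    proof (rule ccontr)
      assume "\<not> ?m > 0"
      \<comment> \<open>For infinite order alternating words of every length are reduced; one of
        length n + 2 would then be a prefix of a reduced word of \<open>?w\<close>, whose length is
        n + 1.\<close>
      then obtain vs where "red (alternating (Suc (Suc n)) s t @ vs)"
        "word_prod W (alternating (Suc (Suc n)) s t @ vs) = ?w"
        using prefix[OF inj, of s t "Suc (Suc n)"] st by blast
      then have "Suc (Suc n) \<le> len ?w" by (metis red_def length_append length_alternating le_add1)
      then show False using Suc by (metis red_def Suc_n_not_le_n)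
    qed
    obtain vs where vs: "red (alternating ?m s t @ vs)" "word_prod W (alternating ?m s t @ vs) = ?w"
      using prefix[OF inj, of s t ?m] st by auto
    have vl: "vs \<in> lists S" "alternating ?m s t \<in> lists S" "alternating ?m t s \<in> lists S"
      using red_lists[OF vs(1)] st by (auto simp: alternating_lists)
    have eq: "word_prod W (alternating ?m t s @ vs) = ?w"
      using vs(2) vl braid_relation_holds[OF st] by (simp add: word_prod_append)
    then have vs': "red (alternating ?m t s @ vs)"
      using vs vl by (simp add: red_def)
    obtain k where k: "?m = Suc k" using \<open>?m > 0\<close> by (metis gr0_implies_Suc)
    have n: "length (alternating ?m s t @ vs) = Suc n"
      using vs Suc by (metis red_def)
    \<comment> \<open>Both words start with s, and at the other end of the chain both start with t,
      so \<open>same\<close> applies; the middle step is the braid relation itself.\<close>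
    have "word_prod G (map f xs) = word_prod G (map f (alternating ?m s t @ vs))"
      unfolding k alternating.simps append_Cons xs
      by (rule same) (use Suc.prems Suc.hyps(2) vs k xs n in simp_all)
    also have "\<dots> = word_prod G (map f (alternating ?m t s @ vs))"
    proof -
      have "map f us \<in> lists (carrier G)" if "us \<in> lists S" for us
        using that G(2) by (auto simp: in_lists_conv_set)
      then show ?thesis
        using f[OF st False \<open>?m > 0\<close>] vl by (simp add: G.word_prod_append)
    qed
    also have "\<dots> = word_prod G (map f ys)"
      unfolding k alternating.simps append_Cons ys
      by (rule same) (use Suc.prems vs' eq k ys n in simp_all)
    finally show ?thesis .
  qed
qed

lemma len_one [simp]: "len \<one> = 0"
  using len_le[of "[]"] by simp

lemma len_eq_0: "x \<in> carrier W \<Longrightarrow> len x = 0 \<Longrightarrow> x = \<one>"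
  using red_obtain[of x] by (metis red_def length_0_conv word_prod_simps(1))

subsection \<open>Longest elements of parabolic subgroups\<close>

lemma generate_eq_words:
  assumes "I \<subseteq> S"
  shows "generate W I = word_prod W ` lists I"
proof (intro equalityI subsetI)
  have l: "xs \<in> lists (carrier W)" if "xs \<in> lists I" for xs
    using that assms gens_closed lists_mono by (metis in_mono order_trans)
  fix w assume "w \<in> generate W I"
  then show "w \<in> word_prod W ` lists I"
  proof (induction rule: generate.induct)
    case one
    then show ?case by (intro image_eqI[of _ _ "[]"]) auto
  next
    case (incl s)
    then show ?case using assms by (intro image_eqI[of _ _ "[s]"]) auto
  next
    case (inv s)
    then show ?case using assms by (intro image_eqI[of _ _ "[s]"]) auto
  next
    case (eng x y)
    then obtain xs ys where "xs \<in> lists I" "ys \<in> lists I" "x = word_prod W xs" "y = word_prod W ys"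
      by blast
    then show ?case using l by (intro image_eqI[of _ _ "xs @ ys"]) (auto simp: word_prod_append)
  qed
next
  fix w assume "w \<in> word_prod W ` lists I"
  then obtain xs where "xs \<in> lists I" "w = word_prod W xs" by blast
  then show "w \<in> generate W I"
    by (induction xs arbitrary: w) (auto intro: generate.intros)
qed

lemma generate_carrier: "I \<subseteq> S \<Longrightarrow> x \<in> generate W I \<Longrightarrow> x \<in> carrier W"
  using generate_incl[of I] gens_closed by blast

lemma len_gen_mult:
  assumes "s \<in> S" "x \<in> carrier W"
  shows "len x \<le> Suc (len (s \<otimes> x))" "len (s \<otimes> x) \<le> Suc (len x)"
proof -
  have "len s \<le> 1" using len_le[of "[s]"] assms by simp
  then show "len (s \<otimes> x) \<le> Suc (len x)" "len x \<le> Suc (len (s \<otimes> x))"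
    using len_mult_le[of s x] len_mult_le[of s "s \<otimes> x"] assms by auto
qed

text \<open>Exchange only deletes letters, so a word over I is shortened to a reduced one without
  leaving I.\<close>

lemma parabolic_red:
  assumes "I \<subseteq> S" "x \<in> generate W I"
  obtains xs where "xs \<in> lists I" "red xs" "word_prod W xs = x"
proof -
  have "\<exists>ys\<in>lists I. red ys \<and> word_prod W ys = word_prod W xs" if "xs \<in> lists I" for xs
    using that
  proof (induction xs)
    case Nil
    then show ?case by (intro bexI[of _ "[]"]) (auto simp: red_def)
  next
    case (Cons s xs)
    then obtain ys where ys: "ys \<in> lists I" "red ys" "word_prod W ys = word_prod W xs" by blast
    have s: "s \<in> S" using Cons assms by auto
    show ?case
    proof (cases "red (s # ys)")
      case True
      then show ?thesis using ys Cons by (intro bexI[of _ "s # ys"]) auto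
    next
      case False
      then have "len (s \<otimes> word_prod W ys) \<le> len (word_prod W ys)"
        using red_Cons_iff[OF s ys(2)] by simp
      then obtain as t bs where *: "ys = as @ t # bs" "s \<otimes> word_prod W ys = word_prod W (as @ bs)"
        using exchange[OF s red_lists[OF ys(2)]] by blast
      have "as @ bs \<in> lists I" using * ys by auto
      moreover have "as @ bs \<in> lists S" using * red_lists[OF ys(2)] by auto
      moreover have "length (as @ bs) \<le> len (word_prod W (as @ bs))"
        using len_gen_mult(1)[OF s, of "word_prod W ys"] red_lists[OF ys(2)] ys(2) *
        by (simp add: red_def)
      ultimately show ?thesis
        using * ys len_le[of "as @ bs"] by (intro bexI[of _ "as @ bs"]) (auto simp: red_def)
    qed
  qed
  then show thesis using assms that by (auto simp: generate_eq_words)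
qed

text \<open>A reduced word of u over I is a prefix of a reduced word of w, by
  \<open>ex_reduced_prefix\<close>.\<close>

lemma len_split_of_descents:
  assumes "I \<subseteq> S" "w \<in> carrier W" "\<And>s. s \<in> I \<Longrightarrow> len (s \<otimes> w) < len w" "u \<in> generate W I"
  shows "len w = len u + len (inv u \<otimes> w)"
proof -
  obtain xs where xs: "xs \<in> lists I" "red xs" "word_prod W xs = u"
    using parabolic_red assms by blast
  obtain ys where ys: "red (xs @ ys)" "word_prod W (xs @ ys) = w"
    using ex_reduced_prefix[OF assms(2,3,1) xs(1,2)] by blast
  have l: "xs \<in> lists S" "ys \<in> lists S" using red_lists[OF ys(1)] by auto
  have "inv u \<otimes> w = word_prod W ys"
    using xs ys l by (simp add: word_prod_append flip: xs(3) ys(2) m_assoc)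
  then show ?thesis using red_append_len(1)[OF ys(1)] xs ys by simp
qed

text \<open>Each of the two elements splits off the other with additive lengths, so both quotients
  have length 0.\<close>

lemma parabolic_descents_unique:
  assumes "I \<subseteq> S" "w \<in> generate W I" "\<And>s. s \<in> I \<Longrightarrow> len (s \<otimes> w) < len w"
    "w' \<in> generate W I" "\<And>s. s \<in> I \<Longrightarrow> len (s \<otimes> w') < len w'"
  shows "w = w'"
proof -
  have c: "w \<in> carrier W" "w' \<in> carrier W" using assms generate_carrier by auto
  have "len w = len w' + len (inv w' \<otimes> w)" "len w' = len w + len (inv w \<otimes> w')"
    using assms c by (auto intro!: len_split_of_descents[of I])
  then have "len (inv w' \<otimes> w) = 0" by simp
  then have "inv w' \<otimes> w = \<one>" using c len_eq_0 by simp
  then have "w' \<otimes> (inv w' \<otimes> w) = w'" using c by simp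
  then show ?thesis using c by (simp flip: m_assoc)
qed

lemma max_len_descents:
  assumes "I \<subseteq> S" "w \<in> generate W I" "\<And>x. x \<in> generate W I \<Longrightarrow> len x \<le> len w" "s \<in> I"
  shows "len (s \<otimes> w) < len w"
proof -
  obtain xs where xs: "xs \<in> lists I" "red xs" "word_prod W xs = w"
    using parabolic_red assms by blast
  have "s \<otimes> w \<in> generate W I" using assms by (auto intro: generate.intros)
  then have "len (s \<otimes> w) \<le> len w" using assms by blast
  then show ?thesis
    using left_descent_cases[of s xs] xs assms red_lists by auto
qed

lemma spherical_subset: "spherical W S I \<Longrightarrow> I \<subseteq> S"
  by (simp add: spherical_def)

abbreviation "longest \<equiv> longest_elem W S"

text \<open>Resolves the \<open>THE\<close> in \<open>longest_elem\<close>: an element of maximal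
  length has every generator in I as a left descent, and such an element is unique.\<close>

lemma longest_elem_eqI:
  assumes "spherical W S I" "w \<in> generate W I" "\<And>x. x \<in> generate W I \<Longrightarrow> len x \<le> len w"
  shows "longest I = w"
  unfolding longest_elem_def
proof (rule the_equality)
  show "is_arg_max len (\<lambda>w. w \<in> generate W I) w"
    using assms by (auto simp: is_arg_max_def not_less)
next
  fix v assume "is_arg_max len (\<lambda>w. w \<in> generate W I) v"
  then have "v \<in> generate W I" "\<And>x. x \<in> generate W I \<Longrightarrow> len x \<le> len v"
    by (auto simp: is_arg_max_def not_less)
  moreover have sub: "I \<subseteq> S" using assms(1) by (rule spherical_subset)
  ultimately show "v = w"
    using parabolic_descents_unique[OF sub _ max_len_descents[OF sub] assms(2) max_len_descents[OF sub]]
      assms(2,3) by blast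
qed

lemma longest_elem:
  assumes "spherical W S I"
  shows "longest I \<in> generate W I"
    and "x \<in> generate W I \<Longrightarrow> len x \<le> len (longest I)"
proof -
  let ?L = "len ` generate W I"
  have "finite ?L" "?L \<noteq> {}" using assms generate.one by (auto simp: spherical_def)
  then obtain w where w: "w \<in> generate W I" "len w = Max ?L"
    using Max_in by (metis (no_types, lifting) imageE)
  have *: "len x \<le> len w" if "x \<in> generate W I" for x
    using w that \<open>finite ?L\<close> by simp
  have "longest I = w" by (rule longest_elem_eqI[OF assms w(1) *])
  then show "longest I \<in> generate W I"
    "x \<in> generate W I \<Longrightarrow> len x \<le> len (longest I)"
    using w * by auto
qed

lemma longest_elem_carrier [simp]: "spherical W S I \<Longrightarrow> longest I \<in> carrier W"
  using longest_elem(1) generate_carrier spherical_subset by blast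

lemma generate_inv: "I \<subseteq> S \<Longrightarrow> x \<in> generate W I \<Longrightarrow> inv x \<in> generate W I"
  using generate_m_inv_closed gens_closed by blast

lemma longest_elem_inv [simp]:
  assumes "spherical W S I"
  shows "inv (longest I) = longest I"
  using assms longest_elem[OF assms] spherical_subset generate_inv len_inv
  by (intro longest_elem_eqI[symmetric]) auto

lemma longest_elem_sq [simp]:
  assumes "spherical W S I"
  shows "longest I \<otimes> longest I = \<one>"
  using r_inv[OF longest_elem_carrier[OF assms]] assms by simp

text \<open>All generators in I are left descents, which gives the first form; the second is its
  image under inversion, which preserves length and fixes the longest element.\<close>

lemma len_longest_split:
  assumes "spherical W S I" "u \<in> generate W I"
  shows "len (longest I) = len u + len (inv u \<otimes> longest I)"
    and "len (longest I) = len u + len (longest I \<otimes> u)"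
proof -
  let ?w = "longest I"
  have sub: "I \<subseteq> S" using assms spherical_subset by simp
  then show *: "len ?w = len u + len (inv u \<otimes> ?w)"
    using assms longest_elem[OF assms(1)] max_len_descents
    by (intro len_split_of_descents) (auto simp: generate_carrier)
  have "len (inv u \<otimes> ?w) = len (inv (inv u \<otimes> ?w))"
    using assms generate_carrier[OF sub] by (intro len_inv[symmetric]) auto
  also have "inv (inv u \<otimes> ?w) = ?w \<otimes> u"
    using assms generate_carrier[OF sub] by (simp add: inv_mult_group)
  finally show "len ?w = len u + len (?w \<otimes> u)" using * by simp
qed

subsection \<open>Direct products\<close>

lemma direct_prod_facts:
  assumes "I \<subseteq> S" "J \<subseteq> S" "parabolic_direct_prod W (I \<union> J) I J"
  shows "\<And>x y. x \<in> generate W I \<Longrightarrow> y \<in> generate W J \<Longrightarrow> x \<otimes> y = y \<otimes> x"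
    and "\<And>x y x' y'. x \<in> generate W I \<Longrightarrow> y \<in> generate W J \<Longrightarrow> x' \<in> generate W I \<Longrightarrow> y' \<in> generate W J
      \<Longrightarrow> x \<otimes> y = x' \<otimes> y' \<Longrightarrow> x = x' \<and> y = y'"
    and "\<And>z. z \<in> generate W (I \<union> J) \<Longrightarrow> \<exists>x\<in>generate W I. \<exists>y\<in>generate W J. z = x \<otimes> y"
proof -
  have car: "carrier (subgroup_generated W K) = generate W K" if "K \<subseteq> S" for K
    using that gens_closed by (simp add: carrier_subgroup_generated Int_absorb1)
  have sub: "I \<union> J \<subseteq> S" using assms by simp
  have iso: "(\<lambda>(x, y). x \<otimes> y) \<in> hom (subgroup_generated W I \<times>\<times> subgroup_generated W J) (subgroup_generated W (I \<union> J))"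
    "bij_betw (\<lambda>(x, y). x \<otimes> y) (generate W I \<times> generate W J) (generate W (I \<union> J))"
    using assms(3) car[OF assms(1)] car[OF assms(2)] car[OF sub]
    by (simp_all add: parabolic_direct_prod_def iso_def)
  show "x \<otimes> y = y \<otimes> x" if "x \<in> generate W I" "y \<in> generate W J" for x y
  proof -
    have "x \<in> carrier W" "y \<in> carrier W" using that generate_carrier assms by blast+
    \<comment> \<open>Multiplicativity at (1, y) and (x, 1), whose product is (x, y), is exactly the
      commutation of x and y.\<close>
    moreover have "(\<one>, y) \<in> carrier (subgroup_generated W I \<times>\<times> subgroup_generated W J)"
      "(x, \<one>) \<in> carrier (subgroup_generated W I \<times>\<times> subgroup_generated W J)"
      using that car assms generate.one by auto
    ultimately show ?thesis using hom_mult[OF iso(1), of "(\<one>, y)" "(x, \<one>)"] by simp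
  qed
  show "x = x' \<and> y = y'"
    if "x \<in> generate W I" "y \<in> generate W J" "x' \<in> generate W I" "y' \<in> generate W J"
      "x \<otimes> y = x' \<otimes> y'" for x y x' y'
    using bij_betw_imp_inj_on[OF iso(2)] that by (auto simp: inj_on_def)
  show "\<exists>x\<in>generate W I. \<exists>y\<in>generate W J. z = x \<otimes> y" if "z \<in> generate W (I \<union> J)" for z
    using that unfolding bij_betw_imp_surj_on[OF iso(2), symmetric] by auto
qed

text \<open>The word \<open>xs @ ys\<close> stays reduced while letters are added in front. An
  exchange can delete no letter of \<open>xs\<close>, since \<open>s # xs\<close> is reduced, and
  none of \<open>ys\<close>, since s x y = x y' would give s x = x by uniqueness of the
  components.\<close>

lemma len_direct_prod:
  assumes sub: "I \<subseteq> S" "J \<subseteq> S" and dp: "parabolic_direct_prod W (I \<union> J) I J"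
    and "x \<in> generate W I" "y \<in> generate W J"
  shows "len (x \<otimes> y) = len x + len y"
proof -
  note facts = direct_prod_facts[OF sub dp]
  obtain ys where ys: "ys \<in> lists J" "red ys" "word_prod W ys = y"
    using parabolic_red assms by blast
  have ly: "ys \<in> lists S" using red_lists[OF ys(2)] .
  have "red (xs @ ys)" if "xs \<in> lists I" "red xs" for xs
    using that
  proof (induction xs)
    case (Cons s xs)
    then have r: "red (xs @ ys)" "red xs" and s: "s \<in> S" using red_Cons_D sub by auto
    have lx: "xs \<in> lists S" using red_lists[OF r(2)] .
    show ?case
    proof (rule ccontr)
      assume "\<not> red ((s # xs) @ ys)"
      then have "len (s \<otimes> word_prod W (xs @ ys)) \<le> len (word_prod W (xs @ ys))"
        using red_Cons_iff[OF s r(1)] by simp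
      then obtain as t bs where *: "xs @ ys = as @ t # bs" "s \<otimes> word_prod W (xs @ ys) = word_prod W (as @ bs)"
        using exchange[OF s, of "xs @ ys"] lx ly by auto
      have sx: "s \<otimes> word_prod W xs \<in> generate W I" "word_prod W xs \<in> generate W I"
        using Cons sub by (auto simp: generate_eq_words intro!: image_eqI[of _ _ "s # xs"])
      consider cs where "xs = as @ t # cs" "bs = cs @ ys"
        | cs where "ys = cs @ t # bs" "as = xs @ cs"
      using *(1) by (rule append_eq_split_Cons)
      then show False
      proof cases
        case 1
        have l: "as \<in> lists S" "cs \<in> lists S" using 1 lx by auto
        then have "s \<otimes> word_prod W xs \<otimes> word_prod W ys = word_prod W (as @ cs) \<otimes> word_prod W ys"
          using *(2) lx ly s 1 by (simp add: word_prod_append m_assoc)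
        then have "s \<otimes> word_prod W xs = word_prod W (as @ cs)" using l lx ly s by simp
        then have "len (word_prod W (s # xs)) \<le> length (as @ cs)"
          using len_le[of "as @ cs"] l by simp
        then show False using Cons.prems 1 by (simp add: red_def)
      next
        case 2
        have l: "cs \<in> lists J" "bs \<in> lists J" "cs \<in> lists S" "bs \<in> lists S" using 2 ly ys by auto
        have "(s \<otimes> word_prod W xs) \<otimes> word_prod W ys = word_prod W xs \<otimes> word_prod W (cs @ bs)"
          using *(2) lx ly s l 2(2) by (simp add: word_prod_append m_assoc)
        then have "s \<otimes> word_prod W xs = word_prod W xs"
          using facts(2)[OF sx(1) _ sx(2)] ys l sub by (auto simp: generate_eq_words)
        then show False using Cons.prems r by (simp add: red_def)
      qed
    qed
  qed (use ys in simp)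
  then show ?thesis
    using parabolic_red[OF sub(1) assms(4)] red_append_len(1) ys ly red_lists word_prod_append
    by (metis lists_carrier)
qed

text \<open>Lengths add up over the two factors, so a product of elements of maximal length is of
  maximal length.\<close>

lemma longest_elem_direct_prod:
  assumes "spherical W S I" "spherical W S J" "spherical W S (I \<union> J)"
    and dp: "parabolic_direct_prod W (I \<union> J) I J"
  shows "longest (I \<union> J) = longest I \<otimes> longest J"
    and "len (longest I \<otimes> longest J)
      = len (longest I) + len (longest J)"
    and "longest I \<otimes> longest J = longest J \<otimes> longest I"
proof -
  have sub: "I \<subseteq> S" "J \<subseteq> S" using assms spherical_subset by auto
  note facts = direct_prod_facts[OF sub dp] and len = len_direct_prod[OF sub dp]
  show c: "longest I \<otimes> longest J = longest J \<otimes> longest I"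
    using facts(1) longest_elem assms by blast
  show l: "len (longest I \<otimes> longest J)
      = len (longest I) + len (longest J)"
    using len longest_elem assms by blast
  have mono: "generate W I \<subseteq> generate W (I \<union> J)" "generate W J \<subseteq> generate W (I \<union> J)"
    by (auto intro!: mono_generate)
  show "longest (I \<union> J) = longest I \<otimes> longest J"
  proof (rule longest_elem_eqI[OF assms(3)])
    show "longest I \<otimes> longest J \<in> generate W (I \<union> J)"
      using longest_elem assms mono by (blast intro: generate.eng)
    fix z assume "z \<in> generate W (I \<union> J)"
    then obtain x y where "x \<in> generate W I" "y \<in> generate W J" "z = x \<otimes> y" using facts(3) by blast
    then show "len z \<le> len (longest I \<otimes> longest J)"
      using len l longest_elem(2) assms by (simp add: add_mono)
  qed
qed

subsection \<open>Conjugation by a longest element\<close>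

context
  fixes J w
  assumes J: "spherical W S J" and w: "w = longest J"
begin

text \<open>Two splittings of w share the part u w: len w = len u + len (u w), obtained from u^-1,
  and len w = len (u w) + len (w u w).\<close>

lemma conj_longest_len:
  assumes "u \<in> generate W J"
  shows "len (w \<otimes> u \<otimes> w) = len u"
proof -
  have sub: "J \<subseteq> S" using J spherical_subset by simp
  have c: "w \<in> carrier W" "u \<in> carrier W" using w J assms sub generate_carrier by auto
  have "u \<otimes> w \<in> generate W J" using assms longest_elem(1)[OF J] w by (auto intro: generate.intros)
  then have "len w = len (u \<otimes> w) + len (w \<otimes> (u \<otimes> w))"
    using len_longest_split(2)[OF J] w by simp
  moreover have "len w = len (inv u) + len (u \<otimes> w)"
    using len_longest_split(1)[OF J generate_inv[OF sub assms]] w c by simp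
  ultimately show ?thesis using c len_inv by (simp add: m_assoc)
qed

lemma conj_longest_generate:
  assumes "u \<in> generate W J" shows "w \<otimes> u \<otimes> w \<in> generate W J"
  using assms longest_elem(1)[OF J] w by (auto intro: generate.intros)

text \<open>The conjugate lies in W_J and has length 1, so a reduced word over J for it is a single
  letter.\<close>

lemma conj_longest_gen:
  assumes "s \<in> J" shows "w \<otimes> s \<otimes> w \<in> J"
proof -
  have sub: "J \<subseteq> S" using J spherical_subset by simp
  have s: "s \<in> generate W J" using assms by (rule generate.incl)
  have "len s \<le> 1" using len_le[of "[s]"] assms sub by auto
  moreover have "s \<noteq> \<one>" using gens_order[of s] assms sub ord_eq_1[of s] by auto
  then have "len s \<noteq> 0" using len_eq_0[of s] subsetD[OF sub assms] by auto
  ultimately have "len (w \<otimes> s \<otimes> w) = 1" using conj_longest_len[OF s] by simp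
  moreover obtain xs where "xs \<in> lists J" "red xs" "word_prod W xs = w \<otimes> s \<otimes> w"
    using parabolic_red[OF sub conj_longest_generate[OF s]] by blast
  ultimately have xs: "xs \<in> lists J" "length xs = 1" "word_prod W xs = w \<otimes> s \<otimes> w"
    by (auto simp: red_def)
  then obtain t where "xs = [t]" by (metis One_nat_def length_0_conv length_Suc_conv)
  with xs sub show ?thesis by auto
qed

lemma conj_longest_image:
  assumes "I \<subseteq> J"
  shows "generate W ((\<lambda>s. w \<otimes> s \<otimes> w) ` I) = (\<lambda>s. w \<otimes> s \<otimes> w) ` generate W I"
proof -
  have sub: "J \<subseteq> S" using J spherical_subset by simp
  have c: "w \<in> carrier W" "w \<otimes> w = \<one>" using w J by auto
  have prod: "word_prod W (map (\<lambda>s. w \<otimes> s \<otimes> w) xs) = w \<otimes> word_prod W xs \<otimes> w" if "xs \<in> lists I" for xs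
    using that
  proof (induction xs)
    case (Cons s xs)
    have "s \<in> S" "xs \<in> lists S"
      using Cons.hyps assms sub by (auto simp: in_lists_conv_set)
    then have sx: "s \<in> carrier W" "word_prod W xs \<in> carrier W" by auto
    have "w \<otimes> s \<otimes> w \<otimes> (w \<otimes> word_prod W xs \<otimes> w) = w \<otimes> s \<otimes> (w \<otimes> w) \<otimes> word_prod W xs \<otimes> w"
      using c(1) sx by (simp only: m_assoc m_closed)
    then show ?case using Cons.IH c sx by (simp add: m_assoc)
  qed (use c in simp)
  have "(\<lambda>s. w \<otimes> s \<otimes> w) ` I \<subseteq> S" using conj_longest_gen assms sub by blast
  then have "generate W ((\<lambda>s. w \<otimes> s \<otimes> w) ` I)
      = word_prod W ` map (\<lambda>s. w \<otimes> s \<otimes> w) ` lists I"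
    by (simp add: generate_eq_words lists_image)
  also have "\<dots> = (\<lambda>s. w \<otimes> s \<otimes> w) ` word_prod W ` lists I"
    unfolding image_image by (rule image_cong) (auto simp: prod)
  also have "word_prod W ` lists I = generate W I"
    using assms sub by (intro generate_eq_words[symmetric]) auto
  finally show ?thesis .
qed

lemma conj_longest_spherical:
  assumes "I \<subseteq> J" "spherical W S I"
  shows "spherical W S ((\<lambda>s. w \<otimes> s \<otimes> w) ` I)"
  using assms conj_longest_image[OF assms(1)] conj_longest_gen spherical_subset[OF J]
  unfolding spherical_def by (auto simp: subset_iff)

lemma conj_longest_longest:
  assumes "I \<subseteq> J" "spherical W S I"
  shows "longest ((\<lambda>s. w \<otimes> s \<otimes> w) ` I) = w \<otimes> longest I \<otimes> w"
proof -
  have sub: "generate W I \<subseteq> generate W J" using assms by (intro mono_generate)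
  have le: "longest I \<in> generate W I" using longest_elem assms by blast
  have len: "len (w \<otimes> x \<otimes> w) = len x" if "x \<in> generate W I" for x
    using conj_longest_len sub that by blast
  show ?thesis
    by (rule longest_elem_eqI[OF conj_longest_spherical[OF assms]])
      (use conj_longest_image[OF assms(1)] longest_elem(2)[OF assms(2)] len le in auto)
qed

end

subsection \<open>Lifts to the braid group\<close>

abbreviation "B \<equiv> braid_group W S"

lemma group_braid_group: "group B"
  by (simp add: braid_group_def group_presented_group)

sublocale B: group B
  by (rule group_braid_group)

abbreviation "braid_class \<equiv> word_class S (braid_relations W S)"

lemma braid_class_closed [simp]: "u \<in> gwords S \<Longrightarrow> braid_class u \<in> carrier B"
  by (simp add: braid_group_def presented_carrier)

lemma braid_class_mult:
  "u \<in> gwords S \<Longrightarrow> v \<in> gwords S \<Longrightarrow> braid_class u \<otimes>\<^bsub>B\<^esub> braid_class v = braid_class (u @ v)"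
  by (simp add: braid_group_def presented_mult)

lemma braid_relation_eval:
  assumes "(l, r) \<in> braid_relations W S"
  shows "word_eval W (\<lambda>s. s) l = word_eval W (\<lambda>s. s) r"
  using assms braid_relation_holds
  by (auto simp: braid_relations_def word_eval_pos_word)

lemma braid_proj_class:
  "u \<in> gwords S \<Longrightarrow> braid_proj W (braid_class u) = word_eval W (\<lambda>s. s) u"
  unfolding braid_proj_def
  by (rule presented_lift_class) (use braid_relation_eval in auto)

lemma braid_proj_hom: "braid_proj W \<in> hom B W"
  unfolding braid_proj_def braid_group_def
  by (rule presented_lift_hom) (use braid_relation_eval in auto)

lemma braid_class_pos_word:
  "xs \<in> lists S \<Longrightarrow> word_prod B (map (\<lambda>s. braid_class [(s, True)]) xs) = braid_class (pos_word xs)"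
  by (induction xs rule: list.induct) (auto simp: braid_class_mult braid_group_def presented_one
      presented_mult)

lemma braid_class_red_eq:
  assumes "red xs" "red ys" "word_prod W xs = word_prod W ys"
  shows "braid_class (pos_word xs) = braid_class (pos_word ys)"
proof -
  have "braid_class (pos_word (alternating (ord (s \<otimes> t)) s t))
      = braid_class (pos_word (alternating (ord (s \<otimes> t)) t s))"
    if "s \<in> S" "t \<in> S" "s \<noteq> t" "ord (s \<otimes> t) > 0" for s t
  proof -
    have "(pos_word (alternating (ord (s \<otimes> t)) s t), pos_word (alternating (ord (s \<otimes> t)) t s))
        \<in> braid_relations W S"
      using that by (auto simp: braid_relations_def)
    from word_cong.rel[OF _ _ this, of "[]" S "[]"] that(1,2)
    have "(pos_word (alternating (ord (s \<otimes> t)) s t), pos_word (alternating (ord (s \<otimes> t)) t s))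
        \<in> word_cong S (braid_relations W S)"
      by (simp add: alternating_lists)
    then show ?thesis by (rule word_class_eqI)
  qed
  then have rel: "word_prod B (map (\<lambda>s. braid_class [(s, True)]) (alternating (ord (s \<otimes> t)) s t))
      = word_prod B (map (\<lambda>s. braid_class [(s, True)]) (alternating (ord (s \<otimes> t)) t s))"
    if "s \<in> S" "t \<in> S" "s \<noteq> t" "ord (s \<otimes> t) > 0" for s t
    using that by (simp only: braid_class_pos_word alternating_lists)
  have "word_prod B (map (\<lambda>s. braid_class [(s, True)]) xs)
      = word_prod B (map (\<lambda>s. braid_class [(s, True)]) ys)"
    by (rule matsumoto[OF rel group_braid_group _ assms]) simp_all
  then show ?thesis using assms red_lists by (simp add: braid_class_pos_word)
qed

lemma braid_lift_red:
  assumes "red xs"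
  shows "braid_lift W S (word_prod W xs) = braid_class (pos_word xs)"
proof -
  have "reduced_decomp W S (word_prod W xs) (SOME ss. reduced_decomp W S (word_prod W xs) ss)"
    by (rule someI[of _ xs]) (use assms in \<open>simp add: reduced_decomp_iff_red\<close>)
  then have "red (SOME ss. reduced_decomp W S (word_prod W xs) ss)"
    "word_prod W (SOME ss. reduced_decomp W S (word_prod W xs) ss) = word_prod W xs"
    by (auto simp only: reduced_decomp_iff_red)
  then show ?thesis
    unfolding braid_lift_def by (rule braid_class_red_eq[OF _ assms])
qed

lemma braid_lift_closed [simp]: "w \<in> carrier W \<Longrightarrow> braid_lift W S w \<in> carrier B"
  by (metis red_obtain braid_lift_red braid_class_closed pos_word_gwords red_lists)

lemma braid_proj_lift [simp]:
  assumes "w \<in> carrier W"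
  shows "braid_proj W (braid_lift W S w) = w"
proof -
  obtain xs where xs: "red xs" "word_prod W xs = w" using red_obtain[OF assms] .
  then show ?thesis
    using braid_lift_red[OF xs(1)] red_lists[OF xs(1)] by (simp add: braid_proj_class word_eval_pos_word)
qed

text \<open>Additivity of lengths means that reduced words of x and y concatenate to a reduced word,
  and any reduced word computes the lift.\<close>

lemma braid_lift_mult:
  assumes "x \<in> carrier W" "y \<in> carrier W" "len (x \<otimes> y) = len x + len y"
  shows "braid_lift W S (x \<otimes> y) = braid_lift W S x \<otimes>\<^bsub>B\<^esub> braid_lift W S y"
proof -
  obtain xs where xs: "red xs" "word_prod W xs = x" using red_obtain[OF assms(1)] .
  obtain ys where ys: "red ys" "word_prod W ys = y" using red_obtain[OF assms(2)] .
  have l: "xs \<in> lists S" "ys \<in> lists S" using red_lists xs ys by auto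
  have p: "word_prod W (xs @ ys) = x \<otimes> y" using xs ys l by (simp add: word_prod_append)
  then have "red (xs @ ys)" using xs ys l assms by (simp add: red_def)
  from braid_lift_red[OF this] show ?thesis
    using braid_lift_red[OF xs(1)] braid_lift_red[OF ys(1)] xs ys l p by (simp add: braid_class_mult)
qed

lemma braid_longest_closed [simp]: "spherical W S I \<Longrightarrow> braid_longest W S I \<in> carrier B"
  by (simp add: braid_longest_def)

lemma braid_proj_longest [simp]:
  "spherical W S I \<Longrightarrow> braid_proj W (braid_longest W S I) = longest I"
  by (simp add: braid_longest_def)

text \<open>The longest elements commute and their lengths add in both orders, so the lift of their
  product factors in both orders.\<close>

lemma braid_longest_direct_prod:
  assumes "spherical W S I" "spherical W S J" "spherical W S (I \<union> J)"
    and dp: "parabolic_direct_prod W (I \<union> J) I J"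
  shows "braid_longest W S (I \<union> J) = braid_longest W S I \<otimes>\<^bsub>B\<^esub> braid_longest W S J"
    and "braid_longest W S I \<otimes>\<^bsub>B\<^esub> braid_longest W S J = braid_longest W S J \<otimes>\<^bsub>B\<^esub> braid_longest W S I"
proof -
  note l = longest_elem_direct_prod[OF assms]
  show 1: "braid_longest W S (I \<union> J) = braid_longest W S I \<otimes>\<^bsub>B\<^esub> braid_longest W S J"
    unfolding braid_longest_def l(1)
    by (rule braid_lift_mult) (use assms l in auto)
  have "braid_longest W S (I \<union> J) = braid_longest W S J \<otimes>\<^bsub>B\<^esub> braid_longest W S I"
    unfolding braid_longest_def l(1) l(3)
    by (rule braid_lift_mult) (use assms l in auto)
  then show "braid_longest W S I \<otimes>\<^bsub>B\<^esub> braid_longest W S J = braid_longest W S J \<otimes>\<^bsub>B\<^esub> braid_longest W S I"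
    using 1 by simp
qed

text \<open>With u = w_I w_J both sides equal \<beta>_I \<beta>_u \<beta>_I': the two bracketings
  use \<beta>_J = \<beta>_u \<beta>_I' and \<beta>_J = \<beta>_I \<beta>_u.\<close>

lemma braid_longest_conj:
  assumes J: "spherical W S J" and I: "I \<subseteq> J" "spherical W S I" and w: "w = longest J"
  defines "I' \<equiv> (\<lambda>s. w \<otimes> s \<otimes> w) ` I"
  shows "braid_longest W S I \<otimes>\<^bsub>B\<^esub> braid_longest W S J = braid_longest W S J \<otimes>\<^bsub>B\<^esub> braid_longest W S I'"
proof -
  let ?v = "longest I"
  have I': "spherical W S I'" "longest I' = w \<otimes> ?v \<otimes> w"
    unfolding I'_def by (rule conj_longest_spherical[OF J w I] conj_longest_longest[OF J w I])+
  have c: "?v \<in> carrier W" "w \<in> carrier W" "w \<otimes> w = \<one>" "?v \<otimes> ?v = \<one>"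
    using J I w by auto
  have v: "?v \<in> generate W J" using longest_elem(1)[OF I(2)] I(1) mono_generate by blast
  have split: "len w = len ?v + len (?v \<otimes> w)"
    using len_longest_split(1)[OF J v] w I by simp
  have 1: "?v \<otimes> (?v \<otimes> w) = w" using c by (simp flip: m_assoc)
  have "?v \<otimes> w \<otimes> (w \<otimes> ?v \<otimes> w) = ?v \<otimes> (w \<otimes> w) \<otimes> ?v \<otimes> w"
    using c(1,2) by (simp only: m_assoc m_closed)
  then have 2: "?v \<otimes> w \<otimes> (w \<otimes> ?v \<otimes> w) = w" using c by simp
  have "len (w \<otimes> ?v \<otimes> w) = len ?v" using conj_longest_len[OF J w v] .
  then have "braid_lift W S (?v \<otimes> w \<otimes> (w \<otimes> ?v \<otimes> w)) = braid_lift W S (?v \<otimes> w) \<otimes>\<^bsub>B\<^esub> braid_lift W S (w \<otimes> ?v \<otimes> w)"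
    using c split by (intro braid_lift_mult) (auto simp: 2)
  then have right: "braid_lift W S w = braid_lift W S (?v \<otimes> w) \<otimes>\<^bsub>B\<^esub> braid_lift W S (w \<otimes> ?v \<otimes> w)"
    by (simp only: 2)
  have "braid_lift W S (?v \<otimes> (?v \<otimes> w)) = braid_lift W S ?v \<otimes>\<^bsub>B\<^esub> braid_lift W S (?v \<otimes> w)"
    using c split by (intro braid_lift_mult) (auto simp: 1)
  then have left: "braid_lift W S w = braid_lift W S ?v \<otimes>\<^bsub>B\<^esub> braid_lift W S (?v \<otimes> w)"
    by (simp only: 1)
  have "braid_lift W S ?v \<otimes>\<^bsub>B\<^esub> braid_lift W S w
      = braid_lift W S ?v \<otimes>\<^bsub>B\<^esub> braid_lift W S (?v \<otimes> w) \<otimes>\<^bsub>B\<^esub> braid_lift W S (w \<otimes> ?v \<otimes> w)"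
    using c by (subst right) (simp add: B.m_assoc)
  then show ?thesis
    by (simp add: braid_longest_def I'(2) flip: left w)
qed

end

section \<open>Group algebras\<close>

abbreviation "keys \<equiv> Poly_Mapping.keys"
abbreviation "single \<equiv> Poly_Mapping.single"
abbreviation "lookup \<equiv> Poly_Mapping.lookup"

text \<open>The pairing of Q[G] with functions on G. As G is a basis, every linear functional has
  this form, so functionals are handled as plain functions on the group.\<close>

definition lin :: "('g \<Rightarrow> rat) \<Rightarrow> ('g \<Rightarrow>\<^sub>0 rat) \<Rightarrow> rat" where
  "lin f a = (\<Sum>g\<in>keys a. lookup a g * f g)"

lemma lin_add: "lin f (a + b) = lin f a + lin f b"
  unfolding lin_def by (rule setsum_keys_plus_distrib) (auto simp: distrib_right)

lemma lin_zero [simp]: "lin f 0 = 0" by (simp add: lin_def)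

lemma lin_single [simp]: "lin f (single g c) = c * f g"
  by (simp add: lin_def)

lemma lin_uminus: "lin f (- a) = - lin f a"
  using lin_add[of f a "- a"] by simp

lemma lin_diff: "lin f (a - b) = lin f a - lin f b"
  using lin_add[of f a "- b"] by (simp add: lin_uminus)

lemma lin_sum: "lin f (sum a A) = (\<Sum>i\<in>A. lin f (a i))"
  by (induction A rule: infinite_finite_induct) (auto simp: lin_add)

lemma lin_fun_add: "lin (\<lambda>g. f g + h g) a = lin f a + lin h a"
  by (simp add: lin_def distrib_left sum.distrib)

lemma lin_fun_diff: "lin (\<lambda>g. f g - h g) a = lin f a - lin h a"
  by (simp add: lin_def right_diff_distrib sum_subtractf)

lemma lin_cong: "(\<And>g. g \<in> keys a \<Longrightarrow> f g = h g) \<Longrightarrow> lin f a = lin h a"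
  by (simp add: lin_def)

lemma augmentation_eq_lin: "augmentation a = lin (\<lambda>_. 1) a"
  by (simp add: augmentation_def lin_def)

lemma poly_mapping_decomp:
  "a = (\<Sum>g\<in>keys a. single g (lookup a g))"
  for a :: "'g \<Rightarrow>\<^sub>0 rat"
proof (rule poly_mapping_eqI)
  fix k
  show "lookup a k = lookup
      (\<Sum>g\<in>keys a. single g (lookup a g)) k"
    by (simp add: lookup_sum lookup_single when_def in_keys_iff)
qed

text \<open>Multilinear identities in the group algebra are reduced to basis elements by one such
  induction per argument.\<close>

lemma poly_mapping_carrier_induct [consumes 1, case_names zero add]:
  fixes a :: "'g \<Rightarrow>\<^sub>0 rat"
  assumes "keys a \<subseteq> A"
    and "P 0"
    and "\<And>g c b. g \<in> A \<Longrightarrow> keys b \<subseteq> A \<Longrightarrow> P b \<Longrightarrow> P (single g c + b)"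
  shows "P a"
proof -
  have "P (\<Sum>g\<in>K. single g (lookup a g))
      \<and> keys (\<Sum>g\<in>K. single g (lookup a g)) \<subseteq> A"
    if "finite K" "K \<subseteq> A" for K
    using that
  proof (induction K)
    case (insert g K)
    let ?b = "\<Sum>g\<in>K. single g (lookup a g)"
    have "keys (single g (lookup a g) + ?b)
        \<subseteq> keys (single g (lookup a g)) \<union> keys ?b"
      by (rule keys_add)
    moreover have "keys (single g (lookup a g)) \<subseteq> {g}"
      by simp
    ultimately show ?case using insert assms(3)[of g ?b] by auto
  qed (use assms(2) in simp)
  from this[of "keys a"] show ?thesis
    using assms(1) poly_mapping_decomp[of a] by simp
qed

lemma group_algebra_map_add:
  "group_algebra_map f (a + b) = group_algebra_map f a + group_algebra_map f b"
  unfolding group_algebra_map_def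
  by (rule setsum_keys_plus_distrib) (auto simp: single_add)

lemma group_algebra_map_zero [simp]: "group_algebra_map f 0 = 0"
  by (simp add: group_algebra_map_def)

lemma group_algebra_map_single [simp]:
  "group_algebra_map f (single g c) = single (f g) c"
  by (simp add: group_algebra_map_def)

lemma group_algebra_map_uminus: "group_algebra_map f (- a) = - group_algebra_map f a"
  using group_algebra_map_add[of f a "- a"] by (simp add: eq_neg_iff_add_eq_0 add.commute)

lemma group_algebra_map_diff:
  "group_algebra_map f (a - b) = group_algebra_map f a - group_algebra_map f b"
  using group_algebra_map_add[of f a "- b"] by (simp add: group_algebra_map_uminus)

lemma lin_group_algebra_map: "lin h (group_algebra_map f a) = lin (\<lambda>g. h (f g)) a"
  unfolding group_algebra_map_def lin_sum lin_single by (simp add: lin_def)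

lemma ga_simps [simp]:
  "carrier (group_algebra G) = {a. keys a \<subseteq> carrier G}"
  "\<one>\<^bsub>group_algebra G\<^esub> = single \<one>\<^bsub>G\<^esub> 1"
  "\<zero>\<^bsub>group_algebra G\<^esub> = 0"
  "a \<oplus>\<^bsub>group_algebra G\<^esub> b = a + b"
  by (simp_all add: group_algebra_def)

lemma ga_mult:
  "a \<otimes>\<^bsub>group_algebra G\<^esub> b = (\<Sum>g\<in>keys a. \<Sum>h\<in>keys b.
    single (g \<otimes>\<^bsub>G\<^esub> h) (lookup a g * lookup b h))"
  by (simp add: group_algebra_def)

lemma ga_distrib_right:
  "(a + b) \<otimes>\<^bsub>group_algebra G\<^esub> c = a \<otimes>\<^bsub>group_algebra G\<^esub> c + b \<otimes>\<^bsub>group_algebra G\<^esub> c"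
  unfolding ga_mult
  by (rule setsum_keys_plus_distrib) (auto simp: single_add distrib_right sum.distrib)

lemma ga_distrib_left:
  "a \<otimes>\<^bsub>group_algebra G\<^esub> (b + c) = a \<otimes>\<^bsub>group_algebra G\<^esub> b + a \<otimes>\<^bsub>group_algebra G\<^esub> c"
  unfolding ga_mult sum.distrib[symmetric]
  by (intro sum.cong setsum_keys_plus_distrib) (auto simp: single_add distrib_left)

lemma ga_mult_zero [simp]:
  "0 \<otimes>\<^bsub>group_algebra G\<^esub> a = 0" "a \<otimes>\<^bsub>group_algebra G\<^esub> 0 = 0"
  by (simp_all add: ga_mult)

lemma ga_mult_uminus [simp]:
  "(- a) \<otimes>\<^bsub>group_algebra G\<^esub> b = - (a \<otimes>\<^bsub>group_algebra G\<^esub> b)"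
  "a \<otimes>\<^bsub>group_algebra G\<^esub> (- b) = - (a \<otimes>\<^bsub>group_algebra G\<^esub> b)"
  using ga_distrib_right[where a = a and b = "- a" and c = b]
    ga_distrib_left[where a = a and b = b and c = "- b"]
  by (auto simp: eq_neg_iff_add_eq_0 add.commute)

lemma ga_diff_right:
  "(a - b) \<otimes>\<^bsub>group_algebra G\<^esub> c = a \<otimes>\<^bsub>group_algebra G\<^esub> c - b \<otimes>\<^bsub>group_algebra G\<^esub> c"
  using ga_distrib_right[where a = a and b = "- b" and c = c] by simp

lemma ga_diff_left:
  "a \<otimes>\<^bsub>group_algebra G\<^esub> (b - c) = a \<otimes>\<^bsub>group_algebra G\<^esub> b - a \<otimes>\<^bsub>group_algebra G\<^esub> c"
  using ga_distrib_left[where a = a and b = b and c = "- c"] by simp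

lemmas ga_distribs = ga_distrib_right ga_distrib_left
  ga_diff_right ga_diff_left

lemma ga_single_mult [simp]:
  "single g c \<otimes>\<^bsub>group_algebra G\<^esub> single h d
    = single (g \<otimes>\<^bsub>G\<^esub> h) (c * d)"
  by (simp add: ga_mult)

lemma keys_uminus' [simp]: "keys (- a) = keys a"
  for a :: "'g \<Rightarrow>\<^sub>0 rat"
  by (simp add: keys.rep_eq uminus_poly_mapping.rep_eq)

lemma keys_plus_subset: "keys a \<subseteq> A \<Longrightarrow> keys b \<subseteq> A
    \<Longrightarrow> keys (a + b) \<subseteq> A" for a :: "'g \<Rightarrow>\<^sub>0 rat"
  using keys_add[of a b] by blast

lemma keys_diff_subset: "keys a \<subseteq> A \<Longrightarrow> keys b \<subseteq> A
    \<Longrightarrow> keys (a - b) \<subseteq> A" for a :: "'g \<Rightarrow>\<^sub>0 rat"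
  using keys_plus_subset[of a A "- b"] by simp

context group
begin

abbreviation ga_mult (infixl \<open>\<star>\<close> 70) where
  "a \<star> b \<equiv> a \<otimes>\<^bsub>group_algebra G\<^esub> b"

abbreviation "GA \<equiv> group_algebra G"

lemma ga_mult_closed:
  "keys a \<subseteq> carrier G \<Longrightarrow> keys b \<subseteq> carrier G
    \<Longrightarrow> keys (a \<star> b) \<subseteq> carrier G"
  for a b :: "'a \<Rightarrow>\<^sub>0 rat"
proof (induction a rule: poly_mapping_carrier_induct)
  case (add g c a)
  have "keys (single g c \<star> b) \<subseteq> carrier G"
    using add.prems
  proof (induction b rule: poly_mapping_carrier_induct)
    case (add h d b)
    then show ?case using \<open>g \<in> carrier G\<close>
      by (simp add: ga_distribs keys_plus_subset)
  qed simp
  with add show ?case by (simp add: ga_distribs keys_plus_subset)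
qed simp

lemma ga_assoc:
  assumes "keys a \<subseteq> carrier G" "keys b \<subseteq> carrier G"
    "keys c \<subseteq> carrier G"
  shows "a \<star> b \<star> c = a \<star> (b \<star> c)"
  using assms(1)
proof (induction a rule: poly_mapping_carrier_induct)
  case (add g x a)
  have "single g x \<star> b \<star> c = single g x \<star> (b \<star> c)"
    using assms(2)
  proof (induction b rule: poly_mapping_carrier_induct)
    case (add h y b)
    have "single g x \<star> single h y \<star> c
        = single g x \<star> (single h y \<star> c)"
      using assms(3)
    proof (induction c rule: poly_mapping_carrier_induct)
      case (add k z c)
      then show ?case using \<open>g \<in> carrier G\<close> \<open>h \<in> carrier G\<close>
        by (simp add: ga_distribs m_assoc mult.assoc)
    qed simp
    with add show ?case by (simp add: ga_distribs)
  qed simp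
  with add show ?case by (simp add: ga_distribs)
qed simp

lemma ga_one_mult:
  assumes "keys a \<subseteq> carrier G"
  shows "single \<one> 1 \<star> a = a" "a \<star> single \<one> 1 = a"
  using assms
  by (induction a rule: poly_mapping_carrier_induct) (simp_all add: ga_distribs)

lemma ring_group_algebra: "ring GA"
proof (rule ringI)
  show "abelian_group GA"
  proof (rule abelian_groupI)
    fix a assume "a \<in> carrier GA"
    then show "\<exists>b\<in>carrier GA. b \<oplus>\<^bsub>GA\<^esub> a = \<zero>\<^bsub>GA\<^esub>"
      by (intro bexI[of _ "- a"]) auto
  qed (auto simp: keys_plus_subset add.assoc add.commute)
  show "monoid GA"
    by (rule monoidI)
      (auto simp: ga_mult_closed ga_assoc ga_one_mult split: if_splits)
qed (auto simp: ga_distribs)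

lemma ga_a_inv: "keys a \<subseteq> carrier G \<Longrightarrow> \<ominus>\<^bsub>GA\<^esub> a = - a"
  using ring.ring_simprules(3)[OF ring_group_algebra]
  by (metis (no_types, lifting) abelian_group.minus_equality ring_def ring_group_algebra
      ga_simps(1,3,4) keys_uminus' mem_Collect_eq ab_left_minus)

lemma ga_minus: "keys a \<subseteq> carrier G \<Longrightarrow> keys b \<subseteq> carrier G
    \<Longrightarrow> a \<ominus>\<^bsub>GA\<^esub> b = a - b"
  by (simp add: a_minus_def ga_a_inv)

lemma scalar_central:
  assumes "keys a \<subseteq> carrier G"
  shows "single \<one> c \<star> a = a \<star> single \<one> c"
  using assms
  by (induction a rule: poly_mapping_carrier_induct)
    (simp_all add: ga_distribs mult.commute)

lemma lin_scalar_mult: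
  assumes "keys a \<subseteq> carrier G"
  shows "lin f (single \<one> c \<star> a) = c * lin f a"
  using assms
  by (induction a rule: poly_mapping_carrier_induct)
    (simp_all add: ga_distribs lin_add distrib_left)

text \<open>A double sum over the two supports, read in either order; it trades products in the
  algebra for translates of functions.\<close>

lemma lin_mult:
  shows "lin f (a \<star> b) = lin (\<lambda>g. lin (\<lambda>h. f (g \<otimes> h)) b) a"
    and "lin f (a \<star> b) = lin (\<lambda>h. lin (\<lambda>g. f (g \<otimes> h)) a) b"
proof -
  show 1: "lin f (a \<star> b) = lin (\<lambda>g. lin (\<lambda>h. f (g \<otimes> h)) b) a"
    by (simp add: ga_mult lin_sum) (simp add: lin_def sum_distrib_left mult.assoc)
  show "lin f (a \<star> b) = lin (\<lambda>h. lin (\<lambda>g. f (g \<otimes> h)) a) b"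
    unfolding 1 unfolding lin_def
    by (simp add: sum_distrib_left) (subst sum.swap, simp add: mult.left_commute)
qed

end

lemma group_algebra_map_mult:
  assumes "group G" "group H" "f \<in> hom G H"
    "keys a \<subseteq> carrier G" "keys b \<subseteq> carrier G"
  shows "group_algebra_map f (a \<otimes>\<^bsub>group_algebra G\<^esub> b)
    = group_algebra_map f a \<otimes>\<^bsub>group_algebra H\<^esub> group_algebra_map f b"
  using assms(4)
proof (induction a rule: poly_mapping_carrier_induct)
  case (add g c a)
  have "group_algebra_map f (single g c \<otimes>\<^bsub>group_algebra G\<^esub> b)
    = single (f g) c \<otimes>\<^bsub>group_algebra H\<^esub> group_algebra_map f b"
    using assms(5)
  proof (induction b rule: poly_mapping_carrier_induct)
    case (add h d b)
    then show ?case using \<open>g \<in> carrier G\<close> hom_mult[OF assms(3)]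
      by (simp add: ga_distribs group_algebra_map_add)
  qed simp
  with add show ?case by (simp add: ga_distribs group_algebra_map_add)
qed simp

lemma keys_group_algebra_map:
  "f ` keys a \<subseteq> A \<Longrightarrow> keys (group_algebra_map f a) \<subseteq> A"
proof -
  assume *: "f ` keys a \<subseteq> A"
  have "keys a \<subseteq> keys a" by simp
  then have "keys a \<subseteq> f -` A" using * by auto
  then show ?thesis
    by (induction a rule: poly_mapping_carrier_induct)
      (simp_all add: group_algebra_map_add keys_plus_subset)
qed

lemma group_algebra_map_ring_hom:
  assumes "group G" "group H" "f \<in> hom G H"
  shows "ring_hom_ring (group_algebra G) (group_algebra H) (group_algebra_map f)"
proof (rule ring_hom_ringI2)
  show "group_algebra_map f \<in> ring_hom (group_algebra G) (group_algebra H)"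
  proof (rule ring_hom_memI)
    show "group_algebra_map f \<one>\<^bsub>group_algebra G\<^esub> = \<one>\<^bsub>group_algebra H\<^esub>"
      using hom_one[OF assms(3,1,2)] by simp
  qed (use assms hom_in_carrier[OF assms(3)] in
      \<open>auto simp: group_algebra_map_mult group_algebra_map_add intro!: keys_group_algebra_map\<close>)
qed (use assms in \<open>simp_all add: group.ring_group_algebra\<close>)

section \<open>Adic completions\<close>

context ideal
begin

definition ipow :: "nat \<Rightarrow> 'a set" where
  "ipow n = I [^]\<^bsub>ideals_set R\<^esub> n"

abbreviation "Q n \<equiv> adic_quot R I n"

abbreviation "H \<equiv> adic_completion R I"

lemma ipow_0: "ipow 0 = carrier R"
  by (simp add: nat_pow_def ideals_set_def ipow_def)

text \<open>The new factor stands on the right; the arguments of \<open>ipow_mult\<close> and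
  \<open>kills_Suc\<close> are arranged accordingly.\<close>

lemma ipow_Suc: "ipow (Suc n) = ipow n \<cdot>\<^bsub>R\<^esub> I"
  by (simp add: nat_pow_def ideals_set_def ipow_def)

lemma ideal_ipow: "ideal (ipow n) R"
proof (induction n)
  case 0
  then show ?case by (simp only: ipow_0 oneideal)
next
  case (Suc n)
  then show ?case by (simp only: ipow_Suc ideal_prod_is_ideal is_ideal)
qed

lemma ipow_1: "ipow 1 = I"
  unfolding One_nat_def ipow_Suc ipow_0
proof (rule equalityI)
  show "carrier R \<cdot>\<^bsub>R\<^esub> I \<subseteq> I"
    using ideal_prod_inter[OF oneideal is_ideal] by blast
  show "I \<subseteq> carrier R \<cdot>\<^bsub>R\<^esub> I"
    using ideal_prod.prod[OF one_closed, of _ I R] a_Hcarr l_one by (metis subsetI)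
qed

lemma ipow_Suc_subset: "ipow (Suc n) \<subseteq> ipow n"
  using ideal_prod_inter[OF ideal_ipow is_ideal] by (auto simp: ipow_Suc)

lemma ipow_antimono: "m \<le> n \<Longrightarrow> ipow n \<subseteq> ipow m"
  by (rule lift_Suc_antimono_le[of ipow]) (rule ipow_Suc_subset)

lemma ipow_carrier: "ipow n \<subseteq> carrier R"
  using ipow_antimono[of 0 n] by (simp only: ipow_0 le0)

lemma ipow_mult:
  assumes "a \<in> ipow m" "b \<in> ipow n"
  shows "a \<otimes> b \<in> ipow (m + n)"
  using assms(2)
proof (induction n arbitrary: b)
  case 0
  then show ?case
    using ideal.I_r_closed[OF ideal_ipow assms(1)] by (simp only: ipow_0 add_0_right)
next
  case (Suc n)
  have a: "a \<in> carrier R" using assms(1) ipow_carrier by blast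
  interpret K: ideal "ipow (m + Suc n)" R by (rule ideal_ipow)
  show ?case using Suc.prems unfolding ipow_Suc
  proof (induction b rule: ideal_prod.induct)
    case (prod i j)
    have "i \<in> carrier R" "j \<in> carrier R" using prod ipow_carrier a_Hcarr by blast+
    then have "a \<otimes> (i \<otimes> j) = a \<otimes> i \<otimes> j" using a by (simp add: m_assoc)
    then show ?case using ideal_prod.prod[OF Suc.IH[OF prod(1)] prod(2), of R]
      by (simp only: ipow_Suc add_Suc_right)
  next
    case (sum s1 s2)
    have "s1 \<in> carrier R" "s2 \<in> carrier R"
      using sum ideal_prod_in_carrier[OF ideal_ipow is_ideal] by blast+
    then have "a \<otimes> (s1 \<oplus> s2) = a \<otimes> s1 \<oplus> a \<otimes> s2" using a by (simp add: r_distr)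
    then show ?case using sum.IH K.a_closed by simp
  qed
qed

lemma adic_quot_eq: "Q n = R Quot ipow n"
  by (simp only: adic_quot_def ipow_def)

lemma ring_Q: "ring (Q n)"
  unfolding adic_quot_eq by (rule ideal.quotient_is_ring[OF ideal_ipow])

lemma coset_hom: "(+>) (ipow n) \<in> ring_hom R (Q n)"
  unfolding adic_quot_eq by (rule ideal.rcos_ring_hom[OF ideal_ipow])

lemma coset_hom_ring: "ring_hom_ring R (Q n) ((+>) (ipow n))"
  unfolding adic_quot_eq by (rule ideal.rcos_ring_hom_ring[OF ideal_ipow])

lemma carrier_Q: "carrier (Q n) = (\<lambda>a. ipow n +> a) ` carrier R"
  by (auto simp: adic_quot_eq FactRing_simps)

lemma coset_self: "a \<in> carrier R \<Longrightarrow> a \<in> ipow n +> a"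
  using additive_subgroup.zero_closed[OF ideal.axioms(1)[OF ideal_ipow]]
  by (force simp: a_r_coset_def r_coset_def)

lemma coset_eqI: "b \<in> ipow n +> a \<Longrightarrow> a \<in> carrier R \<Longrightarrow> ipow n +> b = ipow n +> a"
  using a_repr_independence[OF _ _ additive_subgroup.a_subgroup[OF ideal.axioms(1)[OF ideal_ipow]]]
  by blast

lemma coset_mono: "ipow (Suc n) +> a \<subseteq> ipow n +> a"
  using ipow_Suc_subset by (auto simp: a_r_coset_def r_coset_def)

lemma coset_carrier: "a \<in> carrier R \<Longrightarrow> ipow n +> a \<subseteq> carrier R"
  using ipow_carrier by (fastforce simp: a_r_coset_def r_coset_def)

lemma completion_carrier_iff:
  "x \<in> carrier H \<longleftrightarrow> (\<forall>n. x n \<in> carrier (Q n) \<and> x (Suc n) \<subseteq> x n)"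
  by (simp add: adic_completion_def)

lemma completion_antimono: "x \<in> carrier H \<Longrightarrow> m \<le> n \<Longrightarrow> x n \<subseteq> x m"
  by (rule lift_Suc_antimono_le[of x]) (simp_all add: completion_carrier_iff)

lemma completion_carrier: "x \<in> carrier H \<Longrightarrow> x n \<subseteq> carrier R"
  using coset_carrier by (fastforce simp: completion_carrier_iff carrier_Q)

text \<open>A representative at level n serves all lower levels, so finitely many levels can be
  treated with one ring element.\<close>

lemma completion_coset:
  assumes "x \<in> carrier H" "a \<in> x n" "m \<le> n"
  shows "x m = ipow m +> a"
proof -
  have "a \<in> x m" using completion_antimono assms by blast
  moreover obtain b where "b \<in> carrier R" "x m = ipow m +> b"
    using assms unfolding completion_carrier_iff carrier_Q by blast
  ultimately show ?thesis using coset_eqI by metis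
qed

lemma completion_ex_rep:
  assumes "x \<in> carrier H"
  obtains a where "a \<in> x n" "a \<in> carrier R"
proof -
  obtain b where "b \<in> carrier R" "x n = ipow n +> b"
    using assms unfolding completion_carrier_iff carrier_Q by blast
  then show thesis using that coset_self by blast
qed

lemma completion_simps:
  "(x \<otimes>\<^bsub>H\<^esub> y) n = x n \<otimes>\<^bsub>Q n\<^esub> y n" "(x \<oplus>\<^bsub>H\<^esub> y) n = x n \<oplus>\<^bsub>Q n\<^esub> y n"
  "\<one>\<^bsub>H\<^esub> n = \<one>\<^bsub>Q n\<^esub>" "\<zero>\<^bsub>H\<^esub> n = \<zero>\<^bsub>Q n\<^esub>"
  by (simp_all add: adic_completion_def)

lemma Q_coset_simps:
  assumes "a \<in> carrier R" "b \<in> carrier R"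
  shows "(ipow n +> a) \<otimes>\<^bsub>Q n\<^esub> (ipow n +> b) = ipow n +> a \<otimes> b"
    and "(ipow n +> a) \<oplus>\<^bsub>Q n\<^esub> (ipow n +> b) = ipow n +> (a \<oplus> b)"
  using ring_hom_mult[OF coset_hom assms] ring_hom_add[OF coset_hom assms] by simp_all

text \<open>The source of elements of the completion: a sequence that is Cauchy in the explicit
  sense that its n-th increment lies in I^n.\<close>

lemma completion_memI:
  assumes "\<And>n. a n \<in> carrier R" "\<And>n. a (Suc n) \<in> ipow n +> a n"
  shows "(\<lambda>n. ipow n +> a n) \<in> carrier H"
  unfolding completion_carrier_iff
proof (intro allI conjI)
  fix n
  show "ipow n +> a n \<in> carrier (Q n)" using assms by (auto simp: carrier_Q)
  show "ipow (Suc n) +> a (Suc n) \<subseteq> ipow n +> a n"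
    using coset_mono coset_eqI[OF assms(2) assms(1)] by blast
qed

lemma Q_one: "\<one>\<^bsub>Q n\<^esub> = ipow n +> \<one>"
  using ring_hom_one[OF coset_hom] by simp

lemma Q_zero: "\<zero>\<^bsub>Q n\<^esub> = ipow n +> \<zero>"
proof -
  interpret h: ring_hom_ring R "Q n" "(+>) (ipow n)" by (rule coset_hom_ring)
  show ?thesis using h.hom_zero by simp
qed

text \<open>The transition maps are given by inclusion of cosets, so monotonicity of the coset
  operations is compatibility with these maps.\<close>

lemma Q_mult_mono:
  "A' \<subseteq> A \<Longrightarrow> B' \<subseteq> B \<Longrightarrow> A' \<otimes>\<^bsub>Q (Suc n)\<^esub> B' \<subseteq> A \<otimes>\<^bsub>Q n\<^esub> B"
  "A' \<subseteq> A \<Longrightarrow> B' \<subseteq> B \<Longrightarrow> A' \<oplus>\<^bsub>Q (Suc n)\<^esub> B' \<subseteq> A \<oplus>\<^bsub>Q n\<^esub> B"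
  using coset_mono
  by (fastforce simp: adic_quot_eq FactRing_def rcoset_mult_def,
      auto simp: adic_quot_eq FactRing_def set_add_def set_mult_def)

lemma completion_closed:
  assumes "x \<in> carrier H" "y \<in> carrier H"
  shows "x \<otimes>\<^bsub>H\<^esub> y \<in> carrier H" "x \<oplus>\<^bsub>H\<^esub> y \<in> carrier H"
proof -
  show "x \<otimes>\<^bsub>H\<^esub> y \<in> carrier H" "x \<oplus>\<^bsub>H\<^esub> y \<in> carrier H"
    using assms ring.ring_simprules(1,5)[OF ring_Q] Q_mult_mono
    by (simp_all add: completion_carrier_iff completion_simps)
qed

lemma to_completion_closed: "a \<in> carrier R \<Longrightarrow> to_completion R I a \<in> carrier H"
  unfolding to_completion_def ipow_def[symmetric]
  by (rule completion_memI) (auto simp: coset_self)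

lemma ring_completion: "ring H"
proof (rule ringI)
  have mem: "x n \<in> carrier (Q n)" if "x \<in> carrier H" for x n
    using that by (simp add: completion_carrier_iff)
  note Q = ring.ring_simprules[OF ring_Q]
  show "abelian_group H"
  proof (rule abelian_groupI)
    show "\<zero>\<^bsub>H\<^esub> \<in> carrier H"
      using to_completion_closed[OF zero_closed]
      by (simp add: to_completion_def adic_completion_def Q_zero flip: ipow_def)
    fix x assume x: "x \<in> carrier H"
    have "\<forall>n. \<exists>a. a \<in> x n \<and> a \<in> carrier R" using completion_ex_rep[OF x] by blast
    then obtain a where a: "\<And>n. a n \<in> x n" "\<And>n. a n \<in> carrier R" by metis
    \<comment> \<open>The completion is defined with addition only; negatives are built level by
      level from chosen representatives.\<close>
    let ?y = "\<lambda>n. ipow n +> \<ominus> a n"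
    have eq: "ipow n +> a n = x n" for n using completion_coset[OF x a(1) order_refl] by simp
    have "?y \<in> carrier H"
    proof (rule completion_memI)
      fix n
      have "a (Suc n) \<in> x n" using completion_antimono[OF x, of n "Suc n"] a by auto
      then have "ipow n +> a (Suc n) = ipow n +> a n" using coset_eqI a eq by blast
      interpret h: ring_hom_ring R "Q n" "(+>) (ipow n)" by (rule coset_hom_ring)
      have "ipow n +> \<ominus> a (Suc n) = ipow n +> \<ominus> a n"
        using h.hom_a_inv a \<open>ipow n +> a (Suc n) = ipow n +> a n\<close> by simp
      then show "\<ominus> a (Suc n) \<in> ipow n +> \<ominus> a n" using coset_self a by blast
    qed (use a in simp)
    moreover have "?y \<oplus>\<^bsub>H\<^esub> x = \<zero>\<^bsub>H\<^esub>"
      using Q_coset_simps(2)[of "\<ominus> a n" "a n" n for n] a eq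
      by (auto simp: completion_simps l_neg Q_zero fun_eq_iff)
    ultimately show "\<exists>y\<in>carrier H. y \<oplus>\<^bsub>H\<^esub> x = \<zero>\<^bsub>H\<^esub>" by blast
  qed (simp_all add: completion_closed completion_simps fun_eq_iff mem Q(7,8,10))
  have "\<one>\<^bsub>H\<^esub> \<in> carrier H"
    using to_completion_closed[OF one_closed]
    by (simp add: to_completion_def adic_completion_def Q_one flip: ipow_def)
  then show "monoid H"
    by (intro monoidI)
      (simp_all add: completion_closed completion_simps fun_eq_iff mem Q(11,12)
        monoid.r_one[OF ring.is_monoid[OF ring_Q]])
qed (auto simp: completion_closed completion_simps fun_eq_iff completion_carrier_iff
    ring.ring_simprules(13,23)[OF ring_Q])

lemma completion_eval_hom: "ring_hom_ring H (Q n) (\<lambda>x. x n)"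
  by (rule ring_hom_ringI2[OF ring_completion ring_Q])
    (auto simp: ring_hom_def completion_simps completion_carrier_iff)

lemma to_completion_hom: "ring_hom_ring R H (to_completion R I)"
  by (rule ring_hom_ringI2[OF ring_axioms ring_completion])
    (auto simp: ring_hom_def to_completion_closed[unfolded to_completion_def, folded ipow_def]
      completion_simps Q_coset_simps Q_one
      to_completion_def fun_eq_iff simp flip: ipow_def)

end

section \<open>Rational points of completed group algebras\<close>

locale group_algebra_ideal = group G + J: ideal J "group_algebra G" for G (structure) and J
begin

lemma ipow_keys: "a \<in> J.ipow n \<Longrightarrow> keys a \<subseteq> carrier G"
  using J.ipow_carrier by auto

lemma ipow_zero [simp]: "0 \<in> J.ipow n"
  using additive_subgroup.zero_closed[OF ideal.axioms(1)[OF J.ideal_ipow]] by simp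

lemma ipow_add: "a \<in> J.ipow n \<Longrightarrow> b \<in> J.ipow n \<Longrightarrow> a + b \<in> J.ipow n"
  using additive_subgroup.a_closed[OF ideal.axioms(1)[OF J.ideal_ipow]] by force

lemma ipow_uminus: "a \<in> J.ipow n \<Longrightarrow> - a \<in> J.ipow n"
  using additive_subgroup.a_inv_closed[OF ideal.axioms(1)[OF J.ideal_ipow]]
  by (metis J.is_abelian_group ga_a_inv ipow_keys)

lemma ipow_diff: "a \<in> J.ipow n \<Longrightarrow> b \<in> J.ipow n \<Longrightarrow> a - b \<in> J.ipow n"
  using ipow_add[of a n "- b"] ipow_uminus[of b n] by simp

lemma ipow_mult_left: "keys a \<subseteq> carrier G \<Longrightarrow> b \<in> J.ipow n \<Longrightarrow> a \<star> b \<in> J.ipow n"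
  using ideal.I_l_closed[OF J.ideal_ipow] by force

lemma ipow_mult_right: "keys a \<subseteq> carrier G \<Longrightarrow> b \<in> J.ipow n \<Longrightarrow> b \<star> a \<in> J.ipow n"
  using ideal.I_r_closed[OF J.ideal_ipow] by force

lemma mem_coset_iff: "b \<in> J.ipow n +>\<^bsub>GA\<^esub> a \<longleftrightarrow> b - a \<in> J.ipow n"
proof
  assume "b - a \<in> J.ipow n"
  then show "b \<in> J.ipow n +>\<^bsub>GA\<^esub> a"
    by (auto simp: a_r_coset_def r_coset_def intro!: bexI[of _ "b - a"])
qed (auto simp: a_r_coset_def r_coset_def)

lemma coset_eq_iff:
  assumes "keys a \<subseteq> carrier G" "keys b \<subseteq> carrier G"
  shows "J.ipow n +>\<^bsub>GA\<^esub> b = J.ipow n +>\<^bsub>GA\<^esub> a \<longleftrightarrow> b - a \<in> J.ipow n"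
  using J.coset_eqI[of b n a] J.coset_self[of b n] assms by (auto simp: mem_coset_iff)

lemma completed_elem_eq: "completed_elem G J c g n = J.ipow n +>\<^bsub>GA\<^esub> single g c"
  by (simp add: completed_elem_def to_completion_def J.ipow_def)

lemma completed_elem_closed [simp]: "g \<in> carrier G \<Longrightarrow> completed_elem G J c g \<in> carrier J.H"
  unfolding completed_elem_def by (rule J.to_completion_closed) simp

end

text \<open>
  The ideals of interest are the kernels of \<open>\<rat>[G] \<rightarrow> \<rat>[G/P]\<close>. The last assumption says that a
  functional that factors through \<open>G/P\<close> vanishes on \<open>J\<close>.
\<close>

locale kernel_ideal = group_algebra_ideal +
  fixes P
  assumes subgroup_P: "subgroup P G"
    and P_ideal: "p \<in> P \<Longrightarrow> single p 1 - single \<one> 1 \<in> J"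
    and factor: "(\<And>h p. h \<in> carrier G \<Longrightarrow> p \<in> P \<Longrightarrow> f (h \<otimes> p) = f h) \<Longrightarrow> j \<in> J \<Longrightarrow> lin f j = 0"
begin

lemma P_carrier: "P \<subseteq> carrier G"
  using subgroup_P by (rule subgroup.subset)

text \<open>The functionals on Q[G]/J^n; their union over n is the topological dual. The index
  behaves like a degree: order 0 forces f to vanish on G, and constants have order 1.\<close>

definition kills :: "nat \<Rightarrow> ('a \<Rightarrow> rat) \<Rightarrow> bool" where
  "kills n f \<longleftrightarrow> (\<forall>a\<in>J.ipow n. lin f a = 0)"

lemma kills_mono: "kills m f \<Longrightarrow> m \<le> n \<Longrightarrow> kills n f"
  using J.ipow_antimono unfolding kills_def by blast

lemma kills_0: "kills 0 f \<Longrightarrow> g \<in> carrier G \<Longrightarrow> f g = 0"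
  unfolding kills_def J.ipow_0 by (drule bspec[of _ _ "single g 1"]) auto

lemma kills_lin_eq: "kills n f \<Longrightarrow> a - b \<in> J.ipow n \<Longrightarrow> lin f a = lin f b"
  unfolding kills_def by (auto simp: lin_diff dest!: bspec)

lemma lin_translate: "lin (\<lambda>g. f (g \<otimes> h)) a = lin f (a \<star> single h 1)"
  by (simp add: lin_mult(1))

text \<open>Let i be in J^n. As i h lies in J^n again, the function sending h to f(i h) is invariant
  under right translation by P, hence vanishes on J by \<open>factor\<close>; the products i j
  generate J^(n+1) additively.\<close>

lemma kills_Suc:
  assumes "\<And>a p. a \<in> J.ipow n \<Longrightarrow> p \<in> P \<Longrightarrow> lin (\<lambda>g. f (g \<otimes> p)) a = lin f a"
  shows "kills (Suc n) f"
  unfolding kills_def J.ipow_Suc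
proof
  fix a assume "a \<in> ideal_prod GA (J.ipow n) J"
  then show "lin f a = 0"
  proof (induction a rule: ideal_prod.induct)
    case (prod i j)
    have i: "keys i \<subseteq> carrier G" using prod ipow_keys by blast
    have "lin (\<lambda>h. lin (\<lambda>g. f (g \<otimes> h)) i) j = 0"
    proof (rule factor[OF _ prod(2)])
      fix h p assume h: "h \<in> carrier G" and p: "p \<in> P"
      let ?a = "i \<star> single h 1"
      have "?a \<in> J.ipow n" using prod h by (intro ipow_mult_right) auto
      then have "lin (\<lambda>g. f (g \<otimes> p)) ?a = lin f ?a" using assms p by blast
      moreover have "lin (\<lambda>g. f (g \<otimes> p)) ?a = lin (\<lambda>g. f (g \<otimes> h \<otimes> p)) i"
        by (simp add: lin_mult(1))
      moreover have "\<dots> = lin (\<lambda>g. f (g \<otimes> (h \<otimes> p))) i"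
        using i h p P_carrier by (intro lin_cong) (auto simp: m_assoc subset_iff)
      ultimately show "lin (\<lambda>g. f (g \<otimes> (h \<otimes> p))) i = lin (\<lambda>g. f (g \<otimes> h)) i"
        by (simp add: lin_translate)
    qed
    then show ?case by (simp add: lin_mult(2))
  qed (simp add: lin_add)
qed

lemma kills_const: "kills 1 (\<lambda>_. c)"
  unfolding One_nat_def by (rule kills_Suc) simp

lemma kills_right: "kills n f \<Longrightarrow> keys b \<subseteq> carrier G
    \<Longrightarrow> kills n (\<lambda>g. lin (\<lambda>h. f (g \<otimes> h)) b)"
  unfolding kills_def using ipow_mult_right[of b _ n] by (simp flip: lin_mult(1))

lemma kills_left: "kills n f \<Longrightarrow> g \<in> carrier G \<Longrightarrow> kills n (\<lambda>h. f (g \<otimes> h))"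
  unfolding kills_def
proof
  fix a assume *: "\<forall>a\<in>J.ipow n. lin f a = 0" "g \<in> carrier G" "a \<in> J.ipow n"
  have "single g 1 \<star> a \<in> J.ipow n"
    using * by (intro ipow_mult_left) auto
  then have "lin f (single g 1 \<star> a) = 0" using *(1) by blast
  then show "lin (\<lambda>h. f (g \<otimes> h)) a = 0" by (simp add: lin_mult(1))
qed

lemma kills_translate: "kills n f \<Longrightarrow> p \<in> carrier G \<Longrightarrow> kills n (\<lambda>g. f (g \<otimes> p))"
  using kills_right[of n f "single p 1"] by simp

text \<open>The converse of \<open>kills_Suc\<close>: right multiplication by p - 1 maps J^n into
  J^(n+1), so difference operators lower the order by one.\<close>

lemma kills_shift:
  assumes "kills (Suc n) f" "p \<in> P"
  shows "kills n (\<lambda>g. f (g \<otimes> p) - f g)"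
  unfolding kills_def
proof
  fix a assume a: "a \<in> J.ipow n"
  let ?p = "single p 1 - single \<one> 1 :: 'a \<Rightarrow>\<^sub>0 rat"
  have "a \<star> ?p \<in> J.ipow (Suc n)"
    unfolding J.ipow_Suc using a P_ideal[OF assms(2)] by (rule ideal_prod.prod)
  then have "lin f (a \<star> ?p) = 0" using assms(1) by (simp add: kills_def)
  then show "lin (\<lambda>g. f (g \<otimes> p) - f g) a = 0"
    using ipow_keys[OF a]
    by (simp add: ga_distribs ga_one_mult lin_diff lin_fun_diff lin_translate)
qed

text \<open>
  Dually, the coproduct sends \<open>J\<^sup>n\<^sup>+\<^sup>k\<close> to \<open>J\<^sup>n \<otimes> \<rat>[G] + \<rat>[G] \<otimes> J\<^sup>k\<close>.
\<close>

lemma kills_mult: "kills n f \<Longrightarrow> kills k h \<Longrightarrow> kills (n + k) (\<lambda>g. f g * h g)"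
proof (induction "n + k" arbitrary: n k f h rule: less_induct)
  case less
  show ?case
  proof (cases "n = 0 \<or> k = 0")
    case True
    \<comment> \<open>A functional of order 0 is zero on the group, hence so is the product
      function.\<close>
    have "lin (\<lambda>g. f g * h g) a = lin (\<lambda>_. 0) a" if "a \<in> J.ipow (n + k)" for a
      using True less.prems kills_0 ipow_keys[OF that] by (intro lin_cong) (auto simp: subset_iff)
    then show ?thesis by (simp add: kills_def) (simp add: lin_def)
  next
    case False
    then obtain n' k' where nk: "n = Suc n'" "k = Suc k'" by (metis not0_implies_Suc)
    have "kills (Suc (n' + k)) (\<lambda>g. f g * h g)"
    proof (rule kills_Suc)
      fix a p assume a: "a \<in> J.ipow (n' + k)" and p: "p \<in> P"
      have pc: "p \<in> carrier G" using p P_carrier by auto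
      have "kills (n' + k) (\<lambda>g. (f (g \<otimes> p) - f g) * h (g \<otimes> p))"
        using less.prems kills_shift[OF _ p] kills_translate[OF _ pc] nk by (intro less.hyps) auto
      then have 1: "lin (\<lambda>g. (f (g \<otimes> p) - f g) * h (g \<otimes> p)) a = 0" using a by (simp add: kills_def)
      have "kills (n + k') (\<lambda>g. f g * (h (g \<otimes> p) - h g))"
        using less.prems kills_shift[OF _ p] nk by (intro less.hyps) auto
      then have 2: "lin (\<lambda>g. f g * (h (g \<otimes> p) - h g)) a = 0" using a nk by (simp add: kills_def)
      \<comment> \<open>The Leibniz rule for translation by p; each summand contains a difference,
        so its total order is one less and the induction hypothesis applies.\<close>
      have "lin (\<lambda>g. f (g \<otimes> p) * h (g \<otimes> p)) a - lin (\<lambda>g. f g * h g) a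
        = lin (\<lambda>g. (f (g \<otimes> p) - f g) * h (g \<otimes> p) + f g * (h (g \<otimes> p) - h g)) a"
        unfolding lin_fun_diff[symmetric] by (simp add: algebra_simps)
      then show "lin (\<lambda>g. f (g \<otimes> p) * h (g \<otimes> p)) a = lin (\<lambda>g. f g * h g) a"
        by (simp add: lin_fun_add 1 2)
    qed
    then show ?thesis using nk by simp
  qed
qed

subsection \<open>Group-like elements modulo a power of the ideal\<close>

text \<open>The identity \<Delta>(a) = a \<otimes> a tested on pairs of functionals. The bound n + k
  \<le> N gives f h order N, so only the class of a modulo J^N matters. The guard 0 < N is there
  because J^0 is the whole algebra, on which the counit does not vanish.\<close>

definition grouplike :: "nat \<Rightarrow> ('a \<Rightarrow>\<^sub>0 rat) \<Rightarrow> bool" where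
  "grouplike N a \<longleftrightarrow> keys a \<subseteq> carrier G \<and> (0 < N \<longrightarrow> lin (\<lambda>_. 1) a = 1) \<and>
    (\<forall>f h n k. kills n f \<longrightarrow> kills k h \<longrightarrow> n + k \<le> N \<longrightarrow>
      lin (\<lambda>g. f g * h g) a = lin f a * lin h a)"

lemma grouplikeD:
  assumes "grouplike N a"
  shows "keys a \<subseteq> carrier G" "0 < N \<Longrightarrow> lin (\<lambda>_. 1) a = 1"
    "kills n f \<Longrightarrow> kills k h \<Longrightarrow> n + k \<le> N \<Longrightarrow> lin (\<lambda>g. f g * h g) a = lin f a * lin h a"
  using assms unfolding grouplike_def by blast+

lemma grouplike_cong:
  assumes "grouplike N a" "b - a \<in> J.ipow N"
  shows "grouplike N b"
  unfolding grouplike_def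
proof (intro conjI allI impI)
  show "keys b \<subseteq> carrier G"
    using keys_plus_subset[OF ipow_keys[OF assms(2)] grouplikeD(1)[OF assms(1)]] by simp
  have eq: "lin f b = lin f a" if "kills n f" "n \<le> N" for n f
    using kills_lin_eq[OF kills_mono[OF that] assms(2)] .
  show "lin (\<lambda>_. 1) b = 1" if "0 < N"
    using eq[OF kills_const] grouplikeD(2)[OF assms(1)] that by simp
  show "lin (\<lambda>g. f g * h g) b = lin f b * lin h b"
    if "kills n f" "kills k h" "n + k \<le> N" for f h n k
    using eq[OF kills_mult[OF that(1,2)] that(3)] eq[OF that(1)] eq[OF that(2)]
      grouplikeD(3)[OF assms(1) that] that(3) by simp
qed

lemma grouplike_single: "g \<in> carrier G \<Longrightarrow> grouplike N (single g 1)"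
  by (simp add: grouplike_def)

lemma grouplike_translate:
  assumes b: "grouplike N b" and f: "kills n f" "kills k h" "n + k \<le> N" and g: "g \<in> carrier G"
  shows "lin (\<lambda>x. f (g \<otimes> x) * h (g \<otimes> x)) b = lin (\<lambda>x. f (g \<otimes> x)) b * lin (\<lambda>x. h (g \<otimes> x)) b"
  using grouplikeD(3)[OF b kills_left[OF f(1) g] kills_left[OF f(2) g] f(3)] .

text \<open>The condition for b is applied to the left translates of f and h by g, the condition for
  a to the functions of g so obtained; neither operation raises the orders.\<close>

lemma grouplike_mult:
  assumes a: "grouplike N a" and b: "grouplike N b"
  shows "grouplike N (a \<star> b)"
  unfolding grouplike_def
proof (intro conjI allI impI)
  note ab = grouplikeD(1)[OF a] grouplikeD(1)[OF b]
  show "keys (a \<star> b) \<subseteq> carrier G"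
    using ab by (rule ga_mult_closed)
  show "lin (\<lambda>_. 1) (a \<star> b) = 1" if "0 < N"
    using grouplikeD(2)[OF a that] grouplikeD(2)[OF b that] by (simp add: lin_mult(1))
  show "lin (\<lambda>g. f g * h g) (a \<star> b) = lin f (a \<star> b) * lin h (a \<star> b)"
    if *: "kills n f" "kills k h" "n + k \<le> N" for f h n k
  proof -
    have "lin (\<lambda>g. f g * h g) (a \<star> b)
        = lin (\<lambda>g. lin (\<lambda>x. f (g \<otimes> x)) b * lin (\<lambda>x. h (g \<otimes> x)) b) a"
      unfolding lin_mult(1) using ab(1) grouplike_translate[OF b *] by (intro lin_cong) auto
    also have "\<dots> = lin f (a \<star> b) * lin h (a \<star> b)"
      unfolding lin_mult(1)
      using grouplikeD(3)[OF a kills_right[OF *(1) ab(2)] kills_right[OF *(2) ab(2)] *(3)] .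
    finally show ?thesis .
  qed
qed

text \<open>
  With \<open>f' = f(\<cdot> b)\<close> and \<open>h' = h(\<cdot> b)\<close>, translating the product \<open>f' h'\<close> by \<open>a\<close> gives \<open>f h\<close> up to \<open>J\<^sup>N\<close>.
\<close>

lemma grouplike_inverse:
  assumes a: "grouplike N a" and b: "keys b \<subseteq> carrier G"
    and inv: "a \<star> b - single \<one> 1 \<in> J.ipow N" "b \<star> a - single \<one> 1 \<in> J.ipow N"
  shows "grouplike N b"
  unfolding grouplike_def
proof (intro conjI allI impI)
  note ak = grouplikeD(1)[OF a]
  show "keys b \<subseteq> carrier G" by (rule b)
  show "lin (\<lambda>_. 1) b = 1" if N: "0 < N"
  proof -
    have "lin (\<lambda>_. 1) (a \<star> b) = 1"
      using kills_lin_eq[OF kills_mono[OF kills_const] inv(1), of 1] N by simp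
    then show ?thesis using grouplikeD(2)[OF a N] by (simp add: lin_mult(2))
  qed
  show "lin (\<lambda>g. f g * h g) b = lin f b * lin h b"
    if *: "kills n f" "kills k h" "n + k \<le> N" for f h n k
  proof -
    define f' where "f' = (\<lambda>g. lin (\<lambda>x. f (g \<otimes> x)) b)"
    define h' where "h' = (\<lambda>g. lin (\<lambda>x. h (g \<otimes> x)) b)"
    have k': "kills n f'" "kills k h'" unfolding f'_def h'_def using * b by (auto intro: kills_right)
    \<comment> \<open>Summing a translate of \<open>f'\<close> against a undoes the translation by
      b, because g a b is congruent to g modulo J^N.\<close>
    have recover: "lin (\<lambda>x. lin (\<lambda>y. u (g \<otimes> x \<otimes> y)) b) a = u g"
      if g: "g \<in> carrier G" and u: "kills m u" "m \<le> N" for g u m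
    proof -
      have "single g 1 \<star> (a \<star> b - single \<one> 1) \<in> J.ipow N"
        using inv(1) g by (intro ipow_mult_left) auto
      then have "single g 1 \<star> (a \<star> b) - single g 1 \<in> J.ipow N"
        using g by (simp add: ga_distribs)
      from kills_lin_eq[OF kills_mono[OF u] this]
      have "lin u (single g 1 \<star> (a \<star> b)) = u g" by simp
      moreover have "lin u (single g 1 \<star> (a \<star> b))
          = lin (\<lambda>x. lin (\<lambda>y. u (g \<otimes> (x \<otimes> y))) b) a"
        by (subst lin_mult(1), simp, subst lin_mult(1), simp)
      moreover have "\<dots> = lin (\<lambda>x. lin (\<lambda>y. u (g \<otimes> x \<otimes> y)) b) a"
        using g ak b by (intro lin_cong) (auto simp: m_assoc subset_iff)
      ultimately show ?thesis by simp
    qed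
    have "lin (\<lambda>g. f g * h g) b = lin (\<lambda>g. lin (\<lambda>x. f' (g \<otimes> x) * h' (g \<otimes> x)) a) b"
    proof (rule lin_cong)
      fix g assume "g \<in> keys b"
      then have g: "g \<in> carrier G" using b by auto
      show "f g * h g = lin (\<lambda>x. f' (g \<otimes> x) * h' (g \<otimes> x)) a"
        unfolding grouplike_translate[OF a k' *(3) g]
        using recover[OF g *(1)] recover[OF g *(2)] *(3) by (simp add: f'_def h'_def)
    qed
    also have "\<dots> = lin (\<lambda>g. f' g * h' g) (b \<star> a)"
      by (simp add: lin_mult(1))
    \<comment> \<open>The other congruence, of b a with 1, collapses the sum to the value at the
      identity.\<close>
    also have "\<dots> = f' \<one> * h' \<one>"
      using kills_lin_eq[OF kills_mono[OF kills_mult[OF k'] *(3)] inv(2)] by simp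
    also have "\<dots> = lin f b * lin h b"
      unfolding f'_def h'_def using b by (intro arg_cong2[of _ _ _ _ "(*)"] lin_cong) auto
    finally show ?thesis .
  qed
qed

subsection \<open>The topological dual\<close>

lemma dual_space_iff:
  "l \<in> dual_space G J \<longleftrightarrow> l \<in> extensional (carrier J.H) \<and>
     (\<forall>x\<in>carrier J.H. \<forall>y\<in>carrier J.H. l (x \<oplus>\<^bsub>J.H\<^esub> y) = l x + l y) \<and>
     (\<forall>c. \<forall>x\<in>carrier J.H. l (completed_elem G J c \<one> \<otimes>\<^bsub>J.H\<^esub> x) = c * l x) \<and>
     (\<exists>n. \<forall>x\<in>carrier J.H. x n = \<zero>\<^bsub>J.H\<^esub> n \<longrightarrow> l x = 0)"
  by (auto simp: dual_space_def Let_def)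

text \<open>Linearity determines l on the image of Q[G]. Continuity carries this over to x, whose
  difference from a representative of level N \<ge> n is trivial at level n.\<close>

lemma dual_space_lin:
  assumes l: "l \<in> dual_space G J"
  defines "f \<equiv> \<lambda>g. l (completed_elem G J 1 g)"
  obtains n where "kills n f"
    "\<And>x N a. x \<in> carrier J.H \<Longrightarrow> n \<le> N \<Longrightarrow> a \<in> x N \<Longrightarrow> l x = lin f a"
proof -
  interpret H: ring J.H by (rule J.ring_completion)
  interpret t: ring_hom_ring GA J.H "to_completion GA J" by (rule J.to_completion_hom)
  have add: "\<And>x y. x \<in> carrier J.H \<Longrightarrow> y \<in> carrier J.H \<Longrightarrow> l (x \<oplus>\<^bsub>J.H\<^esub> y) = l x + l y"
    and scale: "\<And>c x. x \<in> carrier J.H \<Longrightarrow> l (completed_elem G J c \<one> \<otimes>\<^bsub>J.H\<^esub> x) = c * l x"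
    using l unfolding dual_space_iff by blast+
  have "\<exists>n. \<forall>x\<in>carrier J.H. x n = \<zero>\<^bsub>J.H\<^esub> n \<longrightarrow> l x = 0"
    using l unfolding dual_space_iff by (elim conjE)
  then obtain n where "\<forall>x\<in>carrier J.H. x n = \<zero>\<^bsub>J.H\<^esub> n \<longrightarrow> l x = 0" by (elim exE)
  then have n: "\<And>x. x \<in> carrier J.H \<Longrightarrow> x n = \<zero>\<^bsub>J.H\<^esub> n \<Longrightarrow> l x = 0" by simp
  have zero: "l \<zero>\<^bsub>J.H\<^esub> = 0" using n by simp
  have tl: "l (to_completion GA J a) = lin f a" if "keys a \<subseteq> carrier G" for a
    using that
  proof (induction a rule: poly_mapping_carrier_induct)
    case zero
    then show ?case using \<open>l \<zero>\<^bsub>J.H\<^esub> = 0\<close> t.hom_zero by simp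
  next
    case (add g c b)
    have "l (to_completion GA J (single g c + b))
      = l (to_completion GA J (single g c)) + l (to_completion GA J b)"
      using add t.hom_add[of "single g c" b]
        \<open>\<And>x y. x \<in> carrier J.H \<Longrightarrow> y \<in> carrier J.H \<Longrightarrow> l (x \<oplus>\<^bsub>J.H\<^esub> y) = l x + l y\<close>
        t.hom_closed by simp
    \<comment> \<open>Homogeneity is available for scalars acting through the identity, so c g is
      written as (c 1) g.\<close>
    moreover have "to_completion GA J (single g c)
        = completed_elem G J c \<one> \<otimes>\<^bsub>J.H\<^esub> completed_elem G J 1 g"
      using add t.hom_mult[of "single \<one> c" "single g 1"]
      by (simp add: completed_elem_def)
    ultimately show ?case using add scale by (simp add: f_def lin_add)
  qed
  show thesis
  proof (rule that[of n])
    show "kills n f"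
      unfolding kills_def
    proof
      fix a assume a: "a \<in> J.ipow n"
      have "to_completion GA J a n = J.ipow n +>\<^bsub>GA\<^esub> a" by (simp add: to_completion_def J.ipow_def)
      also have "\<dots> = J.ipow n +>\<^bsub>GA\<^esub> 0" using a ipow_keys[OF a] by (subst coset_eq_iff) auto
      finally have "to_completion GA J a n = \<zero>\<^bsub>J.H\<^esub> n" by (simp add: J.completion_simps J.Q_zero)
      then show "lin f a = 0" using tl[OF ipow_keys[OF a]] n t.hom_closed ipow_keys[OF a] by simp
    qed
    fix x N a assume x: "x \<in> carrier J.H" and N: "n \<le> N" and a: "a \<in> x N"
    have ak: "keys a \<subseteq> carrier G" using J.completion_carrier[OF x] a by auto
    let ?t = "to_completion GA J a"
    have tc: "?t \<in> carrier J.H" using ak t.hom_closed by simp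
    interpret e: ring_hom_ring J.H "J.Q n" "\<lambda>x. x n" by (rule J.completion_eval_hom)
    have "x n = ?t n" using J.completion_coset[OF x a N] by (simp add: to_completion_def J.ipow_def)
    then have "(x \<ominus>\<^bsub>J.H\<^esub> ?t) n = \<zero>\<^bsub>J.H\<^esub> n"
      using x tc e.hom_add[of x "\<ominus>\<^bsub>J.H\<^esub> ?t"] e.hom_a_inv[OF tc] e.hom_closed[OF tc]
      by (simp add: a_minus_def e.S.r_neg e.hom_zero)
    then have "l (x \<ominus>\<^bsub>J.H\<^esub> ?t) = 0" using n x tc by simp
    moreover have "l x = l (x \<ominus>\<^bsub>J.H\<^esub> ?t) + l ?t"
      using add[of "x \<ominus>\<^bsub>J.H\<^esub> ?t" ?t] x tc by (simp add: a_minus_def H.a_assoc H.l_neg)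
    ultimately show "l x = lin f a" using tl[OF ak] by simp
  qed
qed

lemma completion_rep:
  assumes "x \<in> carrier J.H"
  obtains a where "a \<in> x n" "keys a \<subseteq> carrier G"
  using J.completion_ex_rep[OF assms, of n] by auto

lemma completion_diff:
  assumes "x \<in> carrier J.H" "a \<in> x n" "b \<in> x m" "k \<le> n" "k \<le> m"
  shows "a - b \<in> J.ipow k"
proof -
  have "keys a \<subseteq> carrier G" "keys b \<subseteq> carrier G"
    using J.completion_carrier[OF assms(1)] assms by auto
  then show ?thesis
    using J.completion_coset[OF assms(1,2,4)] J.completion_coset[OF assms(1,3,5)]
    by (simp flip: coset_eq_iff)
qed

text \<open>Density of the span of G: a representative at a level deep enough for both functionals
  reduces the claim to values on G.\<close>

lemma dual_space_ext:
  assumes "l \<in> dual_space G J" "m \<in> dual_space G J"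
    and "\<And>g. g \<in> carrier G \<Longrightarrow> l (completed_elem G J 1 g) = m (completed_elem G J 1 g)"
  shows "l = m"
proof (rule extensionalityI[of _ "carrier J.H"])
  show "l \<in> extensional (carrier J.H)" "m \<in> extensional (carrier J.H)"
    using assms unfolding dual_space_iff by blast+
  fix x assume x: "x \<in> carrier J.H"
  obtain n where "kills n (\<lambda>g. l (completed_elem G J 1 g))"
    and n: "\<And>x N a. x \<in> carrier J.H \<Longrightarrow> n \<le> N \<Longrightarrow> a \<in> x N \<Longrightarrow> l x = lin (\<lambda>g. l (completed_elem G J 1 g)) a"
    by (rule dual_space_lin[OF assms(1)]) metis
  obtain k where "kills k (\<lambda>g. m (completed_elem G J 1 g))"
    and k: "\<And>x N a. x \<in> carrier J.H \<Longrightarrow> k \<le> N \<Longrightarrow> a \<in> x N \<Longrightarrow> m x = lin (\<lambda>g. m (completed_elem G J 1 g)) a"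
    by (rule dual_space_lin[OF assms(2)]) metis
  obtain a where a: "a \<in> x (max n k)" "keys a \<subseteq> carrier G"
    using completion_rep[OF x] .
  have "l x = lin (\<lambda>g. l (completed_elem G J 1 g)) a" "m x = lin (\<lambda>g. m (completed_elem G J 1 g)) a"
    using n[OF x _ a(1)] k[OF x _ a(1)] by auto
  then show "l x = m x"
    using assms(3) a(2) lin_cong[of a "\<lambda>g. l (completed_elem G J 1 g)" "\<lambda>g. m (completed_elem G J 1 g)"]
    by (auto simp: subset_iff)
qed

text \<open>The converse of \<open>dual_space_lin\<close>: a function killing J^n extends to the
  completion through representatives at level n, and \<open>dual_space_ext\<close> resolves the
  \<open>THE\<close>.\<close>

lemma dual_elem:
  assumes f: "kills n f"
  shows "dual_elem G J f \<in> dual_space G J"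
    and "x \<in> carrier J.H \<Longrightarrow> n \<le> N \<Longrightarrow> a \<in> x N \<Longrightarrow> dual_elem G J f x = lin f a"
    and "g \<in> carrier G \<Longrightarrow> dual_elem G J f (completed_elem G J 1 g) = f g"
proof -
  define l where "l = (\<lambda>x\<in>carrier J.H. lin f (SOME a. a \<in> x n))"
  have val: "l x = lin f a" if x: "x \<in> carrier J.H" and N: "n \<le> N" and a: "a \<in> x N" for x N a
  proof -
    have "(SOME a. a \<in> x n) \<in> x n" using completion_rep[OF x, of n] by (metis someI_ex)
    then have "(SOME a. a \<in> x n) - a \<in> J.ipow n" using completion_diff[OF x _ a _ N] by blast
    then show ?thesis using kills_lin_eq[OF f] x by (simp add: l_def)
  qed
  have lg: "l (completed_elem G J 1 g) = f g" if "g \<in> carrier G" for g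
    using val[OF completed_elem_closed[OF that] order_refl, of "single g 1"] that
    by (simp add: completed_elem_eq mem_coset_iff)
  have ld: "l \<in> dual_space G J"
    unfolding dual_space_iff
  proof (intro conjI ballI allI)
    show "l \<in> extensional (carrier J.H)" by (simp add: l_def)
    fix x assume x: "x \<in> carrier J.H"
    obtain a where a: "a \<in> x n" "keys a \<subseteq> carrier G" using completion_rep[OF x] .
    have xa: "x n = J.ipow n +>\<^bsub>GA\<^esub> a" using J.completion_coset[OF x a(1) order_refl] .
    show "l (completed_elem G J c \<one> \<otimes>\<^bsub>J.H\<^esub> x) = c * l x" for c
    proof -
      have "(completed_elem G J c \<one> \<otimes>\<^bsub>J.H\<^esub> x) n = J.ipow n +>\<^bsub>GA\<^esub> (single \<one> c \<star> a)"
        using a by (simp add: J.completion_simps completed_elem_eq xa J.Q_coset_simps)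
      then have "l (completed_elem G J c \<one> \<otimes>\<^bsub>J.H\<^esub> x) = lin f (single \<one> c \<star> a)"
        using x by (intro val[OF J.completion_closed(1) order_refl]) (auto simp: mem_coset_iff)
      then show ?thesis using val[OF x order_refl a(1)] a by (simp add: lin_scalar_mult)
    qed
    show "l (x \<oplus>\<^bsub>J.H\<^esub> y) = l x + l y" if y: "y \<in> carrier J.H" for y
    proof -
      obtain b where b: "b \<in> y n" "keys b \<subseteq> carrier G" using completion_rep[OF y] .
      have yb: "y n = J.ipow n +>\<^bsub>GA\<^esub> b" using J.completion_coset[OF y b(1) order_refl] .
      have "(x \<oplus>\<^bsub>J.H\<^esub> y) n = J.ipow n +>\<^bsub>GA\<^esub> (a + b)"
        using a b by (simp add: J.completion_simps xa yb J.Q_coset_simps)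
      then have "l (x \<oplus>\<^bsub>J.H\<^esub> y) = lin f (a + b)"
        using x y by (intro val[OF J.completion_closed(2) order_refl]) (auto simp: mem_coset_iff)
      then show ?thesis using val[OF x order_refl a(1)] val[OF y order_refl b(1)] by (simp add: lin_add)
    qed
  next
    show "\<exists>n. \<forall>x\<in>carrier J.H. x n = \<zero>\<^bsub>J.H\<^esub> n \<longrightarrow> l x = 0"
    proof (intro exI[of _ n] ballI impI)
      fix x assume "x \<in> carrier J.H" "x n = \<zero>\<^bsub>J.H\<^esub> n"
      then show "l x = 0"
        using val[of x n 0] by (simp add: J.completion_simps J.Q_zero mem_coset_iff)
    qed
  qed
  have "dual_elem G J f = l"
    unfolding dual_elem_def
  proof (rule the_equality)
    show "l \<in> dual_space G J \<and> (\<forall>g\<in>carrier G. l (completed_elem G J 1 g) = f g)"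
      using ld lg by blast
  qed (use ld lg dual_space_ext in auto)
  then show "dual_elem G J f \<in> dual_space G J"
    "x \<in> carrier J.H \<Longrightarrow> n \<le> N \<Longrightarrow> a \<in> x N \<Longrightarrow> dual_elem G J f x = lin f a"
    "g \<in> carrier G \<Longrightarrow> dual_elem G J f (completed_elem G J 1 g) = f g"
    using ld lg val by auto
qed

lemma dual_elem_cong:
  "(\<And>g. g \<in> carrier G \<Longrightarrow> f g = h g) \<Longrightarrow> dual_elem G J f = dual_elem G J h"
  unfolding dual_elem_def by (simp cong: conj_cong)

lemma dual_space_elem:
  assumes "l \<in> dual_space G J"
  obtains n f where "kills n f" "l = dual_elem G J f"
proof -
  obtain n where n: "kills n (\<lambda>g. l (completed_elem G J 1 g))"
    by (rule dual_space_lin[OF assms])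
  show thesis
    by (rule that[OF n], rule dual_space_ext[OF assms dual_elem(1)[OF n]]) (simp add: dual_elem(3)[OF n])
qed

text \<open>The dual has become the algebra of functions killing some J^n, with pointwise product,
  so multiplicativity of evaluation at x is a condition on the representatives of x.\<close>

lemma eval_ring_hom_iff:
  assumes x: "x \<in> carrier J.H"
  shows "(\<lambda>l. l x) \<in> ring_hom (dual_algebra G J) rat_ring \<longleftrightarrow> (\<forall>N. \<forall>a\<in>x N. grouplike N a)"
proof -
  have mult: "dual_elem G J f \<otimes>\<^bsub>dual_algebra G J\<^esub> dual_elem G J h = dual_elem G J (\<lambda>g. f g * h g)"
    if "kills n f" "kills k h" for n k f h
    using that by (auto simp: dual_algebra_def dual_elem(3) intro!: dual_elem_cong)
  have simps: "carrier (dual_algebra G J) = dual_space G J"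
    "\<one>\<^bsub>dual_algebra G J\<^esub> = dual_elem G J (\<lambda>_. 1)"
    "\<And>l m. (l \<oplus>\<^bsub>dual_algebra G J\<^esub> m) x = l x + m x"
    "a \<otimes>\<^bsub>rat_ring\<^esub> b = a * b" "a \<oplus>\<^bsub>rat_ring\<^esub> b = a + b" "\<one>\<^bsub>rat_ring\<^esub> = 1" "carrier rat_ring = UNIV"
    for a b
    using x by (simp_all add: dual_algebra_def rat_ring_def)
  show ?thesis
  proof
    assume hom: "(\<lambda>l. l x) \<in> ring_hom (dual_algebra G J) rat_ring"
    show "\<forall>N. \<forall>a\<in>x N. grouplike N a"
    proof (intro allI ballI)
      fix N a assume a: "a \<in> x N"
      show "grouplike N a"
        unfolding grouplike_def
      proof (intro conjI allI impI)
        show "keys a \<subseteq> carrier G" using J.completion_carrier[OF x] a by auto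
        show "lin (\<lambda>_. 1) a = 1" if "0 < N"
          using ring_hom_one[OF hom] dual_elem(2)[OF kills_const x _ a] that by (simp add: simps)
        fix f h n k assume *: "kills n f" "kills k h" "n + k \<le> N"
        have "dual_elem G J (\<lambda>g. f g * h g) x = dual_elem G J f x * dual_elem G J h x"
          using ring_hom_mult[OF hom, of "dual_elem G J f" "dual_elem G J h"] dual_elem(1) *
          by (auto simp: simps mult[OF *(1,2)])
        then show "lin (\<lambda>g. f g * h g) a = lin f a * lin h a"
          using dual_elem(2)[OF kills_mult[OF *(1,2)] x *(3) a] dual_elem(2)[OF *(1) x _ a]
            dual_elem(2)[OF *(2) x _ a] *(3) by simp
      qed
    qed
  next
    assume gl: "\<forall>N. \<forall>a\<in>x N. grouplike N a"
    show "(\<lambda>l. l x) \<in> ring_hom (dual_algebra G J) rat_ring"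
    proof (rule ring_hom_memI, unfold simps)
      fix l m assume "l \<in> dual_space G J" "m \<in> dual_space G J"
      then obtain n f k h where *: "kills n f" "l = dual_elem G J f" "kills k h" "m = dual_elem G J h"
        using dual_space_elem by metis
      \<comment> \<open>Level n + k serves f, h and their product simultaneously.\<close>
      obtain a where a: "a \<in> x (n + k)" using completion_rep[OF x] by blast
      have "lin (\<lambda>g. f g * h g) a = lin f a * lin h a"
        using gl a *(1,3) by (intro grouplikeD(3)[of "n + k"]) auto
      then show "(l \<otimes>\<^bsub>dual_algebra G J\<^esub> m) x = l x * m x"
        using dual_elem(2)[OF kills_mult[OF *(1,3)] x order_refl a] dual_elem(2)[OF *(1) x _ a]
          dual_elem(2)[OF *(3) x _ a] by (simp add: * mult[OF *(1,3)])
    next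
      obtain a where a: "a \<in> x 1" using completion_rep[OF x] by blast
      then show "dual_elem G J (\<lambda>_. 1) x = 1"
        using dual_elem(2)[OF kills_const x order_refl a] grouplikeD(2)[of 1 a] gl by simp
    qed auto
  qed
qed

section \<open>The group of rational points\<close>

lemma completion_points_carrier_iff:
  "x \<in> carrier (completion_points G J) \<longleftrightarrow> x \<in> Units J.H \<and> (\<forall>N. \<forall>a\<in>x N. grouplike N a)"
  using eval_ring_hom_iff[of x] by (auto simp: completion_points_def Units_def)

lemma completion_points_simps:
  "x \<otimes>\<^bsub>completion_points G J\<^esub> y = x \<otimes>\<^bsub>J.H\<^esub> y" "\<one>\<^bsub>completion_points G J\<^esub> = \<one>\<^bsub>J.H\<^esub>"
  by (simp_all add: completion_points_def units_of_def)

lemma completion_mult_coset: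
  assumes "x \<in> carrier J.H" "y \<in> carrier J.H" "a \<in> x N" "b \<in> y N"
  shows "(x \<otimes>\<^bsub>J.H\<^esub> y) N = J.ipow N +>\<^bsub>GA\<^esub> (a \<star> b)"
proof -
  have "keys a \<subseteq> carrier G" "keys b \<subseteq> carrier G"
    using J.completion_carrier assms by auto
  then show ?thesis
    using J.completion_coset[OF assms(1,3) order_refl] J.completion_coset[OF assms(2,4) order_refl]
    by (simp add: J.completion_simps J.Q_coset_simps)
qed

text \<open>Inverses exist among the units of the completion; \<open>grouplike_inverse\<close> shows
  that they are points, so no antipode has to be constructed.\<close>

lemma group_completion_points: "group (completion_points G J)"
proof -
  interpret H: ring J.H by (rule J.ring_completion)
  have one: "\<one>\<^bsub>J.H\<^esub> N = J.ipow N +>\<^bsub>GA\<^esub> single \<one> 1" for N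
    by (simp add: J.completion_simps J.Q_one)
  show ?thesis
  proof (rule groupI, unfold completion_points_simps)
    fix x y assume "x \<in> carrier (completion_points G J)" "y \<in> carrier (completion_points G J)"
    then have xy: "x \<in> Units J.H" "y \<in> Units J.H" "x \<in> carrier J.H" "y \<in> carrier J.H"
      and gl: "\<And>N a. a \<in> x N \<Longrightarrow> grouplike N a" "\<And>N a. a \<in> y N \<Longrightarrow> grouplike N a"
      by (auto simp: completion_points_carrier_iff)
    have "grouplike N c" if c: "c \<in> (x \<otimes>\<^bsub>J.H\<^esub> y) N" for N c
    proof -
      obtain a b where ab: "a \<in> x N" "b \<in> y N" using completion_rep xy by metis
      then show ?thesis
        using grouplike_cong[OF grouplike_mult[OF gl]] completion_mult_coset[OF xy(3,4) ab] c
        by (simp add: mem_coset_iff)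
    qed
    then show "x \<otimes>\<^bsub>J.H\<^esub> y \<in> carrier (completion_points G J)"
      using xy by (auto simp: completion_points_carrier_iff)
  next
    show "\<one>\<^bsub>J.H\<^esub> \<in> carrier (completion_points G J)"
      using grouplike_cong[OF grouplike_single[OF one_closed]]
      by (auto simp: completion_points_carrier_iff one mem_coset_iff)
  next
    fix x assume "x \<in> carrier (completion_points G J)"
    then have x: "x \<in> Units J.H" "x \<in> carrier J.H" and gl: "\<And>N a. a \<in> x N \<Longrightarrow> grouplike N a"
      by (auto simp: completion_points_carrier_iff)
    let ?y = "inv\<^bsub>J.H\<^esub> x"
    have y: "?y \<in> Units J.H" "?y \<in> carrier J.H" using x by auto
    have "grouplike N b" if b: "b \<in> ?y N" for N b
    proof -
      obtain a where a: "a \<in> x N" "keys a \<subseteq> carrier G" using completion_rep[OF x(2)] .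
      have bk: "keys b \<subseteq> carrier G" using J.completion_carrier[OF y(2)] b by auto
      have "J.ipow N +>\<^bsub>GA\<^esub> (a \<star> b) = J.ipow N +>\<^bsub>GA\<^esub> single \<one> 1"
        "J.ipow N +>\<^bsub>GA\<^esub> (b \<star> a) = J.ipow N +>\<^bsub>GA\<^esub> single \<one> 1"
        using completion_mult_coset[OF x(2) y(2) a(1) b] completion_mult_coset[OF y(2) x(2) b a(1)] x
        by (simp_all add: one)
      then show ?thesis
        using a bk by (intro grouplike_inverse[OF gl[OF a(1)] bk])
          (auto simp: coset_eq_iff ga_mult_closed)
    qed
    then have "?y \<in> carrier (completion_points G J)"
      using y by (auto simp: completion_points_carrier_iff)
    then show "\<exists>y\<in>carrier (completion_points G J). y \<otimes>\<^bsub>J.H\<^esub> x = \<one>\<^bsub>J.H\<^esub>"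
      using x by (intro bexI[of _ ?y]) auto
  qed (simp_all add: completion_points_carrier_iff H.m_assoc H.Units_closed)
qed

end

section \<open>Rational powers\<close>

subsection \<open>Truncated binomial series\<close>

text \<open>The truncation of (1 + X)^\<alpha> modulo X^n. For n = 0 it is 0 rather than 1, whence
  the \<open>Suc\<close> in \<open>rat_power_trunc_mod\<close> and the separate case in
  \<open>unitary_part_commuting\<close>.\<close>

definition binomial_poly :: "rat \<Rightarrow> nat \<Rightarrow> rat poly" where
  "binomial_poly \<alpha> n = (\<Sum>k<n. Polynomial.monom (\<alpha> gchoose k) k)"

lemma coeff_binomial_poly:
  "Polynomial.coeff (binomial_poly \<alpha> n) k = (if k < n then \<alpha> gchoose k else 0)"
  by (simp add: binomial_poly_def coeff_sum)

lemma coeff_binomial_poly_mult: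
  assumes "k < n"
  shows "Polynomial.coeff (binomial_poly \<alpha> n * binomial_poly \<beta> n) k = (\<alpha> + \<beta>) gchoose k"
proof -
  have "Polynomial.coeff (binomial_poly \<alpha> n * binomial_poly \<beta> n) k
      = (\<Sum>i\<in>{0..k}. (\<alpha> gchoose i) * (\<beta> gchoose (k - i)))"
    unfolding coeff_mult using assms
    by (intro sum.cong) (auto simp: coeff_binomial_poly)
  then show ?thesis by (simp add: gbinomial_Vandermonde)
qed

text \<open>By Vandermonde the square has the coefficients (-1 choose k) of (1 + X)^(-1) below
  degree n; multiplication by 1 + X turns them into (0 choose k), by Pascal's rule.\<close>

lemma binomial_poly_inverse_sqrt:
  "Polynomial.monom 1 n dvd binomial_poly (- 1 / 2) n * binomial_poly (- 1 / 2) n * [:1, 1:] - 1"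
  unfolding monom_1_dvd_iff'
proof (intro allI impI)
  fix k assume k: "k < n"
  let ?q = "binomial_poly (- 1 / 2) n * binomial_poly (- 1 / 2) n"
  have q: "Polynomial.coeff ?q j = (- 1) gchoose j" if "j < n" for j
    using coeff_binomial_poly_mult[OF that, of "- 1 / 2" "- 1 / 2"] by simp
  have "?q * [:1, 1:] = ?q + pCons 0 ?q" by simp
  then have "Polynomial.coeff (?q * [:1, 1:]) k = (if k = 0 then 1 else 0)"
    using k q gbinomial_Suc_Suc[of "- 1 :: rat"]
    by (cases k) (auto simp: coeff_pCons add.commute)
  then show "Polynomial.coeff (?q * [:1, 1:] - 1) k = 0"
    by (cases k) (simp_all add: coeff_1)
qed

lemma binomial_poly_power:
  "Polynomial.monom 1 n dvd [:1, 1:] ^ m - binomial_poly (of_nat m) n"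
  unfolding monom_1_dvd_iff'
proof (intro allI impI)
  fix k assume k: "k < n"
  have c: "Polynomial.coeff ([:1, 1:] ^ m :: rat poly) k = of_nat (m choose k)" for k
  proof (induction m arbitrary: k)
    case (Suc m)
    have "[:1, 1:] ^ Suc m = [:1, 1:] ^ m + pCons 0 ([:1, 1:] ^ m :: rat poly)" by simp
    then show ?case using Suc by (cases k) (simp_all add: coeff_pCons del: power_Suc)
  qed (auto simp: coeff_1 split: nat.split)
  show "Polynomial.coeff ([:1, 1:] ^ m - binomial_poly (of_nat m) n) k = 0"
    using k c by (simp add: coeff_binomial_poly binomial_gbinomial)
qed

text \<open>The binomial coefficient as a polynomial in its upper argument, in contrast to
  \<open>binomial_poly\<close>, whose variable stands for p - 1.\<close>

definition gbinomial_poly :: "nat \<Rightarrow> rat poly" where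
  "gbinomial_poly k = Polynomial.smult (inverse (fact k)) (\<Prod>i\<in>{0..<k}. [:- of_nat i, 1:])"

lemma poly_gbinomial_poly: "poly (gbinomial_poly k) \<alpha> = \<alpha> gchoose k"
  by (simp add: gbinomial_poly_def poly_prod gbinomial_prod_rev divide_inverse)

lemma poly_eq_of_nat:
  assumes "\<And>m. poly p (of_nat m) = poly q (of_nat m)"
  shows "p = (q :: rat poly)"
proof (rule ccontr)
  assume "p \<noteq> q"
  then have "finite {x. poly (p - q) x = 0}" by (intro poly_roots_finite) simp
  moreover have "range (of_nat :: nat \<Rightarrow> rat) \<subseteq> {x. poly (p - q) x = 0}" using assms by auto
  ultimately have "finite (range (of_nat :: nat \<Rightarrow> rat))" by (rule finite_subset[rotated])
  then show False using infinite_UNIV_nat by (simp add: finite_image_iff inj_on_def)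
qed

subsection \<open>Evaluation of polynomials in a group algebra\<close>

text \<open>Horner's scheme in the noncommutative algebra, with rational coefficients embedded as
  multiples of the identity.\<close>

definition poly_eval :: "('g, 'm) monoid_scheme \<Rightarrow> ('g \<Rightarrow>\<^sub>0 rat) \<Rightarrow> rat poly \<Rightarrow> ('g \<Rightarrow>\<^sub>0 rat)" where
  "poly_eval G u p = fold_coeffs
    (\<lambda>c r. single \<one>\<^bsub>G\<^esub> c + u \<otimes>\<^bsub>group_algebra G\<^esub> r) p 0"

lemma poly_eval_pCons:
  "poly_eval G u (pCons c p) = single \<one>\<^bsub>G\<^esub> c + u \<otimes>\<^bsub>group_algebra G\<^esub> poly_eval G u p"
  by (cases "c = 0 \<and> p = 0") (auto simp: poly_eval_def)

lemma poly_eval_zero [simp]: "poly_eval G u 0 = 0"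
  by (simp add: poly_eval_def)

lemma poly_eval_add: "poly_eval G u (p + q) = poly_eval G u p + poly_eval G u q"
  by (induction p q rule: poly_induct2)
    (simp_all add: poly_eval_pCons single_add ga_distribs)

lemma poly_eval_uminus: "poly_eval G u (- p) = - poly_eval G u p"
  using poly_eval_add[of G u p "- p"] by (simp add: eq_neg_iff_add_eq_0 add.commute)

lemma poly_eval_diff: "poly_eval G u (p - q) = poly_eval G u p - poly_eval G u q"
  using poly_eval_add[of G u p "- q"] by (simp add: poly_eval_uminus)

context group_algebra_ideal
begin

abbreviation gel :: "'a \<Rightarrow> 'a \<Rightarrow>\<^sub>0 rat" where
  "gel g \<equiv> single g 1"

lemma keys_gel [simp]: "g \<in> carrier G \<Longrightarrow> keys (single g c) \<subseteq> carrier G"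
  by simp

lemma keys_mult [simp]: "keys a \<subseteq> carrier G \<Longrightarrow> keys b \<subseteq> carrier G
    \<Longrightarrow> keys (a \<star> b) \<subseteq> carrier G" for a b :: "'a \<Rightarrow>\<^sub>0 rat"
  by (rule ga_mult_closed)

lemma poly_eval_closed [simp]:
  assumes "keys u \<subseteq> carrier G"
  shows "keys (poly_eval G u p) \<subseteq> carrier G"
  by (induction p) (simp_all add: poly_eval_pCons keys_plus_subset assms)

lemma poly_eval_smult:
  assumes "keys u \<subseteq> carrier G"
  shows "poly_eval G u (Polynomial.smult c p) = single \<one> c \<star> poly_eval G u p"
proof (induction p)
  case (pCons a p)
  have "u \<star> (single \<one> c \<star> poly_eval G u p)
      = single \<one> c \<star> (u \<star> poly_eval G u p)"
    using assms scalar_central[OF assms, of c] by (simp flip: ga_assoc)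
  then show ?case using pCons by (simp add: poly_eval_pCons ga_distribs)
qed simp

lemma poly_eval_mult:
  assumes u: "keys u \<subseteq> carrier G"
  shows "poly_eval G u (p * q) = poly_eval G u p \<star> poly_eval G u q"
proof (induction p)
  case (pCons a p)
  then show ?case
    using u by (simp add: poly_eval_add poly_eval_smult poly_eval_pCons ga_distribs
        ga_assoc)
qed simp

lemma poly_eval_1 [simp]: "poly_eval G u 1 = gel \<one>"
  by (simp add: one_pCons poly_eval_pCons)

text \<open>The common source of the commutation relations between truncated powers: u v = v u'
  passes from u to every polynomial in u.\<close>

lemma poly_eval_intertwine:
  assumes "keys u \<subseteq> carrier G" "keys u' \<subseteq> carrier G"
    "keys v \<subseteq> carrier G" "u \<star> v = v \<star> u'"
  shows "poly_eval G u p \<star> v = v \<star> poly_eval G u' p"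
proof (induction p)
  case (pCons a p)
  have "u \<star> poly_eval G u p \<star> v = u \<star> (v \<star> poly_eval G u' p)"
    using assms pCons.IH by (simp add: ga_assoc)
  also have "\<dots> = v \<star> (u' \<star> poly_eval G u' p)"
    using assms by (simp flip: ga_assoc)
  finally show ?case
    using assms scalar_central[OF assms(3), of a] by (simp add: poly_eval_pCons ga_distribs)
qed simp

text \<open>The bridge from polynomial identities modulo X^n to congruences modulo J^n.\<close>

lemma poly_eval_monom_dvd:
  assumes u: "u \<in> J" and dvd: "Polynomial.monom 1 n dvd p"
  shows "poly_eval G u p \<in> J.ipow n"
proof -
  have uk: "keys u \<subseteq> carrier G" using J.a_subset u by auto
  have "poly_eval G u (Polynomial.monom 1 n) \<in> J.ipow n"
  proof (induction n)
    case 0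
    then show ?case by (simp add: J.ipow_0 monom_0 poly_eval_pCons)
  next
    case (Suc n)
    have "u \<star> poly_eval G u (Polynomial.monom 1 n) \<in> J.ipow (1 + n)"
      using J.ipow_mult[of u 1 _ n] u Suc by (simp add: J.ipow_1 del: One_nat_def)
    then show ?case by (simp add: monom_Suc poly_eval_pCons)
  qed
  moreover obtain q where "p = Polynomial.monom 1 n * q" using dvd by (elim dvdE)
  ultimately show ?thesis using uk by (simp add: poly_eval_mult ipow_mult_right)
qed

definition rat_power_trunc :: "rat \<Rightarrow> 'a \<Rightarrow> nat \<Rightarrow> 'a \<Rightarrow>\<^sub>0 rat" where
  "rat_power_trunc \<alpha> p n = poly_eval G (gel p - gel \<one>) (binomial_poly \<alpha> n)"

lemma keys_gel_diff [simp]: "p \<in> carrier G \<Longrightarrow> keys (gel p - gel \<one>) \<subseteq> carrier G"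
  by (rule keys_diff_subset) simp_all

lemma rat_power_trunc_closed [simp]:
  "p \<in> carrier G \<Longrightarrow> keys (rat_power_trunc \<alpha> p n) \<subseteq> carrier G"
  by (simp add: rat_power_trunc_def)

lemma rat_power_trunc_diff:
  assumes "gel p - gel \<one> \<in> J" "n \<le> m"
  shows "rat_power_trunc \<alpha> p m - rat_power_trunc \<alpha> p n \<in> J.ipow n"
  unfolding rat_power_trunc_def poly_eval_diff[symmetric] using assms
  by (intro poly_eval_monom_dvd) (auto simp: monom_1_dvd_iff' coeff_binomial_poly)

lemma rat_power_trunc_mod:
  assumes "gel p - gel \<one> \<in> J"
  shows "rat_power_trunc \<alpha> p (Suc n) - gel \<one> \<in> J"
proof -
  have "rat_power_trunc \<alpha> p (Suc n) - rat_power_trunc \<alpha> p 1 \<in> J.ipow 1"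
    using assms by (rule rat_power_trunc_diff) simp
  moreover have "binomial_poly \<alpha> 1 = 1"
    by (simp add: binomial_poly_def monom_0 one_pCons)
  ultimately show ?thesis by (simp only: rat_power_trunc_def poly_eval_1 J.ipow_1)
qed

lemma rat_power_trunc_intertwine:
  assumes "p \<in> carrier G" "p' \<in> carrier G" "q \<in> carrier G" "p \<otimes> q = q \<otimes> p'"
  shows "rat_power_trunc \<alpha> p n \<star> gel q = gel q \<star> rat_power_trunc \<alpha> p' n"
  unfolding rat_power_trunc_def
  by (rule poly_eval_intertwine) (use assms in \<open>simp_all add: ga_distribs\<close>)

lemma rat_power_trunc_commute:
  assumes "p \<in> carrier G" "q \<in> carrier G" "p \<otimes> q = q \<otimes> p"
  shows "rat_power_trunc \<alpha> p n \<star> rat_power_trunc \<beta> q m = rat_power_trunc \<beta> q m \<star> rat_power_trunc \<alpha> p n"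
proof -
  have "(gel p - gel \<one>) \<star> rat_power_trunc \<beta> q m = rat_power_trunc \<beta> q m \<star> (gel p - gel \<one>)"
    using rat_power_trunc_intertwine[of q q p] assms
    by (simp add: ga_distribs ga_one_mult)
  then show ?thesis
    unfolding rat_power_trunc_def[of \<alpha>] using assms by (intro poly_eval_intertwine) simp_all
qed

lemma rat_power_trunc_sqrt:
  assumes "p \<in> carrier G" "gel p - gel \<one> \<in> J"
  shows "rat_power_trunc (- 1 / 2) p n \<star> rat_power_trunc (- 1 / 2) p n \<star> gel p - gel \<one> \<in> J.ipow n"
proof -
  have "poly_eval G (gel p - gel \<one>) [:1, 1:] = gel p"
    using assms by (simp add: poly_eval_pCons ga_distribs)
  then have "rat_power_trunc (- 1 / 2) p n \<star> rat_power_trunc (- 1 / 2) p n \<star> gel p - gel \<one>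
    = poly_eval G (gel p - gel \<one>)
        (binomial_poly (- 1 / 2) n * binomial_poly (- 1 / 2) n * [:1, 1:] - 1)"
    using assms(1) by (simp only: poly_eval_diff poly_eval_mult keys_gel_diff rat_power_trunc_def poly_eval_1)
  then show ?thesis
    using poly_eval_monom_dvd[OF assms(2) binomial_poly_inverse_sqrt] by simp
qed

text \<open>Put d = y - z. Since y and z commute, y^2 - z^2 = 2 d + d ((y - 1) + (z - 1)). If d lies
  in J^k with k < n, the last term and the left side lie in J^(k+1), hence so does 2 d, and 2 is
  invertible in Q.\<close>

lemma unipotent_sqrt_unique:
  assumes y: "keys y \<subseteq> carrier G" "y - gel \<one> \<in> J"
    and z: "keys z \<subseteq> carrier G" "z - gel \<one> \<in> J"
    and comm: "y \<star> z = z \<star> y" and sq: "y \<star> y - z \<star> z \<in> J.ipow n"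
  shows "y - z \<in> J.ipow n"
proof -
  have "y - z \<in> J.ipow k" if "k \<le> n" for k
    using that
  proof (induction k)
    case 0
    then show ?case using y z keys_diff_subset[of y _ z] by (simp add: J.ipow_0)
  next
    case (Suc k)
    let ?d = "y - z" and ?w = "(y - gel \<one>) + (z - gel \<one>)"
    have d: "?d \<in> J.ipow k" "keys ?d \<subseteq> carrier G"
      using Suc keys_diff_subset[OF y(1) z(1)] by auto
    have w: "?w \<in> J.ipow 1" using y z J.ipow_1 ipow_add[of _ 1] by metis
    have "?d \<star> ?w \<in> J.ipow (Suc k)" using J.ipow_mult[OF d(1) w] by simp
    moreover have "y \<star> y - z \<star> z \<in> J.ipow (Suc k)" using sq J.ipow_antimono Suc.prems by blast
    moreover have "?d + ?d = (y \<star> y - z \<star> z) - ?d \<star> ?w"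
      using y z by (simp add: ga_distribs ga_one_mult comm)
    ultimately have "?d + ?d \<in> J.ipow (Suc k)" using ipow_diff by metis
    then have "single \<one> (1 / 2) \<star> (?d + ?d) \<in> J.ipow (Suc k)"
      by (intro ipow_mult_left) simp_all
    moreover have "single \<one> (1 / 2) \<star> (?d + ?d) = gel \<one> \<star> ?d"
    proof -
      have "single \<one> (1 / 2) \<star> (?d + ?d)
          = (single \<one> (1 / 2) + single \<one> (1 / 2)) \<star> ?d"
        by (simp only: ga_distrib_right ga_distrib_left)
      then show ?thesis by (simp flip: single_add)
    qed
    ultimately show ?case using d(2) by (simp add: ga_one_mult)
  qed
  then show ?thesis by simp
qed

subsection \<open>Rational powers in the completion\<close>

text \<open>At each level some partial sum agrees with both candidate limits, so the
  \<open>THE\<close> is determined.\<close>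

lemma adic_suminf_eq:
  assumes x: "x \<in> carrier J.H"
    and ev: "\<And>n. \<forall>\<^sub>F M in sequentially. finsum J.H u {..<M} n = x n"
  shows "adic_suminf GA J u = x"
  unfolding adic_suminf_def
proof (rule the_equality)
  show "x \<in> carrier J.H \<and> (\<forall>n. \<forall>\<^sub>F M in sequentially. finsum J.H u {..<M} n = x n)"
    using x ev by blast
next
  fix y assume y: "y \<in> carrier J.H \<and> (\<forall>n. \<forall>\<^sub>F M in sequentially. finsum J.H u {..<M} n = y n)"
  show "y = x"
  proof
    fix n
    have "\<forall>\<^sub>F M in sequentially. finsum J.H u {..<M} n = y n \<and> finsum J.H u {..<M} n = x n"
      using y ev by (intro eventually_conj) auto
    then obtain M where "finsum J.H u {..<M} n = y n" "finsum J.H u {..<M} n = x n"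
      by (auto dest: eventually_happens'[OF sequentially_bot])
    then show "y n = x n" by simp
  qed
qed

lemma rat_power_trunc_Suc:
  "rat_power_trunc \<alpha> p (Suc n) = rat_power_trunc \<alpha> p n
    + poly_eval G (gel p - gel \<one>) (Polynomial.monom (\<alpha> gchoose n) n)"
  unfolding rat_power_trunc_def poly_eval_add[symmetric]
  by (simp add: binomial_poly_def)

lemma rat_power_trunc_in_completion:
  assumes "p \<in> carrier G" "gel p - gel \<one> \<in> J"
  shows "(\<lambda>n. J.ipow n +>\<^bsub>GA\<^esub> rat_power_trunc \<alpha> p n) \<in> carrier J.H"
  by (rule J.completion_memI)
    (use assms rat_power_trunc_diff[OF assms(2), of _ "Suc _"] in \<open>auto simp: mem_coset_iff\<close>)

text \<open>The partial sum over n < M is the image of the truncation at M, and modulo J^n the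
  truncations agree from M = n on.\<close>

lemma adic_suminf_binomial:
  assumes p: "p \<in> carrier G" "gel p - gel \<one> \<in> J"
  shows "adic_suminf GA J
      (\<lambda>n. completed_elem G J (\<alpha> gchoose n) \<one> \<otimes>\<^bsub>J.H\<^esub>
        (completed_elem G J 1 p \<ominus>\<^bsub>J.H\<^esub> \<one>\<^bsub>J.H\<^esub>) [^]\<^bsub>J.H\<^esub> n)
    = (\<lambda>n. J.ipow n +>\<^bsub>GA\<^esub> rat_power_trunc \<alpha> p n)"
proof (rule adic_suminf_eq)
  interpret H: ring J.H by (rule J.ring_completion)
  interpret t: ring_hom_ring GA J.H "to_completion GA J" by (rule J.to_completion_hom)
  let ?u = "gel p - gel \<one>" and ?X = "completed_elem G J 1 p \<ominus>\<^bsub>J.H\<^esub> \<one>\<^bsub>J.H\<^esub>"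
  let ?c = "\<lambda>n. completed_elem G J (\<alpha> gchoose n) \<one>"
  show "(\<lambda>n. J.ipow n +>\<^bsub>GA\<^esub> rat_power_trunc \<alpha> p n) \<in> carrier J.H"
    using p by (rule rat_power_trunc_in_completion)
  have "to_completion GA J ?u = to_completion GA J (gel p \<ominus>\<^bsub>GA\<^esub> gel \<one>)"
    using p by (simp add: ga_minus)
  also have "\<dots> = ?X"
    using p t.hom_add[of "gel p" "\<ominus>\<^bsub>GA\<^esub> gel \<one>"] t.hom_a_inv[of "gel \<one>"] t.hom_one
    by (simp add: completed_elem_def a_minus_def ga_a_inv)
  finally have X: "?X = to_completion GA J ?u" by simp
  have Xc: "?X \<in> carrier J.H" using p by simp
  have pow: "?X [^]\<^bsub>J.H\<^esub> n = to_completion GA J (poly_eval G ?u (Polynomial.monom 1 n))" for n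
  proof (induction n)
    case 0
    then show ?case using t.hom_one by (simp add: monom_0 poly_eval_pCons)
  next
    case (Suc n)
    have "?X [^]\<^bsub>J.H\<^esub> Suc n = ?X \<otimes>\<^bsub>J.H\<^esub> ?X [^]\<^bsub>J.H\<^esub> n"
      using Xc by (rule H.nat_pow_Suc2)
    also have "\<dots> = to_completion GA J (?u \<star> poly_eval G ?u (Polynomial.monom 1 n))"
      unfolding Suc unfolding X
      using p t.hom_mult[of ?u "poly_eval G ?u (Polynomial.monom 1 n)"] by simp
    finally show ?case by (simp add: monom_Suc poly_eval_pCons)
  qed
  have term_eq: "?c n \<otimes>\<^bsub>J.H\<^esub> ?X [^]\<^bsub>J.H\<^esub> n
      = to_completion GA J (poly_eval G ?u (Polynomial.monom (\<alpha> gchoose n) n))" for n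
  proof -
    have "poly_eval G ?u (Polynomial.monom (\<alpha> gchoose n) n)
        = single \<one> (\<alpha> gchoose n) \<star> poly_eval G ?u (Polynomial.monom 1 n)"
      using p by (simp flip: poly_eval_smult add: smult_monom)
    then show ?thesis
      using p t.hom_mult[of "single \<one> (\<alpha> gchoose n)" "poly_eval G ?u (Polynomial.monom 1 n)"]
      unfolding pow by (simp add: completed_elem_def)
  qed
  have sum: "finsum J.H (\<lambda>n. ?c n \<otimes>\<^bsub>J.H\<^esub> ?X [^]\<^bsub>J.H\<^esub> n) {..<M}
      = to_completion GA J (rat_power_trunc \<alpha> p M)" for M
  proof (induction M)
    case 0
    then show ?case using t.hom_zero by (simp add: rat_power_trunc_def binomial_poly_def)
  next
    case (Suc M)
    have "finsum J.H (\<lambda>n. ?c n \<otimes>\<^bsub>J.H\<^esub> ?X [^]\<^bsub>J.H\<^esub> n) {..<Suc M}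
      = (?c M \<otimes>\<^bsub>J.H\<^esub> ?X [^]\<^bsub>J.H\<^esub> M) \<oplus>\<^bsub>J.H\<^esub> finsum J.H (\<lambda>n. ?c n \<otimes>\<^bsub>J.H\<^esub> ?X [^]\<^bsub>J.H\<^esub> n) {..<M}"
      unfolding lessThan_Suc using Xc by (intro H.finsum_insert) auto
    also have "\<dots> = to_completion GA J (rat_power_trunc \<alpha> p (Suc M))"
      unfolding Suc unfolding term_eq rat_power_trunc_Suc
      using p t.hom_add[of "poly_eval G ?u (Polynomial.monom (\<alpha> gchoose M) M)" "rat_power_trunc \<alpha> p M"]
      by (simp add: add.commute)
    finally show ?case .
  qed
  show "\<forall>\<^sub>F M in sequentially. finsum J.H (\<lambda>n. ?c n \<otimes>\<^bsub>J.H\<^esub> ?X [^]\<^bsub>J.H\<^esub> n) {..<M} n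
      = J.ipow n +>\<^bsub>GA\<^esub> rat_power_trunc \<alpha> p n" for n
  proof (rule eventually_sequentiallyI[of n])
    fix M assume "n \<le> M"
    then show "finsum J.H (\<lambda>n. ?c n \<otimes>\<^bsub>J.H\<^esub> ?X [^]\<^bsub>J.H\<^esub> n) {..<M} n
      = J.ipow n +>\<^bsub>GA\<^esub> rat_power_trunc \<alpha> p n"
      unfolding sum using p rat_power_trunc_diff[OF p(2)]
      by (simp add: to_completion_def J.ipow_def[symmetric] coset_eq_iff)
  qed
qed

end

section \<open>Augmentation ideals\<close>

lemma ring_rat_ring: "ring rat_ring"
proof (rule ringI)
  show "abelian_group rat_ring"
  proof (rule abelian_groupI)
    fix x assume "x \<in> carrier rat_ring"
    show "\<exists>y\<in>carrier rat_ring. y \<oplus>\<^bsub>rat_ring\<^esub> x = \<zero>\<^bsub>rat_ring\<^esub>"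
      by (intro bexI[of _ "- x"]) (simp_all add: rat_ring_def)
  qed (simp_all add: rat_ring_def)
  show "monoid rat_ring" by (rule monoidI) (simp_all add: rat_ring_def)
qed (simp_all add: rat_ring_def algebra_simps)

context group
begin

lemma augmentation_ideal_iff:
  "a \<in> augmentation_ideal G \<longleftrightarrow> keys a \<subseteq> carrier G \<and> lin (\<lambda>_. 1) a = 0"
  by (auto simp: augmentation_ideal_def a_kernel_def' rat_ring_def augmentation_eq_lin)

lemma group_algebra_ideal_augmentation: "group_algebra_ideal G (augmentation_ideal G)"
proof (intro group_algebra_ideal.intro group_axioms)
  have "ring_hom_ring GA rat_ring augmentation"
  proof (rule ring_hom_ringI2[OF ring_group_algebra ring_rat_ring], rule ring_hom_memI)
    fix a b assume "a \<in> carrier GA" "b \<in> carrier GA"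
    show "augmentation (a \<star> b) = augmentation a \<otimes>\<^bsub>rat_ring\<^esub> augmentation b"
      unfolding augmentation_eq_lin lin_mult(1)
      by (simp add: rat_ring_def) (simp add: lin_def sum_distrib_right)
  qed (simp_all add: augmentation_eq_lin lin_add rat_ring_def)
  then show "ideal (augmentation_ideal G) GA"
    unfolding augmentation_ideal_def by (rule ring_hom_ring.kernel_is_ideal)
qed

end

section \<open>Passage from the subgroup P to the whole group\<close>

context kernel_ideal
begin

abbreviation "PG \<equiv> G\<lparr>carrier := P\<rparr>"

lemma group_PG: "group PG"
  using subgroup_P by (rule subgroup.subgroup_is_group) (rule group_axioms)

text \<open>Each g in P is congruent to 1 modulo J. Consequently the augmentation ideal of Q[P] lies
  in J, and its powers in those of J, which is what the map between the completions
  requires.\<close>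

lemma augmentation_subset:
  assumes "keys a \<subseteq> P"
  shows "a - single \<one> (lin (\<lambda>_. 1) a) \<in> J"
  using assms
proof (induction a rule: poly_mapping_carrier_induct)
  case zero
  then show ?case using ipow_zero[of 1] unfolding J.ipow_1 by simp
next
  case (add g c b)
  have "single \<one> c \<star> (single g 1 - single \<one> 1) \<in> J.ipow 1"
    using P_ideal[OF add(1)] unfolding J.ipow_1 by (intro ipow_mult_left[of _ _ 1, unfolded J.ipow_1]) simp_all
  then have "single g c - single \<one> c \<in> J.ipow 1"
    using add(1) P_carrier by (simp add: ga_distribs subset_iff)
  moreover have "b - single \<one> (lin (\<lambda>_. 1) b) \<in> J.ipow 1"
    using add unfolding J.ipow_1 by simp
  ultimately have "(single g c - single \<one> c)
      + (b - single \<one> (lin (\<lambda>_. 1) b)) \<in> J"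
    using ipow_add J.ipow_1 by metis
  then show ?case by (simp add: lin_add single_add algebra_simps)
qed

sublocale PG: group_algebra_ideal PG "augmentation_ideal PG"
  by (rule group.group_algebra_ideal_augmentation[OF group_PG])

lemma PG_algebra_mult: "a \<otimes>\<^bsub>group_algebra PG\<^esub> b = a \<star> b"
  by (simp add: group_algebra_def)

lemma augmentation_ideal_PG_subset: "augmentation_ideal PG \<subseteq> J"
proof
  fix a assume "a \<in> augmentation_ideal PG"
  then have "keys a \<subseteq> P" "lin (\<lambda>_. 1) a = 0"
    using group.augmentation_ideal_iff[OF group_PG] by auto
  then show "a \<in> J" using augmentation_subset[of a] by simp
qed

lemma PG_ipow_subset: "PG.J.ipow n \<subseteq> J.ipow n"
proof (induction n)
  case 0
  then show ?case using P_carrier by (auto simp: PG.J.ipow_0 J.ipow_0)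
next
  case (Suc n)
  show ?case
    unfolding PG.J.ipow_Suc J.ipow_Suc
  proof
    fix a assume "a \<in> ideal_prod (group_algebra PG) (PG.J.ipow n) (augmentation_ideal PG)"
    then show "a \<in> ideal_prod GA (J.ipow n) J"
    proof (induction a rule: ideal_prod.induct)
      case (prod i j)
      then show ?case
        using ideal_prod.prod[of i "J.ipow n" j J GA] Suc augmentation_ideal_PG_subset
        by (auto simp: PG_algebra_mult)
    next
      case (sum a b)
      then show ?case using ideal_prod.sum[of a GA "J.ipow n" J b] by simp
    qed
  qed
qed

lemma PG_rat_power_trunc: "PG.rat_power_trunc \<alpha> p n = rat_power_trunc \<alpha> p n"
  by (simp add: PG.rat_power_trunc_def rat_power_trunc_def poly_eval_def PG_algebra_mult)

text \<open>Both algebras use the same polynomial in p - 1 as representative; adding J^n to the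
  coset absorbs the power of the smaller ideal.\<close>

lemma completion_map_rat_power:
  assumes p: "p \<in> P"
  shows "completion_map GA J (\<lambda>a. a) (group_rat_power PG p \<alpha>)
    = (\<lambda>n. J.ipow n +>\<^bsub>GA\<^esub> rat_power_trunc \<alpha> p n)"
proof
  fix n
  have "PG.gel p - PG.gel \<one>\<^bsub>PG\<^esub> \<in> augmentation_ideal PG"
    unfolding group.augmentation_ideal_iff[OF group_PG]
    using p subgroup.one_closed[OF subgroup_P] by (simp add: lin_diff keys_diff_subset)
  then have "group_rat_power PG p \<alpha> = (\<lambda>n. PG.J.ipow n +>\<^bsub>group_algebra PG\<^esub> rat_power_trunc \<alpha> p n)"
    using PG.adic_suminf_binomial[of p \<alpha>] p
    by (simp add: group_rat_power_def Let_def PG_rat_power_trunc)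
  then have "completion_map GA J (\<lambda>a. a) (group_rat_power PG p \<alpha>) n
      = J.ipow n <+>\<^bsub>GA\<^esub> (PG.J.ipow n +>\<^bsub>group_algebra PG\<^esub> rat_power_trunc \<alpha> p n)"
    by (simp add: completion_map_def J.ipow_def)
  also have "\<dots> = J.ipow n +>\<^bsub>GA\<^esub> rat_power_trunc \<alpha> p n"
  proof (intro equalityI subsetI)
    fix c assume "c \<in> J.ipow n <+>\<^bsub>GA\<^esub> (PG.J.ipow n +>\<^bsub>group_algebra PG\<^esub> rat_power_trunc \<alpha> p n)"
    then obtain a b where "a \<in> J.ipow n" "b \<in> PG.J.ipow n" "c = a + (b + rat_power_trunc \<alpha> p n)"
      by (auto simp: set_add_def set_mult_def a_r_coset_def r_coset_def)
    moreover have "b \<in> J.ipow n" using \<open>b \<in> PG.J.ipow n\<close> PG_ipow_subset by blast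
    ultimately show "c \<in> J.ipow n +>\<^bsub>GA\<^esub> rat_power_trunc \<alpha> p n"
      using ipow_add[of a n b] by (simp add: mem_coset_iff)
  next
    fix c assume "c \<in> J.ipow n +>\<^bsub>GA\<^esub> rat_power_trunc \<alpha> p n"
    then have "c - rat_power_trunc \<alpha> p n \<in> J.ipow n" by (simp add: mem_coset_iff)
    moreover have "c = (c - rat_power_trunc \<alpha> p n) + (0 + rat_power_trunc \<alpha> p n)" by simp
    moreover have "0 \<in> PG.J.ipow n" by simp
    ultimately show "c \<in> J.ipow n <+>\<^bsub>GA\<^esub> (PG.J.ipow n +>\<^bsub>group_algebra PG\<^esub> rat_power_trunc \<alpha> p n)"
      unfolding set_add_def set_mult_def a_r_coset_def r_coset_def by force
  qed
  finally show "completion_map GA J (\<lambda>a. a) (group_rat_power PG p \<alpha>) n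
      = J.ipow n +>\<^bsub>GA\<^esub> rat_power_trunc \<alpha> p n" .
qed

text \<open>
  A functional of \<open>p\<^sup>\<alpha>\<close> modulo \<open>J\<^sup>N\<close> is a polynomial function of \<open>\<alpha>\<close>. Being group-like is thus an identity
  between polynomials, which holds for the powers of \<open>p\<close>, that is, for all natural numbers \<open>\<alpha>\<close>.
\<close>

lemma lin_rat_power_trunc:
  assumes p: "p \<in> carrier G"
  obtains F where "\<And>\<alpha>. lin f (rat_power_trunc \<alpha> p N) = poly F \<alpha>"
proof
  let ?u = "gel p - gel \<one>"
  fix \<alpha>
  \<comment> \<open>The value is the sum over k < N of f((p - 1)^k) times (\<alpha> choose k), and
    the factors f((p - 1)^k) do not involve \<alpha>.\<close>
  show "lin f (rat_power_trunc \<alpha> p N)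
    = poly (\<Sum>k<N. Polynomial.smult (lin f (poly_eval G ?u (Polynomial.monom 1 k))) (gbinomial_poly k)) \<alpha>"
  proof (induction N)
    case 0
    then show ?case by (simp add: rat_power_trunc_def binomial_poly_def)
  next
    case (Suc N)
    have "poly_eval G ?u (Polynomial.monom (\<alpha> gchoose N) N)
        = single \<one> (\<alpha> gchoose N) \<star> poly_eval G ?u (Polynomial.monom 1 N)"
      using p by (simp flip: poly_eval_smult add: smult_monom)
    then show ?case
      using p Suc by (simp add: rat_power_trunc_Suc lin_add lin_scalar_mult poly_gbinomial_poly)
  qed
qed

lemma rat_power_trunc_of_nat:
  assumes p: "p \<in> carrier G" "gel p - gel \<one> \<in> J"
  shows "gel (p [^] m) - rat_power_trunc (of_nat m) p N \<in> J.ipow N"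
proof -
  let ?u = "gel p - gel \<one>"
  have "poly_eval G ?u ([:1, 1:] ^ m) = gel (p [^] m)"
  proof (induction m)
    case (Suc m)
    have "poly_eval G ?u [:1, 1:] = gel p"
      using p by (simp add: poly_eval_pCons ga_distribs)
    then show ?case using Suc p nat_pow_Suc2[OF p(1)] by (simp only: power_Suc poly_eval_mult keys_gel_diff) simp
  qed simp
  then show ?thesis
    using poly_eval_monom_dvd[OF p(2) binomial_poly_power[of N m]]
    by (simp add: poly_eval_diff rat_power_trunc_def)
qed

lemma grouplike_rat_power_trunc:
  assumes p: "p \<in> P"
  shows "grouplike N (rat_power_trunc \<alpha> p N)"
  unfolding grouplike_def
proof (intro conjI allI impI)
  have pc: "p \<in> carrier G" "gel p - gel \<one> \<in> J" using p P_carrier P_ideal by auto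
  show "keys (rat_power_trunc \<alpha> p N) \<subseteq> carrier G" using pc by simp
  show "lin (\<lambda>_. 1) (rat_power_trunc \<alpha> p N) = 1" if "0 < N"
  proof -
    obtain M where "N = Suc M" using \<open>0 < N\<close> gr0_implies_Suc by blast
    then have "rat_power_trunc \<alpha> p N - gel \<one> \<in> J.ipow 1"
      using rat_power_trunc_mod[OF pc(2)] by (simp add: J.ipow_1 del: One_nat_def)
    from kills_lin_eq[OF kills_const this] show ?thesis by simp
  qed
  fix f h n k assume *: "kills n f" "kills k h" "n + k \<le> N"
  obtain E where E: "\<And>\<alpha>. lin (\<lambda>g. f g * h g) (rat_power_trunc \<alpha> p N) = poly E \<alpha>"
    using lin_rat_power_trunc[OF pc(1)] by blast
  obtain F where F: "\<And>\<alpha>. lin f (rat_power_trunc \<alpha> p N) = poly F \<alpha>"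
    using lin_rat_power_trunc[OF pc(1)] by blast
  obtain H where H: "\<And>\<alpha>. lin h (rat_power_trunc \<alpha> p N) = poly H \<alpha>"
    using lin_rat_power_trunc[OF pc(1)] by blast
  \<comment> \<open>For \<alpha> = m the truncation is congruent to the group element p^m, at which
    the product of two functions is just the product of their values.\<close>
  have "E = F * H"
  proof (rule poly_eq_of_nat)
    fix m
    have eq: "lin u (rat_power_trunc (of_nat m) p N) = u (p [^] m)" if "kills i u" "i \<le> N" for i u
      using kills_lin_eq[OF kills_mono[OF that] rat_power_trunc_of_nat[OF pc]] by simp
    show "poly E (of_nat m) = poly (F * H) (of_nat m)"
      using eq[OF kills_mult[OF *(1,2)] *(3)] eq[OF *(1)] eq[OF *(2)] *(3)
      by (simp flip: E F H)
  qed
  then show "lin (\<lambda>g. f g * h g) (rat_power_trunc \<alpha> p N)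
      = lin f (rat_power_trunc \<alpha> p N) * lin h (rat_power_trunc \<alpha> p N)"
    by (simp add: E F H)
qed

subsection \<open>The elements \<open>b (b\<^sup>2)\<^sup>-\<^sup>1\<^sup>/\<^sup>2\<close>\<close>

abbreviation rsqrt :: "nat \<Rightarrow> 'a \<Rightarrow> 'a \<Rightarrow>\<^sub>0 rat" where
  "rsqrt n p \<equiv> rat_power_trunc (- 1 / 2) p n"

text \<open>The element x_b of the overview; the level n doubles as truncation order, which is
  precise enough modulo J^n.\<close>

definition unitary_part :: "'a \<Rightarrow> nat \<Rightarrow> ('a \<Rightarrow>\<^sub>0 rat) set" where
  "unitary_part b = (\<lambda>n. J.ipow n +>\<^bsub>GA\<^esub> (gel b \<star> rsqrt n (b \<otimes> b)))"

lemma unitary_part_eq: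
  assumes "b \<in> carrier G" "b \<otimes> b \<in> P"
  shows "completed_elem G J 1 b \<otimes>\<^bsub>J.H\<^esub> completion_map GA J (\<lambda>a. a) (group_rat_power PG (b \<otimes> b) (- 1 / 2))
    = unitary_part b"
  using assms P_carrier
  by (auto simp: fun_eq_iff completion_map_rat_power unitary_part_def J.completion_simps
      completed_elem_eq J.Q_coset_simps)

lemma unitary_part_closed:
  assumes "b \<in> carrier G" "b \<otimes> b \<in> P"
  shows "unitary_part b \<in> carrier J.H"
  unfolding unitary_part_def
proof (rule J.completion_memI)
  fix n
  show "gel b \<star> rsqrt n (b \<otimes> b) \<in> carrier GA" using assms by simp
  have "gel b \<star> (rsqrt (Suc n) (b \<otimes> b) - rsqrt n (b \<otimes> b)) \<in> J.ipow n"
    using assms P_ideal by (intro ipow_mult_left rat_power_trunc_diff) simp_all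
  then show "gel b \<star> rsqrt (Suc n) (b \<otimes> b) \<in> J.ipow n +>\<^bsub>GA\<^esub> (gel b \<star> rsqrt n (b \<otimes> b))"
    by (simp add: mem_coset_iff ga_distribs)
qed

lemma unitary_part_mult:
  assumes "a \<in> carrier G" "b \<in> carrier G"
  shows "(unitary_part a \<otimes>\<^bsub>J.H\<^esub> unitary_part b) n
    = J.ipow n +>\<^bsub>GA\<^esub> ((gel a \<star> rsqrt n (a \<otimes> a)) \<star> (gel b \<star> rsqrt n (b \<otimes> b)))"
  using assms by (simp add: J.completion_simps unitary_part_def J.Q_coset_simps)

lemma unitary_part_sq:
  assumes "b \<in> carrier G" "b \<otimes> b \<in> P"
  shows "unitary_part b \<otimes>\<^bsub>J.H\<^esub> unitary_part b = \<one>\<^bsub>J.H\<^esub>"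
proof
  fix n
  let ?r = "rsqrt n (b \<otimes> b)"
  \<comment> \<open>As b commutes with b^2, it commutes with every polynomial in b^2.\<close>
  have c: "?r \<star> gel b = gel b \<star> ?r"
    using assms(1) by (intro rat_power_trunc_intertwine) (simp_all add: m_assoc)
  have "(gel b \<star> ?r) \<star> (gel b \<star> ?r) = (?r \<star> gel b) \<star> (gel b \<star> ?r)" by (simp only: c)
  also have "\<dots> = ?r \<star> ((gel b \<star> gel b) \<star> ?r)"
    using assms by (simp add: ga_assoc del: ga_single_mult)
  also have "(gel b \<star> gel b) \<star> ?r = ?r \<star> gel (b \<otimes> b)"
    using assms rat_power_trunc_intertwine[of "b \<otimes> b" "b \<otimes> b" "b \<otimes> b" "- 1 / 2" n] by simp
  also have "?r \<star> (?r \<star> gel (b \<otimes> b)) = ?r \<star> ?r \<star> gel (b \<otimes> b)"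
    using assms by (simp add: ga_assoc)
  finally have "(gel b \<star> ?r) \<star> (gel b \<star> ?r) - gel \<one> \<in> J.ipow n"
    using rat_power_trunc_sqrt[of "b \<otimes> b" n] P_ideal assms by simp
  then show "(unitary_part b \<otimes>\<^bsub>J.H\<^esub> unitary_part b) n = \<one>\<^bsub>J.H\<^esub> n"
    unfolding unitary_part_mult[OF assms(1,1)] using assms
    by (simp add: J.completion_simps J.Q_one coset_eq_iff)
qed

lemma unitary_part_point:
  assumes "b \<in> carrier G" "b \<otimes> b \<in> P"
  shows "unitary_part b \<in> carrier (completion_points G J)"
  unfolding completion_points_carrier_iff
proof (intro conjI allI ballI)
  show "unitary_part b \<in> Units J.H"
    using unitary_part_closed[OF assms] unitary_part_sq[OF assms] by (auto simp: Units_def)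
  fix N a assume "a \<in> unitary_part b N"
  then have "a - gel b \<star> rsqrt N (b \<otimes> b) \<in> J.ipow N" by (simp add: unitary_part_def mem_coset_iff)
  then show "grouplike N a"
    by (rule grouplike_cong[rotated])
      (intro grouplike_mult grouplike_single grouplike_rat_power_trunc assms)
qed

lemma unitary_part_commuting:
  assumes a: "a \<in> carrier G" "a \<otimes> a \<in> P" and b: "b \<in> carrier G" "b \<otimes> b \<in> P"
    and comm: "a \<otimes> b = b \<otimes> a" and ab: "a \<otimes> b \<otimes> (a \<otimes> b) \<in> P"
  shows "unitary_part a \<otimes>\<^bsub>J.H\<^esub> unitary_part b = unitary_part (a \<otimes> b)"
proof
  fix n
  let ?r = "rsqrt n (a \<otimes> a)" and ?s = "rsqrt n (b \<otimes> b)" and ?t = "rsqrt n (a \<otimes> b \<otimes> (a \<otimes> b))"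
  have aab: "a \<otimes> a \<otimes> b = b \<otimes> (a \<otimes> a)" and abb: "a \<otimes> (b \<otimes> b) = b \<otimes> b \<otimes> a"
    using a b comm by (metis m_assoc)+
  have sqc: "a \<otimes> a \<otimes> (b \<otimes> b) = b \<otimes> b \<otimes> (a \<otimes> a)" using a b aab abb by (metis m_assoc m_closed)
  have prod: "a \<otimes> b \<otimes> (a \<otimes> b) = a \<otimes> a \<otimes> (b \<otimes> b)" using a b comm by (metis m_assoc m_closed)
  have rs: "?r \<star> ?s = ?s \<star> ?r" using a b sqc by (intro rat_power_trunc_commute) simp_all
  have rt: "?r \<star> ?t = ?t \<star> ?r"
    using a b sqc unfolding prod by (intro rat_power_trunc_commute) (simp_all, metis m_assoc m_closed)
  have st: "?s \<star> ?t = ?t \<star> ?s"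
    using a b sqc unfolding prod by (intro rat_power_trunc_commute) (simp_all, metis m_assoc m_closed)
  have left: "(gel a \<star> ?r) \<star> (gel b \<star> ?s) = gel (a \<otimes> b) \<star> (?r \<star> ?s)"
  proof -
    have "?r \<star> gel b = gel b \<star> ?r" using a b aab by (intro rat_power_trunc_intertwine) simp_all
    then have "gel a \<star> (?r \<star> gel b) \<star> ?s = gel a \<star> (gel b \<star> ?r) \<star> ?s" by simp
    then have "(gel a \<star> ?r) \<star> (gel b \<star> ?s) = (gel a \<star> gel b) \<star> (?r \<star> ?s)"
      using a b by (simp add: ga_assoc del: ga_single_mult)
    then show ?thesis by simp
  qed
  have "?r \<star> ?s - ?t \<in> J.ipow n"
  \<comment> \<open>Modulo J^0 there is nothing to show; for n > 0 the truncations are congruent to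
    1 modulo J, as uniqueness of square roots requires.\<close>
  proof (cases n)
    case 0
    then show ?thesis using a b keys_diff_subset[of "?r \<star> ?s" "carrier G" ?t] by (simp add: J.ipow_0)
  next
    case (Suc m)
    have Pi: "gel p - gel \<one> \<in> J" if "p \<in> P" for p using P_ideal[OF that] .
    have r1: "?r - gel \<one> \<in> J" "?s - gel \<one> \<in> J" "?t - gel \<one> \<in> J"
      unfolding Suc using rat_power_trunc_mod Pi a b ab by auto
    have "?r \<star> (?s - gel \<one>) \<in> J.ipow 1" using r1(2) a by (intro ipow_mult_left) (simp_all only: J.ipow_1, simp)
    then have rs1: "?r \<star> ?s - gel \<one> \<in> J"
      using r1(1) a ipow_add[of "?r \<star> (?s - gel \<one>)" 1 "?r - gel \<one>"] J.ipow_1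
      by (simp add: ga_distribs ga_one_mult del: One_nat_def)
    have r2: "?r \<star> ?r \<star> gel (a \<otimes> a) - gel \<one> \<in> J.ipow n" "?s \<star> ?s \<star> gel (b \<otimes> b) - gel \<one> \<in> J.ipow n"
      "?t \<star> ?t \<star> gel (a \<otimes> b \<otimes> (a \<otimes> b)) - gel \<one> \<in> J.ipow n"
      using rat_power_trunc_sqrt Pi a b ab by auto
    let ?R = "?r \<star> ?r \<star> gel (a \<otimes> a)" and ?S = "?s \<star> ?s \<star> gel (b \<otimes> b)"
    \<comment> \<open>Here (rs)^2 (ab)^2 is the product of r^2 a^2 and s^2 b^2, both congruent to 1.
      Comparison with t^2 (ab)^2 and cancellation of the unit (ab)^2 show that rs and t have
      congruent squares.\<close>
    have "?r \<star> ?s \<star> (?r \<star> ?s) \<star> gel (a \<otimes> b \<otimes> (a \<otimes> b)) = ?R \<star> ?S"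
    proof -
      have c: "gel (a \<otimes> a) \<star> ?s = ?s \<star> gel (a \<otimes> a)"
        using a b sqc by (intro rat_power_trunc_intertwine[symmetric]) simp_all
      have g: "gel (a \<otimes> b \<otimes> (a \<otimes> b)) = gel (a \<otimes> a) \<star> gel (b \<otimes> b)" by (simp add: prod)
      have "?R \<star> ?S = ?r \<star> ?r \<star> ((gel (a \<otimes> a) \<star> ?s) \<star> ?s) \<star> gel (b \<otimes> b)"
        using a b by (simp add: ga_assoc del: ga_single_mult)
      also have "(gel (a \<otimes> a) \<star> ?s) \<star> ?s = ?s \<star> (gel (a \<otimes> a) \<star> ?s)"
        using ga_assoc[of ?s "gel (a \<otimes> a)" ?s] a b by (simp only: c) simp
      also have "\<dots> = ?s \<star> (?s \<star> gel (a \<otimes> a))" by (simp only: c)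
      also have "?r \<star> ?r \<star> (?s \<star> (?s \<star> gel (a \<otimes> a))) \<star> gel (b \<otimes> b)
          = ?r \<star> (?r \<star> ?s) \<star> ?s \<star> gel (a \<otimes> b \<otimes> (a \<otimes> b))"
        unfolding g using a b by (simp add: ga_assoc del: ga_single_mult)
      also have "\<dots> = ?r \<star> ?s \<star> (?r \<star> ?s) \<star> gel (a \<otimes> b \<otimes> (a \<otimes> b))"
      proof -
        have "?r \<star> (?r \<star> ?s) \<star> ?s = ?r \<star> (?s \<star> ?r) \<star> ?s" by (simp only: rs)
        also have "\<dots> = ?r \<star> ?s \<star> (?r \<star> ?s)" using a b by (simp add: ga_assoc)
        finally show ?thesis by simp
      qed
      finally show ?thesis by simp
    qed
    moreover have "?R \<star> ?S - gel \<one> \<in> J.ipow n"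
    proof -
      have "?R \<star> (?S - gel \<one>) + (?R - gel \<one>) \<in> J.ipow n"
        using r2 a b by (intro ipow_add ipow_mult_left) simp_all
      then show ?thesis using a b by (simp add: ga_distribs ga_one_mult)
    qed
    ultimately have "?r \<star> ?s \<star> (?r \<star> ?s) \<star> gel (a \<otimes> b \<otimes> (a \<otimes> b)) - ?t \<star> ?t \<star> gel (a \<otimes> b \<otimes> (a \<otimes> b)) \<in> J.ipow n"
      using ipow_diff[OF _ r2(3)] by fastforce
    then have "(?r \<star> ?s \<star> (?r \<star> ?s) - ?t \<star> ?t) \<star> gel (a \<otimes> b \<otimes> (a \<otimes> b)) \<in> J.ipow n"
      by (simp add: ga_distribs)
    then have "(?r \<star> ?s \<star> (?r \<star> ?s) - ?t \<star> ?t) \<star> gel (a \<otimes> b \<otimes> (a \<otimes> b)) \<star> gel (inv (a \<otimes> b \<otimes> (a \<otimes> b))) \<in> J.ipow n"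
      by (rule ipow_mult_right[rotated]) (use a b in simp)
    moreover have "keys (?r \<star> ?s \<star> (?r \<star> ?s) - ?t \<star> ?t) \<subseteq> carrier G"
      using a b by (intro keys_diff_subset) simp_all
    ultimately have "?r \<star> ?s \<star> (?r \<star> ?s) - ?t \<star> ?t \<in> J.ipow n"
      using a b by (simp only: ga_assoc keys_gel m_closed inv_closed)
        (simp add: ga_one_mult)
    then show ?thesis
    proof (rule unipotent_sqrt_unique[OF _ rs1 _ r1(3), rotated -1])
      show "?r \<star> ?s \<star> ?t = ?t \<star> (?r \<star> ?s)"
        using a b rt st by (metis ga_assoc rat_power_trunc_closed m_closed)
    qed (use a b in simp_all)
  qed
  then have "gel (a \<otimes> b) \<star> (?r \<star> ?s - ?t) \<in> J.ipow n"
    using a b by (intro ipow_mult_left) simp_all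
  then show "(unitary_part a \<otimes>\<^bsub>J.H\<^esub> unitary_part b) n = unitary_part (a \<otimes> b) n"
    using a b unfolding unitary_part_mult[OF a(1) b(1)] left
    by (simp add: unitary_part_def coset_eq_iff ga_distribs)
qed

lemma unitary_part_conj:
  assumes a: "a \<in> carrier G" and a': "a' \<in> carrier G" and b: "b \<in> carrier G"
    and conj: "a \<otimes> b = b \<otimes> a'" "b \<otimes> a = a' \<otimes> b"
  shows "unitary_part a \<otimes>\<^bsub>J.H\<^esub> unitary_part b = unitary_part b \<otimes>\<^bsub>J.H\<^esub> unitary_part a'"
proof
  fix n
  let ?r = "rsqrt n (a \<otimes> a)" and ?r' = "rsqrt n (a' \<otimes> a')" and ?s = "rsqrt n (b \<otimes> b)"
  have 1: "a \<otimes> a \<otimes> b = b \<otimes> (a' \<otimes> a')" using a a' b conj by (metis m_assoc)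
  \<comment> \<open>Both relations enter: b b a' = b a b = a' b b. Thus b^2 commutes with a',
    although b itself may not.\<close>
  have 2: "b \<otimes> b \<otimes> a' = a' \<otimes> (b \<otimes> b)" using a a' b conj by (metis m_assoc)
  have 3: "b \<otimes> b \<otimes> (a' \<otimes> a') = a' \<otimes> a' \<otimes> (b \<otimes> b)" using a' b 2 by (metis m_assoc m_closed)
  have i1: "?r \<star> gel b = gel b \<star> ?r'" using a a' b 1 by (intro rat_power_trunc_intertwine) simp_all
  have i2: "?s \<star> gel a' = gel a' \<star> ?s" using a' b 2 by (intro rat_power_trunc_intertwine) simp_all
  have i3: "?s \<star> ?r' = ?r' \<star> ?s" using a' b 3 by (intro rat_power_trunc_commute) simp_all
  have "(gel a \<star> ?r) \<star> (gel b \<star> ?s) = gel a \<star> (?r \<star> gel b) \<star> ?s"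
    using a a' b by (simp add: ga_assoc del: ga_single_mult)
  also have "\<dots> = (gel a \<star> gel b) \<star> (?r' \<star> ?s)"
    unfolding i1 using a a' b by (simp add: ga_assoc del: ga_single_mult)
  also have "\<dots> = (gel b \<star> gel a') \<star> (?s \<star> ?r')"
    by (simp only: conj(1) i3 ga_single_mult)
  also have "\<dots> = gel b \<star> (gel a' \<star> ?s) \<star> ?r'"
    using a a' b by (simp add: ga_assoc del: ga_single_mult)
  also have "\<dots> = (gel b \<star> ?s) \<star> (gel a' \<star> ?r')"
    unfolding i2[symmetric] using a a' b by (simp add: ga_assoc del: ga_single_mult)
  finally show "(unitary_part a \<otimes>\<^bsub>J.H\<^esub> unitary_part b) n = (unitary_part b \<otimes>\<^bsub>J.H\<^esub> unitary_part a') n"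
    by (simp only: unitary_part_mult[OF a b] unitary_part_mult[OF b a'])
qed

end

section \<open>From the cactus group to the completed braid group\<close>

lemma kernel_ideal_of_hom:
  fixes G :: "('g, 'm) monoid_scheme"
  assumes G: "group G" and H: "group H" and \<pi>: "\<pi> \<in> hom G H"
  shows "kernel_ideal G (a_kernel (group_algebra G) (group_algebra H) (group_algebra_map \<pi>))
    (kernel G H \<pi>)"
proof -
  interpret \<pi>: group_hom G H \<pi> using assms by (simp add: group_hom_def group_hom_axioms_def)
  interpret r: ring_hom_ring "group_algebra G" "group_algebra H" "group_algebra_map \<pi>"
    using assms by (rule group_algebra_map_ring_hom)
  let ?J = "a_kernel (group_algebra G) (group_algebra H) (group_algebra_map \<pi>)"
  have J: "a \<in> ?J \<longleftrightarrow> keys a \<subseteq> carrier G \<and> group_algebra_map \<pi> a = 0" for a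
    by (simp only: a_kernel_def' ga_simps mem_Collect_eq)
  show ?thesis
  proof (intro kernel_ideal.intro group_algebra_ideal.intro kernel_ideal_axioms.intro)
    show "group G" by (rule G)
    show "ideal ?J (group_algebra G)" by (rule r.kernel_is_ideal)
    show "subgroup (kernel G H \<pi>) G" by (rule \<pi>.subgroup_kernel)
    show "single p 1 - single \<one>\<^bsub>G\<^esub> 1 \<in> ?J" if "p \<in> kernel G H \<pi>" for p
      using that unfolding J by (simp add: kernel_def group_algebra_map_diff keys_diff_subset)
  next
    fix f :: "'g \<Rightarrow> rat" and j assume f: "\<And>h p. h \<in> carrier G \<Longrightarrow> p \<in> kernel G H \<pi> \<Longrightarrow> f (h \<otimes>\<^bsub>G\<^esub> p) = f h"
      and j: "j \<in> ?J"
    \<comment> \<open>An arbitrary choice of preimages: f is constant on the cosets of the kernel,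
      so f factors as f' after \<pi>, and f(j) = f'(\<pi>(j)) = 0.\<close>
    define f' where "f' = (\<lambda>w. f (SOME g. g \<in> carrier G \<and> \<pi> g = w))"
    have "f g = f' (\<pi> g)" if g: "g \<in> carrier G" for g
    proof -
      define r where "r = (SOME r. r \<in> carrier G \<and> \<pi> r = \<pi> g)"
      have r: "r \<in> carrier G" "\<pi> r = \<pi> g"
        using someI[of "\<lambda>r. r \<in> carrier G \<and> \<pi> r = \<pi> g" g] g unfolding r_def by auto
      have "inv\<^bsub>G\<^esub> r \<otimes>\<^bsub>G\<^esub> g \<in> kernel G H \<pi>" using r g by (simp add: kernel_def)
      then have "f (r \<otimes>\<^bsub>G\<^esub> (inv\<^bsub>G\<^esub> r \<otimes>\<^bsub>G\<^esub> g)) = f r" using f r by blast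
      moreover have "r \<otimes>\<^bsub>G\<^esub> (inv\<^bsub>G\<^esub> r \<otimes>\<^bsub>G\<^esub> g) = g" using r g by (simp flip: \<pi>.G.m_assoc)
      ultimately show ?thesis by (simp add: f'_def r_def)
    qed
    then have "lin f j = lin f' (group_algebra_map \<pi> j)"
      unfolding lin_group_algebra_map using j J by (intro lin_cong) auto
    then show "lin f j = 0" using j J by simp
  qed
qed

context coxeter_group
begin

abbreviation "pure \<equiv> kernel B W (braid_proj W)"

sublocale K: kernel_ideal B "braid_ideal W S" pure
  unfolding braid_ideal_def
  by (rule kernel_ideal_of_hom[OF group_braid_group group_axioms braid_proj_hom])

lemma braid_longest_sq_pure:
  assumes "spherical W S I"
  shows "braid_longest W S I \<otimes>\<^bsub>B\<^esub> braid_longest W S I \<in> pure"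
  using assms hom_mult[OF braid_proj_hom, of "braid_longest W S I" "braid_longest W S I"]
  by (simp add: kernel_def)

lemma cactus_image_eq:
  assumes "spherical W S I"
  shows "cactus_image W S I = K.unitary_part (braid_longest W S I)"
  using K.unitary_part_eq[OF braid_longest_closed[OF assms] braid_longest_sq_pure[OF assms]]
  by (simp add: cactus_image_def Let_def braid_to_hat_def braid_algebra_hat_def
      pure_to_braid_hat_def pure_braid_group_def)

abbreviation "Bhat \<equiv> braid_group_hat W S"

lemma group_Bhat: "group Bhat"
  unfolding braid_group_hat_def by (rule K.group_completion_points)

sublocale Bhat: group Bhat
  by (rule group_Bhat)

lemma Bhat_simps:
  "x \<otimes>\<^bsub>Bhat\<^esub> y = x \<otimes>\<^bsub>K.J.H\<^esub> y" "\<one>\<^bsub>Bhat\<^esub> = \<one>\<^bsub>K.J.H\<^esub>"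
  by (simp_all add: braid_group_hat_def K.completion_points_simps)

lemma cactus_image_closed [simp]: "spherical W S I \<Longrightarrow> cactus_image W S I \<in> carrier Bhat"
  using K.unitary_part_point braid_longest_sq_pure
  by (simp add: cactus_image_eq braid_group_hat_def)

lemma cactus_image_sq: "spherical W S I \<Longrightarrow> cactus_image W S I \<otimes>\<^bsub>Bhat\<^esub> cactus_image W S I = \<one>\<^bsub>Bhat\<^esub>"
  using K.unitary_part_sq braid_longest_sq_pure
  by (simp add: cactus_image_eq Bhat_simps)

lemma cactus_image_direct_prod:
  assumes "spherical W S I" "spherical W S J" "spherical W S (I \<union> J)"
    "parabolic_direct_prod W (I \<union> J) I J"
  shows "cactus_image W S I \<otimes>\<^bsub>Bhat\<^esub> cactus_image W S J = cactus_image W S (I \<union> J)"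
proof -
  note b = braid_longest_direct_prod[OF assms]
  show ?thesis
    unfolding cactus_image_eq[OF assms(1)] cactus_image_eq[OF assms(2)] cactus_image_eq[OF assms(3)]
      Bhat_simps b(1)
    by (rule K.unitary_part_commuting[OF _ _ _ _ b(2)])
      (use assms braid_longest_sq_pure[OF assms(3)] in \<open>simp_all add: braid_longest_sq_pure b(1)\<close>)
qed

lemma cactus_image_conj:
  assumes J: "spherical W S J" and I: "I \<subseteq> J" "spherical W S I" and w: "w = longest J"
  defines "I' \<equiv> (\<lambda>s. w \<otimes> s \<otimes> w) ` I"
  shows "cactus_image W S I \<otimes>\<^bsub>Bhat\<^esub> cactus_image W S J = cactus_image W S J \<otimes>\<^bsub>Bhat\<^esub> cactus_image W S I'"
proof -
  have c: "w \<in> carrier W" "w \<otimes> w = \<one>" using J w by auto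
  have I': "I' \<subseteq> J" "spherical W S I'"
    using conj_longest_gen[OF J w] conj_longest_spherical[OF J w I] I unfolding I'_def by auto
  have "w \<otimes> (w \<otimes> s \<otimes> w) \<otimes> w = s" if "s \<in> I" for s
  proof -
    have s: "s \<in> carrier W" using that I J spherical_subset gens_closed by blast
    have "w \<otimes> (w \<otimes> s \<otimes> w) \<otimes> w = (w \<otimes> w) \<otimes> s \<otimes> (w \<otimes> w)"
      using c(1) s by (simp only: m_assoc m_closed)
    then show ?thesis using c s by simp
  qed
  \<comment> \<open>Conjugation by w is an involution, so \<open>braid_longest_conj\<close> applied
    to I' leads back to I; this is the second relation needed for
    \<open>unitary_part_conj\<close>.\<close>
  then have I'': "(\<lambda>s. w \<otimes> s \<otimes> w) ` I' = I"
    unfolding I'_def image_image by simp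
  show ?thesis
    unfolding cactus_image_eq[OF I(2)] cactus_image_eq[OF J] cactus_image_eq[OF I'(2)] Bhat_simps
    by (rule K.unitary_part_conj)
      (use I I' J braid_longest_conj[OF J I w] braid_longest_conj[OF J I' w] I'' in
        \<open>simp_all add: I'_def[symmetric]\<close>)
qed

section \<open>Relations and homomorphisms of the cactus group\<close>

abbreviation "Sph \<equiv> {I. spherical W S I}"

lemma cactus_relation_cases:
  assumes "(l, r) \<in> cactus_relations W S"
  obtains I where "spherical W S I" "l = pos_word [I, I]" "r = []"
  | I J where "spherical W S I" "spherical W S J" "spherical W S (I \<union> J)"
      "parabolic_direct_prod W (I \<union> J) I J" "l = pos_word [I, J]" "r = pos_word [I \<union> J]"
  | I J w where "spherical W S I" "spherical W S J" "I \<subseteq> J" "w = longest J"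
      "l = pos_word [I, J]" "r = pos_word [J, (\<lambda>s. w \<otimes> s \<otimes> w) ` I]"
  using assms unfolding cactus_relations_def by blast

lemma cactus_relation_Bhat:
  assumes "(l, r) \<in> cactus_relations W S"
  shows "word_eval Bhat (cactus_image W S) l = word_eval Bhat (cactus_image W S) r"
  using assms
proof (cases rule: cactus_relation_cases)
  case (1 I)
  then show ?thesis by (simp add: cactus_image_sq)
next
  case (2 I J)
  then show ?thesis by (simp add: cactus_image_direct_prod)
next
  case (3 I J w)
  then have "spherical W S ((\<lambda>s. w \<otimes> s \<otimes> w) ` I)" using conj_longest_spherical by blast
  then show ?thesis using 3 cactus_image_conj[of J I w] by simp
qed

lemma cactus_relation_W:
  assumes "(l, r) \<in> cactus_relations W S"
  shows "word_eval W (longest) l = word_eval W (longest) r"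
  using assms
proof (cases rule: cactus_relation_cases)
  case (1 I)
  then show ?thesis by simp
next
  case (2 I J)
  then show ?thesis by (simp add: longest_elem_direct_prod(1))
next
  case (3 I J w)
  have c: "w \<in> carrier W" "w \<otimes> w = \<one>" "longest I \<in> carrier W" using 3 by auto
  have "w \<otimes> (w \<otimes> longest I \<otimes> w) = (w \<otimes> w) \<otimes> longest I \<otimes> w"
    using c(1,3) by (simp only: m_assoc m_closed)
  then show ?thesis using 3 c conj_longest_longest[of J w I] by simp
qed

abbreviation "cactus_class \<equiv> word_class Sph (cactus_relations W S)"

lemma cactus_proj_class:
  "u \<in> gwords Sph \<Longrightarrow> cactus_proj W S (cactus_class u)
    = word_eval W (longest) u"
  unfolding cactus_proj_def
  by (rule presented_lift_class) (use cactus_relation_W in auto)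

lemma cactus_gen_eq: "cactus_gen W S I = cactus_class [(I, True)]"
  by (simp add: cactus_gen_def)

lemma cactus_gen_closed: "spherical W S I \<Longrightarrow> cactus_gen W S I \<in> carrier (cactus_group W S)"
  by (auto simp: cactus_gen_eq cactus_group_def presented_carrier)

lemma group_cactus_group: "group (cactus_group W S)"
  by (simp add: cactus_group_def group_presented_group)

text \<open>Serves both the uniqueness of \<phi> and the comparison of the projections, where \<phi>
  is an arbitrary homomorphism with the given values.\<close>

lemma cactus_hom_eval:
  assumes \<phi>: "\<phi> \<in> hom (cactus_group W S) Bhat"
    and gen: "\<And>I. spherical W S I \<Longrightarrow> \<phi> (cactus_gen W S I) = cactus_image W S I"
    and u: "u \<in> gwords Sph"
  shows "\<phi> (cactus_class u) = word_eval Bhat (cactus_image W S) u"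
proof -
  have "\<phi> (cactus_class u)
      = word_eval Bhat (\<lambda>I. \<phi> (cactus_class [(I, True)])) u"
    using Bhat.presented_hom_eval[OF \<phi>[unfolded cactus_group_def] u] .
  also have "\<dots> = word_eval Bhat (cactus_image W S) u"
    using u by (induction u) (auto simp: gen simp flip: cactus_gen_eq)
  finally show ?thesis .
qed

section \<open>Compatibility with the projections to W\<close>

lemma braid_hat_proj_eq:
  assumes x: "x \<in> carrier K.J.H" and a: "a \<in> x 1" "group_algebra_map (braid_proj W) a = single w 1"
    and w: "w \<in> carrier W"
  shows "braid_hat_proj W x = w"
proof -
  have ker: "group_algebra_map (braid_proj W) j = 0" if "j \<in> braid_ideal W S" for j
    using that by (simp add: braid_ideal_def a_kernel_def')
  \<comment> \<open>The set \<open>x 1\<close> is a coset of the ideal, which the map to Q[W]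
    annihilates, so one representative determines the image.\<close>
  have "group_algebra_map (braid_proj W) b = single w 1" if "b \<in> x 1" for b
    using K.completion_diff[OF x that a(1) order_refl order_refl] ker[of "b - a"] a(2)
    by (simp add: K.J.ipow_1 group_algebra_map_diff del: One_nat_def)
  then have "group_algebra_map (braid_proj W) ` x 1 = (\<lambda>_. single w 1) ` x 1"
    by (rule image_cong[OF HOL.refl])
  then have img: "group_algebra_map (braid_proj W) ` x 1 = {single w 1}"
    using a(1) by (simp add: image_constant)
  show ?thesis
    unfolding braid_hat_proj_def img
  proof (rule the_equality)
    fix v assume "v \<in> carrier W \<and> {single w (1 :: rat)} = {single v 1}"
    then have "keys (single w (1 :: rat)) = keys (single v (1 :: rat))"
      by simp
    then show "v = w" by simp
  qed (use w in simp)
qed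

lemma Bhat_carrier: "x \<in> carrier Bhat \<Longrightarrow> x \<in> carrier K.J.H"
  by (auto simp: braid_group_hat_def K.completion_points_carrier_iff Units_def)

lemma cactus_image_level_one:
  assumes I: "spherical W S I"
  obtains a where "a \<in> cactus_image W S I 1"
    "group_algebra_map (braid_proj W) a = single (longest I) 1"
proof -
  let ?b = "braid_longest W S I"
  let ?a = "K.gel ?b \<otimes>\<^bsub>group_algebra B\<^esub> K.rsqrt 1 (?b \<otimes>\<^bsub>B\<^esub> ?b)"
  \<comment> \<open>At level 1 only the constant term of the binomial series is left, so \<beta>_I
    itself is a representative.\<close>
  have "binomial_poly (- 1 / 2) 1 = 1" by (simp add: binomial_poly_def monom_0 one_pCons)
  then have "K.rsqrt 1 (?b \<otimes>\<^bsub>B\<^esub> ?b) = K.gel \<one>\<^bsub>B\<^esub>"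
    by (simp only: K.rat_power_trunc_def K.poly_eval_1)
  then have a: "?a = K.gel ?b" using I by simp
  have "K.gel ?b \<in> cactus_image W S I 1"
    unfolding cactus_image_eq[OF I] K.unitary_part_def a by (simp add: K.mem_coset_iff)
  then show thesis by (rule that) (use I in simp)
qed

lemma word_eval_level_one:
  assumes "u \<in> gwords Sph"
  shows "\<exists>a\<in>word_eval Bhat (cactus_image W S) u 1.
    group_algebra_map (braid_proj W) a = single (word_eval W (longest) u) 1"
  using assms
proof (induction u)
  case Nil
  have "K.gel \<one>\<^bsub>B\<^esub> \<in> \<one>\<^bsub>Bhat\<^esub> 1"
    by (simp add: Bhat_simps K.J.completion_simps K.J.Q_one K.mem_coset_iff)
  moreover have "braid_proj W \<one>\<^bsub>B\<^esub> = \<one>"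
    using hom_one[OF braid_proj_hom group_braid_group group_axioms] .
  ultimately show ?case by (intro bexI[of _ "K.gel \<one>\<^bsub>B\<^esub>"]) simp_all
next
  case (Cons p u)
  obtain I e where p: "p = (I, e)" by force
  have I: "spherical W S I" and u: "u \<in> gwords Sph" using Cons.hyps p by auto
  let ?x = "cactus_image W S I" and ?y = "word_eval Bhat (cactus_image W S) u"
  have xc: "?x \<in> carrier Bhat" using I by simp
  have yc: "?y \<in> carrier Bhat"
    by (rule Bhat.word_eval_closed[OF _ u]) auto
  \<comment> \<open>Images of generators are involutions, as are the longest elements, so a formal
    inverse takes the same values as its generator.\<close>
  have "inv\<^bsub>Bhat\<^esub> ?x = ?x" using cactus_image_sq[OF I] xc by (intro Bhat.inv_equality)
  then have ev: "word_eval Bhat (cactus_image W S) (p # u) = ?x \<otimes>\<^bsub>K.J.H\<^esub> ?y"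
    "word_eval W (longest) (p # u) = longest I \<otimes> word_eval W (longest) u"
    using I by (simp_all add: p Bhat_simps)
  obtain a where a: "a \<in> ?x 1" "group_algebra_map (braid_proj W) a = single (longest I) 1"
    using cactus_image_level_one[OF I] .
  obtain b where b: "b \<in> ?y 1"
    "group_algebra_map (braid_proj W) b = single (word_eval W (longest) u) 1"
    using Cons.IH by blast
  note c = Bhat_carrier[OF xc] Bhat_carrier[OF yc]
  have ab: "keys a \<subseteq> carrier B" "keys b \<subseteq> carrier B"
    using K.J.completion_carrier c a(1) b(1) by auto
  have "a \<otimes>\<^bsub>group_algebra B\<^esub> b \<in> (?x \<otimes>\<^bsub>K.J.H\<^esub> ?y) 1"
    unfolding K.completion_mult_coset[OF c a(1) b(1)] by (simp add: K.mem_coset_iff)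
  moreover have "group_algebra_map (braid_proj W) (a \<otimes>\<^bsub>group_algebra B\<^esub> b)
      = single (longest I \<otimes> word_eval W (longest) u) 1"
    using group_algebra_map_mult[OF group_braid_group group_axioms braid_proj_hom ab] a b by simp
  ultimately show ?case unfolding ev by blast
qed

lemma braid_hat_proj_cactus:
  assumes \<phi>: "\<phi> \<in> hom (cactus_group W S) Bhat"
    and gen: "\<And>I. spherical W S I \<Longrightarrow> \<phi> (cactus_gen W S I) = cactus_image W S I"
    and c: "c \<in> carrier (cactus_group W S)"
  shows "braid_hat_proj W (\<phi> c) = cactus_proj W S c"
proof -
  obtain u where u: "u \<in> gwords Sph" "c = cactus_class u"
    using c by (auto simp: cactus_group_def presented_carrier)
  have \<phi>c: "\<phi> c = word_eval Bhat (cactus_image W S) u"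
    using cactus_hom_eval[OF \<phi> gen u(1)] u(2) by simp
  obtain a where "a \<in> \<phi> c 1"
    "group_algebra_map (braid_proj W) a = single (word_eval W (longest) u) 1"
    using word_eval_level_one[OF u(1)] unfolding \<phi>c by blast
  moreover have "word_eval W (longest) u \<in> carrier W"
    by (rule word_eval_closed[OF _ u(1)]) auto
  moreover have "\<phi> c \<in> carrier K.J.H" using hom_in_carrier[OF \<phi> c] by (rule Bhat_carrier)
  ultimately show ?thesis using braid_hat_proj_eq cactus_proj_class[OF u(1)] u(2) by simp
qed

lemma cactus_hom_exists:
  "\<exists>\<phi>. \<phi> \<in> extensional (carrier (cactus_group W S)) \<and> \<phi> \<in> hom (cactus_group W S) Bhat
    \<and> (\<forall>I. spherical W S I \<longrightarrow> \<phi> (cactus_gen W S I) = cactus_image W S I)"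
proof (intro exI conjI allI impI)
  let ?\<psi> = "presented_lift Bhat (cactus_image W S)"
  \<comment> \<open>The lift is cut off outside the carrier, where the homomorphism property imposes
    no condition.\<close>
  let ?\<phi> = "restrict ?\<psi> (carrier (cactus_group W S))"
  have f: "cactus_image W S \<in> Sph \<rightarrow> carrier Bhat" by auto
  have hom: "?\<psi> \<in> hom (cactus_group W S) Bhat"
    unfolding cactus_group_def by (rule Bhat.presented_lift_hom[OF f cactus_relation_Bhat])
  show "?\<phi> \<in> extensional (carrier (cactus_group W S))" by simp
  show "?\<phi> \<in> hom (cactus_group W S) Bhat"
    using hom group.is_monoid[OF group_cactus_group]
    by (auto simp: hom_def Pi_iff monoid.m_closed)
  show "?\<phi> (cactus_gen W S I) = cactus_image W S I" if I: "spherical W S I" for I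
    using Bhat.presented_lift_class[OF f cactus_relation_Bhat, where u = "[(I, True)]"] I
    by (simp add: cactus_gen_closed) (simp add: cactus_gen_eq)
qed

end

text \<open>Homomorphisms are functions on a whole type, so uniqueness is asserted among those
  normalised by \<open>extensional\<close>.\<close>

theorem proposition2p1:
  fixes W (structure) and S :: "'a set"
  assumes "coxeter_group W S" and "finite S"
  shows "(\<exists>!\<phi>. \<phi> \<in> extensional (carrier (cactus_group W S))
            \<and> group_hom (cactus_group W S) (braid_group_hat W S) \<phi>
            \<and> (\<forall>I. spherical W S I \<longrightarrow> \<phi> (cactus_gen W S I) = cactus_image W S I))
       \<and> (\<forall>\<phi>. group_hom (cactus_group W S) (braid_group_hat W S) \<phi>
            \<and> (\<forall>I. spherical W S I \<longrightarrow> \<phi> (cactus_gen W S I) = cactus_image W S I)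
            \<longrightarrow> (\<forall>c \<in> carrier (cactus_group W S).
                   braid_hat_proj W (\<phi> c) = cactus_proj W S c))"
proof -
  interpret coxeter_group W S by (rule assms(1))
  have hom_iff: "group_hom (cactus_group W S) (braid_group_hat W S) \<phi>
      \<longleftrightarrow> \<phi> \<in> hom (cactus_group W S) (braid_group_hat W S)" for \<phi>
    using group_cactus_group group_Bhat by (simp add: group_hom_def group_hom_axioms_def)
  have unique: "\<phi> = \<psi>"
    if \<phi>: "\<phi> \<in> extensional (carrier (cactus_group W S)) \<and> \<phi> \<in> hom (cactus_group W S) (braid_group_hat W S)
        \<and> (\<forall>I. spherical W S I \<longrightarrow> \<phi> (cactus_gen W S I) = cactus_image W S I)"
      and \<psi>: "\<psi> \<in> extensional (carrier (cactus_group W S)) \<and> \<psi> \<in> hom (cactus_group W S) (braid_group_hat W S)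
        \<and> (\<forall>I. spherical W S I \<longrightarrow> \<psi> (cactus_gen W S I) = cactus_image W S I)" for \<phi> \<psi>
  proof (rule extensionalityI)
    fix c assume "c \<in> carrier (cactus_group W S)"
    then obtain u where "u \<in> gwords Sph" "c = cactus_class u"
      by (auto simp: cactus_group_def presented_carrier)
    then show "\<phi> c = \<psi> c" using cactus_hom_eval[of _ u] \<phi> \<psi> by simp
  qed (use \<phi> \<psi> in blast)+
  show ?thesis
    unfolding hom_iff using cactus_hom_exists unique braid_hat_proj_cactus by (intro conjI ex_ex1I) blast+
qed

end
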